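(* For every positive integer $n$, the map $\Phi_{\mathcal{B}}$ (the restriction of $\phi$ to Baxter tree-like tableaux) is a bijection from $\mathcal{T}_n$ onto $\mathcal{B}_n$, the set of inverses of twisted Baxter permutations of size $n$.
   Context: Ferrers diagrams are drawn in English notation: left-justified rows of unit cells whose lengths weakly decrease from top to bottom. A tree-like tableau (TLT) is a nonempty Ferrers diagram each of whose cells is either empty or pointed, such that: (1) the top-left cell is pointed (the root point); (2) for every non-root pointed cell $c$ there is a pointed cell above $c$ in the same column or a pointed cell to the left of $c$ in the same row, but not both; the nearest such pointed cell is the parent of $c$; (3) every row and every column contains at least one pointed cell. The size is the number of points. A TLT contains the pattern H if there are rows $r_1$ above $r_2$ and columns $c_1<c_2<c_3$ with all six cells $(r_a,c_b)$ in the diagram such that $(r_1,c_2),(r_2,c_1),(r_2,c_3)$ are pointed and $(r_1,c_3),(r_2,c_2)$ are empty; it contains the pattern V if there are rows $r_1$ above $r_2$ above $r_3$ and columns $c_1<c_2$ with all six cells in the diagram such that $(r_1,c_2),(r_2,c_1),(r_3,c_2)$ are pointed and $(r_2,c_2),(r_3,c_1)$ are empty. A Baxter TLT avoids both H and V; $\mathcal{T}_n$ is the set of Baxter TLTs of size $n$. Insertion labeling: the points of a TLT $T$ of size $n$ are labeled bijectively by $1,\dots,n$ recursively. If $n=1$ the point gets label $1$. If $n\ge 2$, the special point $s$ is the rightmost among the pointed cells that are the lowest cell of their column; $s$ gets label $n$. Call a cell a rim cell if the cell diagonally south-east of it is not in the diagram; rim cells form a path of edge-adjacent cells from the bottom cell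 of the first column to the rightmost cell of the first row, each step going right or up. If the cell immediately right of $s$ is in the diagram, the ribbon of $s$ consists of the cells met when following this path from that cell up to, but excluding, the first pointed cell; otherwise it is empty. Exactly one holds: no pointed cell lies above $s$ in its column, or none lies to its left in its row. Delete the column of $s$ in the first case (row of $s$ in the second) and the ribbon of $s$, closing up the gap; this gives a TLT $T'$ of size $n-1$ whose points are those of $T$ other than $s$, each of which receives its label in $T'$. The map $\phi$: every cell of a TLT $T$ gets a label $\mathrm{iso}(c)$. Pointed cells keep their insertion labels. An empty cell of the first column gets the label of the nearest pointed cell above it; an empty cell of the first row gets the label of the nearest pointed cell to its left. The other empty cells are labeled from north-west to south-east: if $x,y,z$ are the labels of its north-west, north and west neighbours, the cell gets $x$ if there are pointed cells both above it in its column and to its left in its row, $y$ if only above, $z$ if only to the left, and $x$ ($=y=z$) if neither. Then $\phi(T)$ is the sequence of labels read starting from the bottom cell of the first column and moving at each step one cell to the right if that cell is in the diagram and one cell up otherwise, until the rightmost cell of the first row is reached; it is a permutation of $\{1,\dots,n\}$. A twisted Baxter permutation is a permutation $\sigma$ avoiding the vincular patterns $2\text{-}41\text{-}3$ and $3\text{-}41\text{-}2$, i.e. there are no indices $i<j<k$ with $j+1<k$ and $\sigma(j+1)<\sigma(i)<\sigma(k)<\sigma(j)$, and no indices $i<j<k$ with $j+1<k$ and $\sigma(j+1)<\sigma(k)<\sigma(i)<\sigma(j)$. $\mathcal{B}_n$ is the set of permutations of size $n$ whose inverse is a twisted Baxter permutation. *)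

theory Defs
  imports "HOL-Combinatorics.Permutations"
begin

text \<open>
  A cell is a pair (row, column); both coordinates start at 0, rows are numbered
  from top to bottom and columns from left to right.
\<close>

type_synonym cell = "nat \<times> nat"

datatype tableau = Tableau (cells: "cell set") (points: "cell set")

definition ferrers_diagram :: "cell set \<Rightarrow> bool" where
  "ferrers_diagram D \<longleftrightarrow>
     (\<exists>lens. lens \<noteq> [] \<and> 0 \<notin> set lens \<and> sorted_wrt (\<ge>) lens \<and>
        D = {(i, j). i < length lens \<and> j < lens ! i})"

definition point_above :: "tableau \<Rightarrow> cell \<Rightarrow> bool" where
  "point_above T = (\<lambda>(i, j). \<exists>i'<i. (i', j) \<in> points T)"

definition point_left :: "tableau \<Rightarrow> cell \<Rightarrow> bool" where
  "point_left T = (\<lambda>(i, j). \<exists>j'<j. (i, j') \<in> points T)"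

definition tree_like :: "tableau \<Rightarrow> bool" where
  "tree_like T \<longleftrightarrow>
     ferrers_diagram (cells T) \<and> points T \<subseteq> cells T \<and>
     (0, 0) \<in> points T \<and>
     (\<forall>c \<in> points T - {(0, 0)}. point_above T c \<noteq> point_left T c) \<and>
     (\<forall>(i, j) \<in> cells T. (\<exists>j'. (i, j') \<in> points T) \<and> (\<exists>i'. (i', j) \<in> points T))"

definition tsize :: "tableau \<Rightarrow> nat" where
  "tsize T = card (points T)"

definition contains_H :: "tableau \<Rightarrow> bool" where
  "contains_H T \<longleftrightarrow>
     (\<exists>r1 r2 c1 c2 c3. r1 < r2 \<and> c1 < c2 \<and> c2 < c3 \<and>
        {r1, r2} \<times> {c1, c2, c3} \<subseteq> cells T \<and>
        (r1, c2) \<in> points T \<and> (r2, c1) \<in> points T \<and> (r2, c3) \<in> points T \<and>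
        (r1, c3) \<notin> points T \<and> (r2, c2) \<notin> points T)"

definition contains_V :: "tableau \<Rightarrow> bool" where
  "contains_V T \<longleftrightarrow>
     (\<exists>r1 r2 r3 c1 c2. r1 < r2 \<and> r2 < r3 \<and> c1 < c2 \<and>
        {r1, r2, r3} \<times> {c1, c2} \<subseteq> cells T \<and>
        (r1, c2) \<in> points T \<and> (r2, c1) \<in> points T \<and> (r3, c2) \<in> points T \<and>
        (r2, c2) \<notin> points T \<and> (r3, c1) \<notin> points T)"

definition baxter_tlts :: "nat \<Rightarrow> tableau set" where
  "baxter_tlts n = {T. tree_like T \<and> tsize T = n \<and> \<not> contains_H T \<and> \<not> contains_V T}"


subsection \<open>Insertion labeling\<close>

definition rim :: "cell set \<Rightarrow> cell set" where
  "rim D = {(i, j). (i, j) \<in> D \<and> (Suc i, Suc j) \<notin> D}"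

text \<open>
  Every step of the rim path goes right or up, so a rim cell is met at or after
  another one exactly if it lies weakly north-east of it.
\<close>

definition weakly_NE :: "cell \<Rightarrow> cell \<Rightarrow> bool" where
  "weakly_NE = (\<lambda>(i, j) (i', j'). i' \<le> i \<and> j \<le> j')"

text \<open>
  No two points are the lowest cell of the same column, so the maximiser below is unique.
\<close>

definition special :: "tableau \<Rightarrow> cell" where
  "special T = arg_max snd (\<lambda>(i, j). (i, j) \<in> points T \<and> (Suc i, j) \<notin> cells T)"

definition ribbon :: "tableau \<Rightarrow> cell set" where
  "ribbon T = (case special T of (r, c) \<Rightarrow>
     if (r, Suc c) \<in> cells T
     then {x \<in> rim (cells T). weakly_NE (r, Suc c) x \<and>
             \<not> (\<exists>y \<in> rim (cells T) \<inter> points T. weakly_NE (r, Suc c) y \<and> weakly_NE y x)}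
     else {})"

text \<open>The column of the special point if no point lies above it, otherwise its row.\<close>

definition deleted_line :: "tableau \<Rightarrow> cell set" where
  "deleted_line T = (case special T of (r, c) \<Rightarrow>
     if \<not> point_above T (r, c) then {(i, j). j = c} else {(i, j). i = r})"

definition close_gap :: "tableau \<Rightarrow> cell \<Rightarrow> cell" where
  "close_gap T = (\<lambda>(i, j). case special T of (r, c) \<Rightarrow>
     if \<not> point_above T (r, c) then (i, if c < j then j - 1 else j)
     else (if r < i then i - 1 else i, j))"

definition remove_special :: "tableau \<Rightarrow> tableau" where
  "remove_special T =
     Tableau (close_gap T ` (cells T - deleted_line T - ribbon T))
             (close_gap T ` (points T - {special T}))"

text \<open>
  The first argument is the size of the tableau. If the size is 1, the only point is
  the special one.
\<close>

primrec ins_label_aux :: "nat \<Rightarrow> tableau \<Rightarrow> cell \<Rightarrow> nat" where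
  "ins_label_aux 0 T p = 0"
| "ins_label_aux (Suc n) T p =
     (if p = special T then Suc n
      else ins_label_aux n (remove_special T) (close_gap T p))"

definition ins_label :: "tableau \<Rightarrow> cell \<Rightarrow> nat" where
  "ins_label T = ins_label_aux (tsize T) T"


subsection \<open>The map phi\<close>

fun iso :: "tableau \<Rightarrow> nat \<Rightarrow> nat \<Rightarrow> nat" where
  "iso T i 0 =
     (if (i, 0) \<in> points T then ins_label T (i, 0)
      else ins_label T (Max {i'. i' < i \<and> (i', 0) \<in> points T}, 0))"
| "iso T 0 (Suc j) =
     (if (0, Suc j) \<in> points T then ins_label T (0, Suc j)
      else ins_label T (0, Max {j'. j' < Suc j \<and> (0, j') \<in> points T}))"
| "iso T (Suc i) (Suc j) =
     (if (Suc i, Suc j) \<in> points T then ins_label T (Suc i, Suc j)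
      else if point_above T (Suc i, Suc j) \<and> point_left T (Suc i, Suc j) then iso T i j
      else if point_above T (Suc i, Suc j) then iso T i (Suc j)
      else if point_left T (Suc i, Suc j) then iso T (Suc i) j
      else iso T i j)"

text \<open>
  The cells met from (i, j) on when moving right if possible and up otherwise;
  finiteness of D is only there for termination.
\<close>

function walk :: "cell set \<Rightarrow> nat \<Rightarrow> nat \<Rightarrow> cell list" where
  "walk D i j =
     (i, j) # (if finite D \<and> (i, Suc j) \<in> D then walk D i (Suc j)
               else if 0 < i then walk D (i - 1) j
               else [])"
  by pat_completeness auto
termination
proof (relation "measures [\<lambda>(D, i, j). i, \<lambda>(D, i, j). card {j'. j < j' \<and> (i, j') \<in> D}]")
  fix D :: "cell set" and i j :: nat
  assume *: "finite D \<and> (i, Suc j) \<in> D"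
  have "{j'. j < j' \<and> (i, j') \<in> D} \<subseteq> snd ` D" by force
  with * have "finite {j'. j < j' \<and> (i, j') \<in> D}" by (meson finite_imageI finite_subset)
  moreover have "{j'. Suc j < j' \<and> (i, j') \<in> D} \<subset> {j'. j < j' \<and> (i, j') \<in> D}"
    using * by auto
  ultimately show "((D, i, Suc j), (D, i, j))
      \<in> measures [\<lambda>(D, i, j). i, \<lambda>(D, i, j). card {j'. j < j' \<and> (i, j') \<in> D}]"
    by (simp add: psubset_card_mono)
qed auto

declare walk.simps [simp del]

definition phi :: "tableau \<Rightarrow> nat list" where
  "phi T = map (\<lambda>(i, j). iso T i j) (walk (cells T) (Max {i. (i, 0) \<in> cells T}) 0)"


subsection \<open>Inverses of twisted Baxter permutations\<close>

definition twisted_baxter :: "nat \<Rightarrow> (nat \<Rightarrow> nat) \<Rightarrow> bool" where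
  "twisted_baxter n \<sigma> \<longleftrightarrow>
     \<sigma> permutes {1..n} \<and>
     \<not> (\<exists>i j k. {i, j, k} \<subseteq> {1..n} \<and> i < j \<and> j + 1 < k \<and>
          \<sigma> (j + 1) < \<sigma> i \<and> \<sigma> i < \<sigma> k \<and> \<sigma> k < \<sigma> j) \<and>
     \<not> (\<exists>i j k. {i, j, k} \<subseteq> {1..n} \<and> i < j \<and> j + 1 < k \<and>
          \<sigma> (j + 1) < \<sigma> k \<and> \<sigma> k < \<sigma> i \<and> \<sigma> i < \<sigma> j)"

definition one_line :: "nat \<Rightarrow> (nat \<Rightarrow> nat) \<Rightarrow> nat list" where
  "one_line n \<sigma> = map \<sigma> [1..<n + 1]"

definition inverse_twisted_baxter :: "nat \<Rightarrow> nat list set" where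
  "inverse_twisted_baxter n =
     one_line n ` {\<sigma>. \<sigma> permutes {1..n} \<and> twisted_baxter n (inv \<sigma>)}"

end

theory Submission
  imports Defs
begin

text \<open>Each step of the south-east border of a tree-like tableau \<open>T\<close> is the right end of a row or the
  bottom of a column. Undoing the removal of the special point, a tableau of size \<open>n + 1\<close> arises
  from a unique one of size \<open>n\<close> by choosing one of the \<open>n + 1\<close> border steps, replacing it by a new
  corner and adding a ribbon from there to the old special point whenever this lies further
  north-east. The new line copies the labels of its neighbour and every ribbon cell copies the
  label of its north-west neighbour, so \<open>phi\<close> just inserts \<open>n + 1\<close> into the word of \<open>T\<close>, in the gap
  given by the border step. Hence \<open>phi\<close> is a bijection from all tree-like tableaux to all
  permutations.

  The patterns H and V are created by an insertion exactly if the line of the chosen border step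
  contains a cell with points both above it and to its left. In an inverse of a twisted Baxter
  permutation, \<open>n + 1\<close> may be inserted into a gap unless some \<open>v + 1\<close> before and \<open>v\<close> behind the gap
  enclose a value below \<open>v\<close>. Both kinds of forbidden positions obey the same recursion: inserting
  \<open>n + 1\<close> before \<open>n\<close> forbids the gaps between them, whose lines are those covered by the ribbon.\<close>

subsection \<open>Inverses of twisted Baxter permutations\<close>

text \<open>Labels are defined by repeatedly removing the special point, so an insertion is useful
  only if the removal finds exactly what was inserted. This explains the ribbon: a pointed column
  bottom to the right of the new point would be preferred as special point, and the ribbon puts a
  cell below each of them. It ends at the old special point, which is therefore the first point that
  the removal meets on the rim. Order along the border is expressed by the content
  \<open>j - i\<close>. The rim has exactly one cell of each content in its range, so an entry of
  the word is the label of the rim cell of a given content, and moving a stretch of the rim one cell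
  south-east, as a ribbon does, changes no position. The recursions for forbidden gaps are used only
  for insertions into free gaps, so the agreement of the gaps is carried along for Baxter tableaux
  only. This suffices because a forbidden pattern, on either side, survives all later
  insertions.\<close>

definition insert_at :: "nat \<Rightarrow> 'a \<Rightarrow> 'a list \<Rightarrow> 'a list" where
  "insert_at k x xs = take k xs @ x # drop k xs"

lemma length_insert_at [simp]: "length (insert_at k x xs) = Suc (length xs)"
  by (auto simp: insert_at_def)

lemma set_insert_at [simp]: "set (insert_at k x xs) = insert x (set xs)"
  by (metis append_take_drop_id insert_at_def list.simps(15) set_append Un_insert_right)

lemma distinct_insert_at [simp]: "distinct (insert_at k x xs) \<longleftrightarrow> x \<notin> set xs \<and> distinct xs"
proof -
  define us vs where "us = take k xs" and "vs = drop k xs"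
  have "xs = us @ vs"
    by (simp add: us_def vs_def)
  then show ?thesis
    unfolding insert_at_def us_def[symmetric] vs_def[symmetric] by auto
qed

lemma nth_insert_at:
  assumes "k \<le> length xs" "i \<le> length xs"
  shows "insert_at k x xs ! i = (if i < k then xs ! i else if i = k then x else xs ! (i - 1))"
  using assms by (auto simp: insert_at_def nth_append min_def nth_Cons')

lemma insert_at_eq_iff:
  assumes "x \<notin> set xs" "x \<notin> set ys" "k \<le> length xs" "l \<le> length ys"
  shows "insert_at k x xs = insert_at l x ys \<longleftrightarrow> k = l \<and> xs = ys"
proof
  assume eq: "insert_at k x xs = insert_at l x ys"
  have "x \<notin> set (take k xs)" "x \<notin> set (take l ys)" "x \<notin> set (drop k xs)" "x \<notin> set (drop l ys)"
    using assms by (auto dest: in_set_takeD in_set_dropD)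
  then have "take k xs = take l ys \<and> drop k xs = drop l ys"
    using eq unfolding insert_at_def by (subst (asm) append_Cons_eq_iff) auto
  moreover have "length (take k xs) = k" "length (take l ys) = l"
    using assms by auto
  ultimately show "k = l \<and> xs = ys"
    by (metis append_take_drop_id)
qed auto

definition perm_list :: "nat \<Rightarrow> nat list \<Rightarrow> bool" where
  "perm_list n xs \<longleftrightarrow> distinct xs \<and> set xs = {1..n}"

lemma length_perm_list: "perm_list n xs \<Longrightarrow> length xs = n"
  unfolding perm_list_def by (metis card_atLeastAtMost diff_Suc_1 distinct_card)

lemma perm_list_insert_at:
  "perm_list n xs \<Longrightarrow> perm_list (Suc n) (insert_at k (Suc n) xs)"
  unfolding perm_list_def by auto

lemma perm_list_SucE:
  assumes "perm_list (Suc n) xs"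
  obtains k ys where "xs = insert_at k (Suc n) ys" "perm_list n ys" "k \<le> n"
proof -
  have "Suc n \<in> set xs"
    using assms by (auto simp: perm_list_def)
  then obtain us vs where xs: "xs = us @ Suc n # vs"
    by (meson split_list)
  have eq: "xs = insert_at (length us) (Suc n) (us @ vs)"
    by (simp add: xs insert_at_def)
  have "Suc n \<notin> set (us @ vs)" "distinct (us @ vs)" "insert (Suc n) (set (us @ vs)) = {1..Suc n}"
    using assms unfolding perm_list_def xs by auto
  then have "distinct (us @ vs)" "set (us @ vs) = {1..Suc n} - {Suc n}"
    by (simp, metis Diff_insert_absorb)
  moreover have "{1..Suc n} - {Suc n} = {1..n}"
    by auto
  ultimately have "perm_list n (us @ vs)"
    unfolding perm_list_def by metis
  moreover from length_perm_list[OF this] have "length us \<le> n"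
    by simp
  ultimately show thesis
    using eq that by blast
qed

text \<open>In the one-line word of a permutation, the two adjacent entries of a vincular pattern of its
  inverse become consecutive values \<open>v + 1\<close> and \<open>v\<close>, in this order, and the two patterns differ only
  in the order of a smaller and a larger value in between. Gap \<open>q\<close> lies in front of entry \<open>q\<close>.\<close>

definition baxter_list :: "nat list \<Rightarrow> bool" where
  "baxter_list xs \<longleftrightarrow>
     (\<forall>x y z w. x < z \<and> z < y \<and> x < w \<and> w < y \<and> y < length xs \<and> xs ! x = Suc (xs ! y) \<longrightarrow>
        xs ! z < xs ! y \<longrightarrow> xs ! x < xs ! w \<longrightarrow> False)"

definition bad_gap :: "nat list \<Rightarrow> nat \<Rightarrow> bool" where
  "bad_gap xs q \<longleftrightarrow>
     (\<exists>x y z. x < q \<and> q \<le> y \<and> y < length xs \<and> xs ! x = Suc (xs ! y) \<and> x < z \<and> z < y \<and> xs ! z < xs ! y)"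

lemma insert_at_index:
  assumes "k \<le> length xs" "i \<le> length xs"
  shows "i = k \<and> insert_at k x xs ! i = x \<or>
    (\<exists>i'<length xs. i = (if i' < k then i' else Suc i') \<and> insert_at k x xs ! i = xs ! i')"
proof (cases i k rule: linorder_cases)
  case less
  then have "i < length xs \<and> i = (if i < k then i else Suc i) \<and> insert_at k x xs ! i = xs ! i"
    using assms by (auto simp: nth_insert_at)
  then show ?thesis by blast
next
  case equal
  then show ?thesis using assms by (auto simp: nth_insert_at)
next
  case greater
  then have "i - 1 < length xs \<and> i = (if i - 1 < k then i - 1 else Suc (i - 1)) \<and>
      insert_at k x xs ! i = xs ! (i - 1)"
    using assms by (auto simp: nth_insert_at)
  then show ?thesis by blast
qed

lemma nth_insert_at_shift:
  assumes "k \<le> length xs" "i < length xs"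
  shows "insert_at k x xs ! (if i < k then i else Suc i) = xs ! i"
  using assms by (auto simp: nth_insert_at)

text \<open>The new maximum can only be the entry at \<open>w\<close>: at \<open>x\<close> it would
  have to lie below the entry at \<open>w\<close>, at \<open>y\<close> the entry at \<open>x\<close>
  would exceed it, and at \<open>z\<close> it would have to lie below the entry at \<open>y\<close>.
  A new pattern thus consists of three old entries placed around gap \<open>k\<close>.\<close>

lemma baxter_list_insert_at:
  assumes xs: "perm_list n xs" and k: "k \<le> n"
  shows "baxter_list (insert_at k (Suc n) xs) \<longleftrightarrow> baxter_list xs \<and> \<not> bad_gap xs k"
proof -
  let ?ys = "insert_at k (Suc n) xs"
  \<comment> \<open>\<open>e\<close> sends an old index to its index in the longer list; it is
    increasing and misses only \<open>k\<close>.\<close>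
  define e where "e i = (if i < k then i else Suc i)" for i
  have len: "length xs = n"
    using xs by (rule length_perm_list)
  have le: "xs ! i \<le> n" if "i < n" for i
    using xs that len nth_mem[of i xs] by (auto simp: perm_list_def)
  have nth_e: "?ys ! e i = xs ! i" if "i < n" for i
    using nth_insert_at_shift[of k xs i "Suc n"] that k len by (simp add: e_def)
  have nth_k: "?ys ! k = Suc n"
    using k len by (auto simp: nth_insert_at)
  have e_less: "e i < e j \<longleftrightarrow> i < j" "e i < k \<longleftrightarrow> i < k" "k < e i \<longleftrightarrow> k \<le> i"
    "e i < Suc n \<longleftrightarrow> i < n" for i j
    using k by (auto simp: e_def)
  show ?thesis
  proof
    assume *: "baxter_list ?ys"
    have "baxter_list xs"
      unfolding baxter_list_def
    proof (intro allI impI)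
      fix x y z w
      assume h: "x < z \<and> z < y \<and> x < w \<and> w < y \<and> y < length xs \<and> xs ! x = Suc (xs ! y)"
        "xs ! z < xs ! y" "xs ! x < xs ! w"
      then show False
        using *[unfolded baxter_list_def, rule_format, of "e x" "e z" "e y" "e w"] len
        by (simp add: e_less nth_e)
    qed
    moreover have "\<not> bad_gap xs k"
    proof
      assume "bad_gap xs k"
      then obtain x y z where h: "x < k" "k \<le> y" "y < n" "xs ! x = Suc (xs ! y)" "x < z" "z < y"
        "xs ! z < xs ! y"
        unfolding bad_gap_def len by blast
      then show False
        using *[unfolded baxter_list_def, rule_format, of "e x" "e z" "e y" k] len le[of x]
        by (simp add: e_less nth_e nth_k)
    qed
    ultimately show "baxter_list xs \<and> \<not> bad_gap xs k" ..
  next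
    assume *: "baxter_list xs \<and> \<not> bad_gap xs k"
    show "baxter_list ?ys"
      unfolding baxter_list_def
    proof (intro allI impI)
      fix x y z w
      assume h: "x < z \<and> z < y \<and> x < w \<and> w < y \<and> y < length ?ys \<and> ?ys ! x = Suc (?ys ! y)"
        "?ys ! z < ?ys ! y" "?ys ! x < ?ys ! w"
      have ex: "i = k \<and> ?ys ! i = Suc n \<or> (\<exists>i'<n. i = e i' \<and> ?ys ! i = xs ! i')" if "i \<le> n" for i
        using insert_at_index[of k xs i "Suc n"] that k unfolding e_def len by blast
      have lex: "?ys ! i \<le> Suc n" if "i \<le> n" for i
        using ex[OF that] le by (metis le_SucI order_refl)
      have b: "x \<le> n" "y \<le> n" "z \<le> n" "w \<le> n"
        using h len by auto
      have "x \<noteq> k" "y \<noteq> k" "z \<noteq> k"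
        using h nth_k lex[OF b(1)] lex[OF b(2)] lex[OF b(4)] by auto
      then obtain x' y' z' where hx: "x' < n" "x = e x'" "?ys ! x = xs ! x'"
        and hy: "y' < n" "y = e y'" "?ys ! y = xs ! y'"
        and hz: "z' < n" "z = e z'" "?ys ! z = xs ! z'"
        using ex b by meson
      from ex[OF b(4)] show False
      proof
        assume w: "w = k \<and> ?ys ! w = Suc n"
        have "bad_gap xs k"
          unfolding bad_gap_def
          using h(1,2) unfolding conjunct1[OF w] hx(3) hy(3) hz(3) unfolding hx(2) hy(2) hz(2) e_less
          using hy(1) len by blast
        then show False using * by blast
      next
        assume "\<exists>w'<n. w = e w' \<and> ?ys ! w = xs ! w'"
        then obtain w' where hw: "w' < n" "w = e w'" "?ys ! w = xs ! w'"
          by blast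
        show False
          using * h unfolding hx(3) hy(3) hz(3) hw(3) unfolding hx(2) hy(2) hz(2) hw(2) e_less
          using hy(1) len unfolding baxter_list_def by blast
      qed
    qed
  qed
qed

text \<open>The new pair of consecutive values is \<open>n + 1\<close> at \<open>k\<close> and
  \<open>n\<close>, which sits at \<open>Suc m\<close> if \<open>k \<le> m\<close>. It spoils the
  gaps between the two as soon as some entry separates them, since every such entry is below
  \<open>n\<close>; this accounts for \<open>k < m\<close>. Old bad gaps keep their witnesses and
  are renumbered behind \<open>k\<close>. Gap \<open>k\<close> splits into \<open>k\<close> and
  \<open>Suc k\<close>, and neither inherits anything because \<open>k\<close> was not bad.\<close>

lemma bad_gap_insert_at:
  assumes xs: "perm_list n xs" and k: "k \<le> n" and nb: "\<not> bad_gap xs k"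
    and m: "m < n" "xs ! m = n"
  shows "bad_gap (insert_at k (Suc n) xs) q \<longleftrightarrow>
    (k < q \<and> q \<le> Suc m \<and> k < m) \<or> (q < k \<and> bad_gap xs q) \<or> (Suc k < q \<and> bad_gap xs (q - 1))"
proof -
  let ?ys = "insert_at k (Suc n) xs"
  define e where "e i = (if i < k then i else Suc i)" for i
  have len: "length xs = n"
    using xs by (rule length_perm_list)
  have le: "xs ! i \<le> n" if "i < n" for i
    using xs that len nth_mem[of i xs] by (auto simp: perm_list_def)
  have inj: "xs ! i = xs ! j \<longleftrightarrow> i = j" if "i < n" "j < n" for i j
    using xs that len by (simp add: nth_eq_iff_index_eq perm_list_def)
  have nth_e: "?ys ! e i = xs ! i" if "i < n" for i
    using nth_insert_at_shift[of k xs i "Suc n"] that k len by (simp add: e_def)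
  have nth_k: "?ys ! k = Suc n"
    using k len by (auto simp: nth_insert_at)
  have e_less: "e i < e j \<longleftrightarrow> i < j" "e i < k \<longleftrightarrow> i < k" "k < e i \<longleftrightarrow> k \<le> i"
    "e i < Suc n \<longleftrightarrow> i < n" for i j
    using k by (auto simp: e_def)
  have ex: "i = k \<and> ?ys ! i = Suc n \<or> (\<exists>i'<n. i = e i' \<and> ?ys ! i = xs ! i')" if "i \<le> n" for i
    using insert_at_index[of k xs i "Suc n"] that k unfolding e_def len by blast
  have lex: "?ys ! i \<le> Suc n" if "i \<le> n" for i
    using ex[OF that] le by (metis le_SucI order_refl)
  have old: "bad_gap ?ys q" if q': "bad_gap xs q'" "q = e q' \<or> q = Suc k \<and> q' = k" "q' \<noteq> k" for q'
  proof -
    obtain x y z where h: "x < q'" "q' \<le> y" "y < n" "xs ! x = Suc (xs ! y)" "x < z" "z < y"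
      "xs ! z < xs ! y"
      using q'(1) unfolding bad_gap_def len by blast
    then have "x < n" "z < n" by auto
    then have "?ys ! e x = Suc (?ys ! e y)" "?ys ! e z < ?ys ! e y"
      using h by (simp_all add: nth_e)
    moreover have "e x < q" "q \<le> e y" "e y < Suc n" "e x < e z" "e z < e y"
      using h q'(2,3) by (auto simp: e_def)
    ultimately show ?thesis
      unfolding bad_gap_def length_insert_at len by blast
  qed
  show ?thesis
  proof
    assume "bad_gap ?ys q"
    then obtain x y z where h: "x < q" "q \<le> y" "y \<le> n" "?ys ! x = Suc (?ys ! y)" "x < z" "z < y"
      "?ys ! z < ?ys ! y"
      unfolding bad_gap_def length_insert_at len by (metis less_Suc_eq_le)
    then have b: "x \<le> n" "z \<le> n" by auto
    have "y \<noteq> k" "z \<noteq> k"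
      using h nth_k lex[OF b(1)] lex[OF h(3)] by auto
    then obtain y' z' where hy: "y' < n" "y = e y'" "?ys ! y = xs ! y'"
      and hz: "z' < n" "z = e z'" "?ys ! z = xs ! z'"
      using ex b h(3) by meson
    from ex[OF b(1)]
    show "(k < q \<and> q \<le> Suc m \<and> k < m) \<or> (q < k \<and> bad_gap xs q) \<or> (Suc k < q \<and> bad_gap xs (q - 1))"
    proof
      assume x: "x = k \<and> ?ys ! x = Suc n"
      then have "xs ! y' = xs ! m"
        using h hy m by simp
      then have "y' = m"
        using inj hy m by blast
      then show ?thesis
        using x h hy(2) hz(2) by (auto simp: e_def split: if_splits)
    next
      assume "\<exists>i'<n. x = e i' \<and> ?ys ! x = xs ! i'"
      then obtain x' where hx: "x' < n" "x = e x'" "?ys ! x = xs ! x'"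
        by blast
      have "bad_gap xs q'" if "x' < q'" "q' \<le> y'" for q'
        unfolding bad_gap_def len
        using h(4-7) that hy(1) unfolding hx(3) hy(3) hz(3) unfolding hx(2) hy(2) hz(2) e_less
        by blast
      \<comment> \<open>Left of \<open>k\<close> the old gap is \<open>q\<close>, right of
        \<open>Suc k\<close> it is \<open>q - 1\<close>; for \<open>k\<close> and
        \<open>Suc k\<close> it would be gap \<open>k\<close>, which \<open>nb\<close>
        excludes.\<close>
      from this[of q] this[of "q - 1"] this[of k] show ?thesis
        using nb h(1,2) hx(2) hy(2) by (auto simp: e_def split: if_splits)
    qed
  next
    assume "(k < q \<and> q \<le> Suc m \<and> k < m) \<or> (q < k \<and> bad_gap xs q) \<or> (Suc k < q \<and> bad_gap xs (q - 1))"
    then consider "k < q" "q \<le> Suc m" "k < m" | "q < k" "bad_gap xs q" | "Suc k < q" "bad_gap xs (q - 1)"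
      by blast
    then show "bad_gap ?ys q"
    proof cases
      case 1
      then have "?ys ! Suc k = xs ! k" "?ys ! Suc m = xs ! m"
        using nth_e[of k] nth_e[of m] m by (auto simp: e_def)
      moreover have "xs ! k < xs ! m"
        using le[of k] inj[of k m] m 1 by auto
      ultimately have "?ys ! k = Suc (?ys ! Suc m)" "?ys ! Suc k < ?ys ! Suc m"
        using nth_k m by auto
      then show ?thesis
        unfolding bad_gap_def length_insert_at len
        by (intro exI[of _ k] exI[of _ "Suc m"] exI[of _ "Suc k"]) (use 1 m in auto)
    next
      case 2
      then show ?thesis using old[of q] by (auto simp: e_def)
    next
      case 3
      then show ?thesis using old[of "q - 1"] by (auto simp: e_def)
    qed
  qed
qed

section \<open>Permutations as functions and as words\<close>

lemma one_line_perm_list: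
  assumes "\<sigma> permutes {1..n}"
  shows "perm_list n (one_line n \<sigma>)"
  using permutes_inj_on[OF assms] permutes_image[OF assms]
  by (auto simp: perm_list_def one_line_def distinct_map atLeastLessThanSuc_atLeastAtMost simp del: upt_Suc)

lemma nth_one_line: "i < n \<Longrightarrow> one_line n \<sigma> ! i = \<sigma> (Suc i)"
  by (simp add: one_line_def del: upt_Suc)

lemma perm_list_one_lineE:
  assumes "perm_list n xs"
  obtains \<sigma> where "\<sigma> permutes {1..n}" "xs = one_line n \<sigma>"
proof
  let ?s = "\<lambda>i. if i \<in> {1..n} then xs ! (i - 1) else i"
  have len: "length xs = n"
    using assms by (rule length_perm_list)
  show "xs = one_line n ?s"
    by (rule nth_equalityI) (auto simp: len nth_one_line one_line_def simp del: upt_Suc)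
  have "bij_betw (\<lambda>i. i - 1) {1..n} {..<n}"
    by (rule bij_betwI[of _ _ _ Suc]) auto
  moreover have "bij_betw ((!) xs) {..<n} {1..n}"
    using assms bij_betw_nth[of xs "{..<n}" "{1..n}"] len by (auto simp: perm_list_def)
  ultimately have "bij_betw (\<lambda>i. xs ! (i - 1)) {1..n} {1..n}"
    using bij_betw_trans[of "\<lambda>i. i - 1" "{1..n}" "{..<n}" "(!) xs" "{1..n}"] by (simp add: comp_def)
  then have "bij_betw ?s {1..n} {1..n}"
    by (subst bij_betw_cong[of _ _ "\<lambda>i. xs ! (i - 1)"]) auto
  then show "?s permutes {1..n}"
    by (rule bij_imp_permutes) auto
qed

text \<open>The dictionary: the pattern entries at \<open>j + 1\<close>, \<open>j\<close>,
  \<open>i\<close>, \<open>k\<close> of the inverse are the positions \<open>x\<close>,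
  \<open>y\<close>, \<open>z\<close>, \<open>w\<close> of these values in the word, up to the shift
  between counting from 1 and from 0.\<close>

lemma twisted_baxter_inv_iff:
  assumes s: "\<sigma> permutes {1..n}"
  shows "twisted_baxter n (inv \<sigma>) \<longleftrightarrow> baxter_list (one_line n \<sigma>)"
proof -
  let ?xs = "one_line n \<sigma>"
  have len: "length ?xs = n"
    by (simp add: one_line_def del: upt_Suc)
  have p: "inv \<sigma> permutes {1..n}"
    using s by (rule permutes_inv)
  have inv1: "inv \<sigma> (\<sigma> i) = i" "\<sigma> (inv \<sigma> i) = i" for i
    using permutes_inverses[OF s] by auto
  have ran: "\<sigma> i \<in> {1..n} \<longleftrightarrow> i \<in> {1..n}" "inv \<sigma> i \<in> {1..n} \<longleftrightarrow> i \<in> {1..n}" for i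
    using permutes_in_image[OF s] permutes_in_image[OF p] by auto
  show ?thesis
  proof
    assume *: "twisted_baxter n (inv \<sigma>)"
    show "baxter_list ?xs"
      unfolding baxter_list_def
    proof (intro allI impI)
      fix x y z w
      assume h: "x < z \<and> z < y \<and> x < w \<and> w < y \<and> y < length ?xs \<and> ?xs ! x = Suc (?xs ! y)"
        "?xs ! z < ?xs ! y" "?xs ! x < ?xs ! w"
      let ?i = "\<sigma> (Suc z)" and ?j = "\<sigma> (Suc y)" and ?k = "\<sigma> (Suc w)"
      have Suc_j: "?j + 1 = \<sigma> (Suc x)" "?i < ?j" "?j + 1 < ?k"
        using h len by (auto simp: nth_one_line)
      have "Suc z \<in> {1..n}" "Suc y \<in> {1..n}" "Suc w \<in> {1..n}"
        using h len by auto
      then have "{?i, ?j, ?k} \<subseteq> {1..n}"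
        using ran by blast
      \<comment> \<open>Whichever of \<open>z\<close> and \<open>w\<close> comes first decides which
        of the two vincular patterns occurs.\<close>
      moreover have "z \<noteq> w"
        using h by auto
      ultimately show False
        using * Suc_j h unfolding twisted_baxter_def Suc_j
        by (metis (no_types, lifting) Suc_j(1) inv1(1) Suc_less_eq linorder_neqE_nat)
    qed
  next
    assume *: "baxter_list ?xs"
    have nb: False if h: "{i, j, k} \<subseteq> {1..n}" "i < j" "j + 1 < k"
      "inv \<sigma> (j + 1) < inv \<sigma> i" "inv \<sigma> (j + 1) < inv \<sigma> k" "inv \<sigma> i < inv \<sigma> j" "inv \<sigma> k < inv \<sigma> j" for i j k
    proof -
      have "j + 1 \<in> {1..n}"
        using h by auto
      with h(1) have m: "inv \<sigma> i \<in> {1..n}" "inv \<sigma> j \<in> {1..n}" "inv \<sigma> k \<in> {1..n}" "inv \<sigma> (j + 1) \<in> {1..n}"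
        using ran by blast+
      have nth: "?xs ! (a - 1) = \<sigma> a" if "a \<in> {1..n}" for a
        using nth_one_line[of "a - 1" n \<sigma>] that by (cases a) auto
      define x z y w where "x = inv \<sigma> (j + 1) - 1" and "z = inv \<sigma> i - 1"
        and "y = inv \<sigma> j - 1" and "w = inv \<sigma> k - 1"
      then have e: "?xs ! z = i" "?xs ! y = j" "?xs ! w = k" "?xs ! x = j + 1"
        by (simp_all only: nth m inv1)
      have "x < z \<and> z < y \<and> x < w \<and> w < y \<and> y < length ?xs"
        using m h unfolding len x_def z_def y_def w_def by auto
      moreover have "?xs ! x = Suc (?xs ! y)" "?xs ! z < ?xs ! y" "?xs ! x < ?xs ! w"
        using h unfolding e by auto
      ultimately show False
        using * unfolding baxter_list_def by blast
    qed
    show "twisted_baxter n (inv \<sigma>)"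
      unfolding twisted_baxter_def
    proof (intro conjI notI p; elim exE conjE)
      fix i j k
      assume h: "{i, j, k} \<subseteq> {1..n}" "i < j" "j + 1 < k"
      show False if "inv \<sigma> (j + 1) < inv \<sigma> i" "inv \<sigma> i < inv \<sigma> k" "inv \<sigma> k < inv \<sigma> j"
        by (rule nb[OF h]) (use that in linarith)+
      show False if "inv \<sigma> (j + 1) < inv \<sigma> k" "inv \<sigma> k < inv \<sigma> i" "inv \<sigma> i < inv \<sigma> j"
        by (rule nb[OF h]) (use that in linarith)+
    qed
  qed
qed

lemma inverse_twisted_baxter_iff:
  "xs \<in> inverse_twisted_baxter n \<longleftrightarrow> perm_list n xs \<and> baxter_list xs"
proof
  assume "xs \<in> inverse_twisted_baxter n"
  then show "perm_list n xs \<and> baxter_list xs"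
    unfolding inverse_twisted_baxter_def using one_line_perm_list twisted_baxter_inv_iff by blast
next
  assume *: "perm_list n xs \<and> baxter_list xs"
  then obtain \<sigma> where "\<sigma> permutes {1..n}" "xs = one_line n \<sigma>"
    using perm_list_one_lineE by blast
  then show "xs \<in> inverse_twisted_baxter n"
    unfolding inverse_twisted_baxter_def using * twisted_baxter_inv_iff by blast
qed

subsection \<open>Ferrers diagrams and their rim\<close>

text \<open>The later constructions describe diagrams as sets of cells, for which closure towards
  the north-west is easier to verify than a list of row lengths.\<close>

definition ferrers :: "cell set \<Rightarrow> bool" where
  "ferrers D \<longleftrightarrow> finite D \<and> (0, 0) \<in> D \<and>
     (\<forall>i j i' j'. (i, j) \<in> D \<longrightarrow> i' \<le> i \<longrightarrow> j' \<le> j \<longrightarrow> (i', j') \<in> D)"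

lemma ferrersD: "ferrers D \<Longrightarrow> (i, j) \<in> D \<Longrightarrow> i' \<le> i \<Longrightarrow> j' \<le> j \<Longrightarrow> (i', j') \<in> D"
  unfolding ferrers_def by blast

lemma ferrers_finite: "ferrers D \<Longrightarrow> finite D"
  and ferrers_corner: "ferrers D \<Longrightarrow> (0, 0) \<in> D"
  unfolding ferrers_def by blast+

lemma down_closed_nat:
  fixes A :: "nat set"
  assumes "finite A" "\<And>x y. x \<in> A \<Longrightarrow> y \<le> x \<Longrightarrow> y \<in> A"
  shows "\<exists>l. \<forall>x. x \<in> A \<longleftrightarrow> x < l"
proof (cases "A = {}")
  case True
  then show ?thesis by (intro exI[of _ 0]) auto
next
  case False
  then show ?thesis
    using assms(2)[OF Max_in[OF assms(1) False]] Max_ge[OF assms(1)]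
    by (intro exI[of _ "Suc (Max A)"]) (auto simp: less_Suc_eq_le)
qed

lemma ferrers_row:
  assumes "ferrers D"
  shows "\<exists>l. \<forall>j. (i, j) \<in> D \<longleftrightarrow> j < l"
proof -
  have "finite {j. (i, j) \<in> D}"
    using finite_subset[of "{j. (i, j) \<in> D}" "snd ` D"] ferrers_finite[OF assms] by force
  from down_closed_nat[OF this] show ?thesis
    using ferrersD[OF assms] by simp
qed

lemma ferrers_col:
  assumes "ferrers D"
  shows "\<exists>h. \<forall>i. (i, j) \<in> D \<longleftrightarrow> i < h"
proof -
  have "finite {i. (i, j) \<in> D}"
    using finite_subset[of "{i. (i, j) \<in> D}" "fst ` D"] ferrers_finite[OF assms] by force
  from down_closed_nat[OF this] show ?thesis
    using ferrersD[OF assms] by simp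
qed

lemma ferrers_diagram_iff: "ferrers_diagram D \<longleftrightarrow> ferrers D"
proof
  assume "ferrers_diagram D"
  then obtain lens where lens: "lens \<noteq> []" "0 \<notin> set lens" "sorted_wrt (\<ge>) lens"
    and D: "D = {(i, j). i < length lens \<and> j < lens ! i}"
    unfolding ferrers_diagram_def by blast
  have "D = Sigma {..<length lens} (\<lambda>i. {..<lens ! i})"
    unfolding D by auto
  then have "finite D"
    by simp
  moreover have "lens ! 0 \<noteq> 0"
    using lens by (metis length_greater_0_conv nth_mem)
  then have "(0, 0) \<in> D"
    using lens D by simp
  moreover have "(i', j') \<in> D" if "(i, j) \<in> D" "i' \<le> i" "j' \<le> j" for i j i' j'
  proof (cases "i' = i")
    case False
    then have "lens ! i \<le> lens ! i'"
      using that sorted_wrt_nth_less[OF lens(3), of i' i] D by auto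
    then show ?thesis using that D by auto
  qed (use that D in auto)
  ultimately show "ferrers D"
    unfolding ferrers_def by blast
next
  assume D: "ferrers D"
  obtain R where R: "\<And>i j. (i, j) \<in> D \<longleftrightarrow> j < R i"
    using ferrers_row[OF D] by metis
  obtain m where m: "\<And>i. (i, 0) \<in> D \<longleftrightarrow> i < m"
    using ferrers_col[OF D] by metis
  have R0: "0 < R i \<longleftrightarrow> i < m" for i
    using R[of i 0] m by simp
  have "R j \<le> R i" if "i < j" for i j
    using ferrersD[OF D, of j "R i" i "R i"] R that by (metis less_imp_le_nat linorder_not_le order_refl)
  then have "sorted_wrt (\<ge>) (map R [0..<m])"
    by (auto simp: sorted_wrt_iff_nth_less)
  moreover have "map R [0..<m] \<noteq> []"
    using ferrers_corner[OF D] m by auto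
  moreover have "0 \<notin> set (map R [0..<m])"
  proof
    assume "0 \<in> set (map R [0..<m])"
    then obtain i where "i < m" "R i = 0"
      by auto
    then show False
      using R0[of i] by simp
  qed
  moreover have "(i, j) \<in> D \<longleftrightarrow> i < m \<and> j < R i" for i j
    using R[of i j] R0[of i] by linarith
  then have "D = {(i, j). i < length (map R [0..<m]) \<and> j < map R [0..<m] ! i}"
    by auto
  ultimately show "ferrers_diagram D"
    unfolding ferrers_diagram_def by (intro exI[of _ "map R [0..<m]"] conjI)
qed

definition last_row :: "cell set \<Rightarrow> nat" where
  "last_row D = Max {i. (i, 0) \<in> D}"

definition last_col :: "cell set \<Rightarrow> nat" where
  "last_col D = Max {j. (0, j) \<in> D}"

lemma last_row_eqI:
  assumes "ferrers D" "(m, 0) \<in> D" "(Suc m, 0) \<notin> D"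
  shows "last_row D = m"
proof -
  have "(i, 0) \<in> D \<longleftrightarrow> i \<le> m" for i
    using assms ferrersD[OF assms(1)] by (metis not_less_eq_eq order_refl)
  then have "{i. (i, 0) \<in> D} = {..m}"
    by auto
  then show ?thesis
    unfolding last_row_def by (simp add: Max_eq_iff)
qed

lemma last_row_iff:
  assumes "ferrers D"
  shows "(i, 0) \<in> D \<longleftrightarrow> i \<le> last_row D"
proof -
  obtain h where h: "\<And>i. (i, 0) \<in> D \<longleftrightarrow> i < h"
    using ferrers_col[OF assms] by metis
  then have "0 < h"
    using ferrers_corner[OF assms] by auto
  then have "last_row D = h - 1"
    by (intro last_row_eqI assms) (auto simp: h)
  then show ?thesis
    using h[of i] \<open>0 < h\<close> by auto
qed

lemma last_col_eqI:
  assumes "ferrers D" "(0, m) \<in> D" "(0, Suc m) \<notin> D"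
  shows "last_col D = m"
proof -
  have "(0, i) \<in> D \<longleftrightarrow> i \<le> m" for i
    using assms ferrersD[OF assms(1)] by (metis not_less_eq_eq order_refl)
  then have "{i. (0, i) \<in> D} = {..m}"
    by auto
  then show ?thesis
    unfolding last_col_def by (simp add: Max_eq_iff)
qed

lemma last_col_iff:
  assumes "ferrers D"
  shows "(0, i) \<in> D \<longleftrightarrow> i \<le> last_col D"
proof -
  obtain h where h: "\<And>i. (0, i) \<in> D \<longleftrightarrow> i < h"
    using ferrers_row[OF assms] by metis
  then have "0 < h"
    using ferrers_corner[OF assms] by auto
  then have "last_col D = h - 1"
    by (intro last_col_eqI assms) (auto simp: h)
  then show ?thesis
    using h[of i] \<open>0 < h\<close> by auto
qed

lemma ferrers_le_last_row: "ferrers D \<Longrightarrow> (i, j) \<in> D \<Longrightarrow> i \<le> last_row D"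
  using ferrersD[of D i j i 0] last_row_iff[of D i] by simp

lemma ferrers_le_last_col: "ferrers D \<Longrightarrow> (i, j) \<in> D \<Longrightarrow> j \<le> last_col D"
  using ferrersD[of D i j 0 j] last_col_iff[of D j] by simp

section \<open>The rim path, contents, and positions in the word\<close>

lemma mem_rim: "(i, j) \<in> rim D \<longleftrightarrow> (i, j) \<in> D \<and> (Suc i, Suc j) \<notin> D"
  by (simp add: rim_def)

lemma rim_unique:
  assumes D: "ferrers D" and "(i, j) \<in> rim D" "(i', j') \<in> rim D" "j + i' = j' + i"
  shows "i = i' \<and> j = j'"
proof (rule ccontr)
  assume "\<not> ?thesis"
  then have "Suc i \<le> i' \<and> Suc j \<le> j' \<or> Suc i' \<le> i \<and> Suc j' \<le> j"
    using assms(4) by linarith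
  then show False
    using assms(2,3) ferrersD[OF D, of i' j' "Suc i" "Suc j"] ferrersD[OF D, of i j "Suc i'" "Suc j'"]
    unfolding mem_rim by blast
qed

text \<open>Otherwise one cell would lie strictly south-east of the other, which is impossible on
  the rim. This turns comparisons of contents into comparisons of coordinates.\<close>

lemma rim_mono:
  assumes D: "ferrers D" and "(i, j) \<in> rim D" "(i', j') \<in> rim D" "j + i' \<le> j' + i"
  shows "i' \<le> i \<and> j \<le> j'"
proof (rule ccontr)
  assume "\<not> ?thesis"
  then have "Suc i \<le> i' \<and> Suc j \<le> j' \<or> Suc i' \<le> i \<and> Suc j' \<le> j"
    using assms(4) by linarith
  then show False
    using assms(2,3) ferrersD[OF D, of i' j' "Suc i" "Suc j"] ferrersD[OF D, of i j "Suc i'" "Suc j'"]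
    unfolding mem_rim by blast
qed

text \<open>Each step of the path raises the content by one and stays on the rim, and the content of
  the last cell of the first row fixes the length. From here on, positions in the word are computed
  from contents and \<open>walk\<close> is no longer unfolded.\<close>

lemma walk_rim:
  assumes "ferrers D" "(i, j) \<in> rim D"
  shows "length (walk D i j) + j = Suc (last_col D + i) \<and>
    (\<forall>k < length (walk D i j). \<exists>a b. walk D i j ! k = (a, b) \<and> (a, b) \<in> rim D \<and> b + i = a + j + k)"
  using assms
proof (induction D i j rule: walk.induct)
  case (1 D i j)
  have D: "ferrers D" and fin: "finite D" and ij: "(i, j) \<in> D" "(Suc i, Suc j) \<notin> D"
    using 1 by (auto simp: ferrers_def mem_rim)
  have rest: "length (walk D i j) + j = Suc (last_col D + i) \<and>
      (\<forall>k < length (walk D i j). \<exists>a b. walk D i j ! k = (a, b) \<and> (a, b) \<in> rim D \<and> b + i = a + j + k)"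
    if w: "walk D i j = (i, j) # walk D i' j'"
      and len: "length (walk D i' j') + j' = Suc (last_col D + i')" "i + j' = i' + Suc j"
      and nth: "\<forall>k < length (walk D i' j').
        \<exists>a b. walk D i' j' ! k = (a, b) \<and> (a, b) \<in> rim D \<and> b + i' = a + j' + k"
    for i' j'
  proof (intro conjI allI impI)
    show "length (walk D i j) + j = Suc (last_col D + i)"
      using w len by simp
    fix k assume k: "k < length (walk D i j)"
    show "\<exists>a b. walk D i j ! k = (a, b) \<and> (a, b) \<in> rim D \<and> b + i = a + j + k"
    proof (cases k)
      case 0
      then show ?thesis using w 1 by simp
    next
      case (Suc k')
      then have "k' < length (walk D i' j')"
        using k w by simp
      with nth obtain a b where "walk D i' j' ! k' = (a, b)" "(a, b) \<in> rim D" "b + i' = a + j' + k'"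
        by blast
      then show ?thesis
        using w len(2) Suc by (intro exI[of _ a] exI[of _ b]) simp
    qed
  qed
  consider "(i, Suc j) \<in> D" | "(i, Suc j) \<notin> D" "0 < i" | "(i, Suc j) \<notin> D" "i = 0"
    by blast
  then show ?case
  proof cases
    case c: 1
    have "(i, Suc j) \<in> rim D"
      using c ij ferrersD[OF D, of "Suc i" "Suc (Suc j)" "Suc i" "Suc j"] by (auto simp: mem_rim)
    with 1(1) fin c D have IH: "length (walk D i (Suc j)) + Suc j = Suc (last_col D + i) \<and>
      (\<forall>k < length (walk D i (Suc j)). \<exists>a b. walk D i (Suc j) ! k = (a, b) \<and> (a, b) \<in> rim D \<and> b + i = a + Suc j + k)"
      by blast
    have "walk D i j = (i, j) # walk D i (Suc j)"
      using c fin by (subst walk.simps) simp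
    then show ?thesis
      by (rule rest) (use IH in auto)
  next
    case c: 2
    have "(i - 1, j) \<in> rim D"
      using c ij ferrersD[OF D, of i j "i - 1" j] by (auto simp: mem_rim)
    with 1(2) fin c D have IH: "length (walk D (i - 1) j) + j = Suc (last_col D + (i - 1)) \<and>
      (\<forall>k < length (walk D (i - 1) j). \<exists>a b. walk D (i - 1) j ! k = (a, b) \<and> (a, b) \<in> rim D \<and> b + (i - 1) = a + j + k)"
      by blast
    have "walk D i j = (i, j) # walk D (i - 1) j"
      using c fin by (subst walk.simps) simp
    then show ?thesis
      by (rule rest) (use IH c in auto)
  next
    case 3
    then have w: "walk D i j = [(i, j)]"
      by (subst walk.simps) simp
    have "last_col D = j"
      using 3 D ij by (intro last_col_eqI) auto
    then show ?thesis
      using 3 w 1 by simp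
  qed
qed

lemma bottom_rim: "ferrers D \<Longrightarrow> (last_row D, 0) \<in> rim D"
  using last_row_iff[of D "last_row D"] last_row_iff[of D "Suc (last_row D)"] ferrersD[of D "Suc (last_row D)" "Suc 0" "Suc (last_row D)" 0]
  by (auto simp: mem_rim)

lemma rim_ex:
  assumes "ferrers D" "k \<le> last_col D + last_row D"
  shows "\<exists>a b. (a, b) \<in> rim D \<and> b + last_row D = a + k"
  using walk_rim[OF assms(1) bottom_rim[OF assms(1)]] assms(2) by (metis add_0_right le_imp_less_Suc)

lemma phi_walk: "phi T = map (\<lambda>(i, j). iso T i j) (walk (cells T) (last_row (cells T)) 0)"
  by (simp add: phi_def last_row_def)

lemma length_phi: "ferrers (cells T) \<Longrightarrow> length (phi T) = Suc (last_col (cells T) + last_row (cells T))"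
  using walk_rim[OF _ bottom_rim, of "cells T"] by (simp add: phi_walk)

lemma phi_nth:
  assumes T: "ferrers (cells T)" and ab: "(a, b) \<in> rim (cells T)" "b + last_row (cells T) = a + k"
  shows "k < length (phi T) \<and> phi T ! k = iso T a b"
proof -
  let ?D = "cells T"
  have "b \<le> last_col ?D"
    using ab ferrers_le_last_col[OF T] by (auto simp: mem_rim)
  then have k: "k < length (phi T)"
    using ab length_phi[OF T] by simp
  then have "k < length (walk ?D (last_row ?D) 0)"
    by (simp add: phi_walk)
  then obtain a' b' where "walk ?D (last_row ?D) 0 ! k = (a', b')" "(a', b') \<in> rim ?D" "b' + last_row ?D = a' + k"
    using walk_rim[OF T bottom_rim[OF T]] by auto
  moreover from this have "a = a' \<and> b = b'"
    using ab by (intro rim_unique[OF T]) auto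
  ultimately show ?thesis
    using k by (simp add: phi_walk)
qed

text \<open>The \<open>q\<close>-th step of the south-east border, read from the bottom left, is the right end of a
  row or the bottom of a column; it lies between the entries \<open>q - 1\<close> and \<open>q\<close> of the rim path.\<close>

definition row_gap :: "cell set \<Rightarrow> nat \<Rightarrow> nat \<Rightarrow> bool" where
  "row_gap D i q \<longleftrightarrow> (\<exists>l>0. (\<forall>j. (i, j) \<in> D \<longleftrightarrow> j < l) \<and> q + i = last_row D + l)"

definition col_gap :: "cell set \<Rightarrow> nat \<Rightarrow> nat \<Rightarrow> bool" where
  "col_gap D j q \<longleftrightarrow> (\<exists>h>0. (\<forall>i. (i, j) \<in> D \<longleftrightarrow> i < h) \<and> q + h = Suc (j + last_row D))"

lemma row_gapI:
  assumes D: "ferrers D" and "(i, j) \<in> D" "(i, Suc j) \<notin> D" "q + i = Suc (last_row D + j)"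
  shows "row_gap D i q"
proof -
  have "(i, j') \<in> D \<longleftrightarrow> j' < Suc j" for j'
    using assms(2,3) ferrersD[OF D, of i j i j'] ferrersD[OF D, of i j' i "Suc j"]
    by (cases "j' \<le> j") (auto simp: not_le)
  then show ?thesis
    unfolding row_gap_def using assms(4) by (intro exI[of _ "Suc j"]) simp
qed

lemma col_gapI:
  assumes D: "ferrers D" and "(i, j) \<in> D" "(Suc i, j) \<notin> D" "q + i = j + last_row D"
  shows "col_gap D j q"
proof -
  have "(i', j) \<in> D \<longleftrightarrow> i' < Suc i" for i'
    using assms(2,3) ferrersD[OF D, of i j i' j] ferrersD[OF D, of i' j "Suc i" j]
    by (cases "i' \<le> i") (auto simp: not_le)
  then show ?thesis
    unfolding col_gap_def using assms(4) by (intro exI[of _ "Suc i"]) simp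
qed

text \<open>Step \<open>0\<close> is the bottom of the first column. Any later step follows entry
  \<open>q - 1\<close> of the path: if the path goes right, it is the bottom of the next column,
  otherwise the right end of the current row.\<close>

lemma gap_ex:
  assumes D: "ferrers D" and q: "q \<le> Suc (last_col D + last_row D)"
  shows "(\<exists>i. row_gap D i q) \<or> (\<exists>j. col_gap D j q)"
proof (cases q)
  case 0
  have "col_gap D 0 q"
    by (rule col_gapI[OF D, of "last_row D"]) (auto simp: 0 last_row_iff[OF D])
  then show ?thesis by blast
next
  case (Suc k)
  then obtain a b where ab: "(a, b) \<in> rim D" "b + last_row D = a + k"
    using rim_ex[OF D, of k] q by auto
  show ?thesis
  proof (cases "(a, Suc b) \<in> D")
    case True
    moreover have "(Suc a, Suc b) \<notin> D"
      using ab by (simp add: mem_rim)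
    ultimately have "col_gap D (Suc b) q"
      by (rule col_gapI[OF D]) (use ab Suc in simp)
    then show ?thesis by blast
  next
    case False
    have "row_gap D a q"
      by (rule row_gapI[OF D, of _ b]) (use ab Suc False in \<open>auto simp: mem_rim\<close>)
    then show ?thesis by blast
  qed
qed

text \<open>A common step would give \<open>l + h = i + j + 1\<close>. But \<open>(i, j)\<close> is
  in the diagram iff \<open>j < l\<close> and also iff \<open>i < h\<close>, so both inequalities
  hold or both fail, and the sum is too large or too small.\<close>

lemma row_col_gap:
  assumes "row_gap D i q" "col_gap D j q"
  shows False
proof -
  obtain l h where "(i, j) \<in> D \<longleftrightarrow> j < l" "q + i = last_row D + l"
    "(i, j) \<in> D \<longleftrightarrow> i < h" "q + h = Suc (j + last_row D)"
    using assms unfolding row_gap_def col_gap_def by blast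
  then show False
    by (cases "(i, j) \<in> D") auto
qed

lemma row_gap_unique:
  assumes D: "ferrers D" and "row_gap D i q" "row_gap D i' q"
  shows "i = i'"
proof -
  have "False" if h: "i < i'" "\<forall>j. (i, j) \<in> D \<longleftrightarrow> j < l" "\<forall>j. (i', j) \<in> D \<longleftrightarrow> j < l'" "0 < l'"
    "q + i = last_row D + l" "q + i' = last_row D + l'" for i i' l l'
  proof -
    have "l < l'"
      using h by auto
    then show False
      using h ferrersD[OF D, of i' l i l] by auto
  qed
  then show ?thesis
    using assms(2,3) unfolding row_gap_def by (metis nat_neq_iff)
qed

lemma col_gap_unique:
  assumes D: "ferrers D" and "col_gap D j q" "col_gap D j' q"
  shows "j = j'"
proof -
  have "False" if h: "j < j'" "\<forall>i. (i, j) \<in> D \<longleftrightarrow> i < l" "\<forall>i. (i, j') \<in> D \<longleftrightarrow> i < l'" "0 < l'"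
    "q + l = Suc (j + last_row D)" "q + l' = Suc (j' + last_row D)" for j j' l l'
  proof -
    have "l < l'"
      using h by auto
    then show False
      using h ferrersD[OF D, of l j' l j] by auto
  qed
  then show ?thesis
    using assms(2,3) unfolding col_gap_def by (metis nat_neq_iff)
qed

section \<open>The local rule for \<open>iso\<close>\<close>

lemma point_above_iff: "point_above T (i, j) \<longleftrightarrow> (\<exists>i'<i. (i', j) \<in> points T)"
  and point_left_iff: "point_left T (i, j) \<longleftrightarrow> (\<exists>j'<j. (i, j') \<in> points T)"
  by (auto simp: point_above_def point_left_def)

lemma iso_point: "(i, j) \<in> points T \<Longrightarrow> iso T i j = ins_label T (i, j)"
  by (cases i; cases j) auto

text \<open>One rule for all empty cells: in the first row and column the root provides a point on
  exactly one side, and the label of the nearest point is passed on from neighbour to neighbour.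
  Each branch reads \<open>i - 1\<close> or \<open>j - 1\<close> only where the coordinate is
  positive.\<close>

lemma iso_not_point:
  assumes "(0, 0) \<in> points T" "(i, j) \<notin> points T"
  shows "iso T i j =
    (if point_above T (i, j) \<and> point_left T (i, j) then iso T (i - 1) (j - 1)
     else if point_above T (i, j) then iso T (i - 1) j
     else if point_left T (i, j) then iso T i (j - 1)
     else iso T (i - 1) (j - 1))"
proof (cases j)
  case 0
  with assms obtain i' where i: "i = Suc i'"
    by (cases i) auto
  have "iso T i 0 = iso T i' 0"
  proof (cases "(i', 0) \<in> points T")
    case True
    then have "Max {k. k < i \<and> (k, 0) \<in> points T} = i'"
      using i by (intro Max_eqI) auto
    then show ?thesis using True assms 0 by simp
  next
    case False
    then have "{k. k < i \<and> (k, 0) \<in> points T} = {k. k < i' \<and> (k, 0) \<in> points T}"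
      using i less_Suc_eq by auto
    then show ?thesis using False assms 0 by simp
  qed
  moreover have "point_above T (i, j)" "\<not> point_left T (i, j)"
    using 0 i assms by (auto simp: point_above_iff point_left_iff)
  ultimately show ?thesis using 0 i by simp
next
  case j: (Suc j')
  show ?thesis
  proof (cases i)
    case 0
    have "iso T 0 j = iso T 0 j'"
    proof (cases "(0, j') \<in> points T")
      case True
      then have "Max {k. k < j \<and> (0, k) \<in> points T} = j'"
        using j by (intro Max_eqI) auto
      then show ?thesis using True assms 0 j by (simp add: iso_point)
    next
      case False
      then have eq: "{k. k < j \<and> (0, k) \<in> points T} = {k. k < j' \<and> (0, k) \<in> points T}"
        using j less_Suc_eq by auto
      have "j' \<noteq> 0"
        using False assms by (metis)
      then obtain j'' where "j' = Suc j''"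
        by (cases j') auto
      then show ?thesis using False assms 0 j eq by simp
    qed
    moreover have "point_left T (i, j)" "\<not> point_above T (i, j)"
      using 0 j assms by (auto simp: point_above_iff point_left_iff)
    ultimately show ?thesis using 0 j by simp
  next
    case (Suc i')
    then show ?thesis using j assms by simp
  qed
qed

text \<open>This is the claim that the three neighbours of an empty cell agree if no point lies
  above it or to its left. The rule then reads the north-west cell; since the row to the left is
  empty too, the second statement, one column further left, equates this label with the west one.
  Hence the simultaneous induction.\<close>

lemma iso_empty_line:
  assumes "(0, 0) \<in> points T"
  shows "(\<forall>i'\<le>i. (i', j) \<notin> points T) \<longrightarrow> iso T i j = iso T i (j - 1)"
    and "(\<forall>j'\<le>j. (i, j') \<notin> points T) \<longrightarrow> iso T i j = iso T (i - 1) j"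
proof (induction "i + j" arbitrary: i j rule: less_induct)
  case less
  { case 1
    show ?case
    proof
      assume e: "\<forall>i'\<le>i. (i', j) \<notin> points T"
      then have ab: "(i, j) \<notin> points T" "\<not> point_above T (i, j)" "0 < j"
        using assms by (auto simp: point_above_iff intro: gr0I)
      show "iso T i j = iso T i (j - 1)"
      proof (cases "point_left T (i, j)")
        case True
        then show ?thesis using ab iso_not_point[OF assms ab(1)] by simp
      next
        case False
        then have "\<forall>j'\<le>j - 1. (i, j') \<notin> points T"
          using ab by (auto simp: point_left_iff)
        then have "iso T i (j - 1) = iso T (i - 1) (j - 1)"
          using less(2)[of i "j - 1"] ab by simp
        then show ?thesis using False ab iso_not_point[OF assms ab(1)] by simp
      qed
    qed
  next
    case 2
    show ?case
    proof
      assume e: "\<forall>j'\<le>j. (i, j') \<notin> points T"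
      then have ab: "(i, j) \<notin> points T" "\<not> point_left T (i, j)" "0 < i"
        using assms by (auto simp: point_left_iff intro: gr0I)
      show "iso T i j = iso T (i - 1) j"
      proof (cases "point_above T (i, j)")
        case True
        then show ?thesis using ab iso_not_point[OF assms ab(1)] by simp
      next
        case False
        then have "\<forall>i'\<le>i - 1. (i', j) \<notin> points T"
          using ab by (auto simp: point_above_iff)
        then have "iso T (i - 1) j = iso T (i - 1) (j - 1)"
          using less(1)[of "i - 1" j] ab by simp
        then show ?thesis using False ab iso_not_point[OF assms ab(1)] by simp
      qed
    qed
  }
qed

subsection \<open>Ribbons and the special point\<close>

text \<open>The content \<open>j - i\<close> of a cell \<open>(i, j)\<close> increases by one with each step of the rim path.
  Inequalities between contents are stated without subtraction.\<close>

definition inner_ribbon :: "cell set \<Rightarrow> nat \<Rightarrow> nat \<Rightarrow> nat \<Rightarrow> nat \<Rightarrow> cell set" where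
  "inner_ribbon D r c a b = {(i, j). (i, j) \<in> rim D \<and> c + i < j + r \<and> j + a < b + i}"

text \<open>A diagonal shift preserves contents, so the new cells take over the positions of the old
  ones on the rim path.\<close>

definition outer_ribbon :: "cell set \<Rightarrow> nat \<Rightarrow> nat \<Rightarrow> nat \<Rightarrow> nat \<Rightarrow> cell set" where
  "outer_ribbon D r c a b = (\<lambda>(i, j). (Suc i, Suc j)) ` inner_ribbon D r c a b"

lemma mem_inner_ribbon:
  "(i, j) \<in> inner_ribbon D r c a b \<longleftrightarrow> (i, j) \<in> rim D \<and> c + i < j + r \<and> j + a < b + i"
  by (simp add: inner_ribbon_def)

lemma Suc_mem_outer_ribbon [simp]:
  "(Suc i, Suc j) \<in> outer_ribbon D r c a b \<longleftrightarrow> (i, j) \<in> inner_ribbon D r c a b"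
  by (auto simp: outer_ribbon_def)

lemma zero_notin_outer_ribbon [simp]:
  "(0, j) \<notin> outer_ribbon D r c a b" "(i, 0) \<notin> outer_ribbon D r c a b"
  by (auto simp: outer_ribbon_def)

lemma mem_outer_ribbon:
  "(i, j) \<in> outer_ribbon D r c a b \<longleftrightarrow> 0 < i \<and> 0 < j \<and> (i - 1, j - 1) \<in> inner_ribbon D r c a b"
  by (cases i; cases j) auto

text \<open>The conditions that \<open>(r, c)\<close> ends its row and \<open>(a, b)\<close> its
  column keep the enlarged set a diagram at the two ends of the ribbon. If the content of
  \<open>(a, b)\<close> does not exceed that of \<open>(r, c)\<close> by at least two, the ribbon is
  empty.\<close>

locale ribbon_addition =
  fixes D :: "cell set" and r c a b :: nat
  assumes ferrers: "ferrers D"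
    and start: "(r, c) \<in> D" "(r, Suc c) \<notin> D"
    and stop: "(a, b) \<in> D" "(Suc a, b) \<notin> D"
begin

abbreviation "E \<equiv> D \<union> outer_ribbon D r c a b"

lemma start_rim: "(r, c) \<in> rim D"
  using start ferrersD[OF ferrers, of "Suc r" "Suc c" r "Suc c"] by (auto simp: mem_rim)

lemma stop_rim: "(a, b) \<in> rim D"
  using stop ferrersD[OF ferrers, of "Suc a" "Suc b" "Suc a" b] by (auto simp: mem_rim)

lemma outer_disjoint: "(i, j) \<in> outer_ribbon D r c a b \<Longrightarrow> (i, j) \<notin> D"
  by (auto simp: outer_ribbon_def mem_inner_ribbon mem_rim)

text \<open>A cell outside \<open>D\<close> left of a ribbon cell has its north-west neighbour on
  the rim. As row \<open>r\<close> ends in column \<open>c\<close>, this neighbour is still beyond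
  \<open>(r, c)\<close>, so the cell belongs to the ribbon itself.\<close>

lemma left_of_outer:
  assumes "(i, j) \<in> inner_ribbon D r c a b" "j' \<le> j"
  shows "(Suc i, j') \<in> E"
proof (cases "(Suc i, j') \<in> D")
  case False
  have ij: "(i, j) \<in> D" "(i, j) \<in> rim D" "c + i < j + r" "j + a < b + i"
    using assms(1) by (auto simp: mem_inner_ribbon mem_rim)
  have "\<not> Suc i \<le> r \<or> \<not> j' \<le> c"
    using False start ferrersD[OF ferrers, of r c "Suc i" j'] by blast
  moreover have i: "i \<le> r \<and> c \<le> j"
    using rim_mono[OF ferrers start_rim ij(2)] ij by simp
  moreover have "i \<noteq> r"
    using ij i start ferrersD[OF ferrers, of i j r "Suc c"] by auto
  ultimately have "c < j'"
    by linarith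
  then obtain j'' where j'': "j' = Suc j''" "c \<le> j''"
    by (cases j') auto
  have "(i, j'') \<in> rim D"
    using False j'' ij assms(2) ferrersD[OF ferrers, of i j i j''] by (auto simp: mem_rim)
  then have "(i, j'') \<in> inner_ribbon D r c a b"
    using ij j'' i \<open>i \<noteq> r\<close> assms(2) by (auto simp: mem_inner_ribbon)
  then show ?thesis
    using j'' by simp
qed simp

lemma above_outer:
  assumes "(i, j) \<in> inner_ribbon D r c a b" "i' \<le> i"
  shows "(i', Suc j) \<in> E"
proof (cases "(i', Suc j) \<in> D")
  case False
  have ij: "(i, j) \<in> D" "(i, j) \<in> rim D" "c + i < j + r" "j + a < b + i"
    using assms(1) by (auto simp: mem_inner_ribbon mem_rim)
  have "\<not> i' \<le> a \<or> \<not> Suc j \<le> b"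
    using False stop ferrersD[OF ferrers, of a b i' "Suc j"] by blast
  moreover have i: "a \<le> i \<and> j \<le> b"
    using rim_mono[OF ferrers ij(2) stop_rim] ij by simp
  moreover have "j \<noteq> b"
    using ij i stop ferrersD[OF ferrers, of i j "Suc a" b] by auto
  ultimately have "a < i'"
    by linarith
  then obtain i'' where i'': "i' = Suc i''" "a \<le> i''"
    by (cases i') auto
  have "(i'', j) \<in> rim D"
    using False i'' ij assms(2) ferrersD[OF ferrers, of i j i'' j] by (auto simp: mem_rim)
  then have "(i'', j) \<in> inner_ribbon D r c a b"
    using ij i'' i \<open>j \<noteq> b\<close> assms(2) by (auto simp: mem_inner_ribbon)
  then show ?thesis
    using i'' by simp
qed simp

lemma ferrers_E: "ferrers E"
  unfolding ferrers_def
proof (intro conjI allI impI)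
  have "finite (inner_ribbon D r c a b)"
    by (rule finite_subset[OF _ ferrers_finite[OF ferrers]]) (auto simp: mem_inner_ribbon mem_rim)
  then show "finite E"
    using ferrers_finite[OF ferrers] by (simp add: outer_ribbon_def)
  show "(0, 0) \<in> E"
    using ferrers_corner[OF ferrers] by simp
  fix i j i' j'
  assume h: "(i, j) \<in> E" "i' \<le> i" "j' \<le> j"
  show "(i', j') \<in> E"
  proof (cases "(i, j) \<in> D")
    case True
    then show ?thesis using ferrersD[OF ferrers True h(2,3)] by simp
  next
    case False
    then obtain k l where kl: "i = Suc k" "j = Suc l" "(k, l) \<in> inner_ribbon D r c a b"
      using h by (cases i; cases j) auto
    then have "(k, l) \<in> D"
      by (simp add: mem_inner_ribbon mem_rim)
    then have "(i', j') \<in> D" if "i' \<le> k" "j' \<le> l"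
      using ferrersD[OF ferrers] that by blast
    moreover have "(i', j') \<in> E" if "i' = Suc k" "j' \<le> l"
      using left_of_outer[OF kl(3) that(2)] that by simp
    moreover have "(i', j') \<in> E" if "j' = Suc l" "i' \<le> k"
      using above_outer[OF kl(3) that(2)] that by simp
    moreover have "(i', j') \<in> E" if "i' = Suc k" "j' = Suc l"
      using that kl h by simp
    ultimately show ?thesis
      using h kl by (metis UnI1 le_SucE)
  qed
qed

lemma last_row_E: "last_row E = last_row D"
  by (rule last_row_eqI[OF ferrers_E]) (use last_row_iff[OF ferrers] in auto)

lemma last_col_E: "last_col E = last_col D"
  by (rule last_col_eqI[OF ferrers_E]) (use last_col_iff[OF ferrers] in auto)

lemma stop_rim_E: "(a, b) \<in> rim E"
  using stop_rim by (auto simp: mem_rim mem_inner_ribbon)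

text \<open>In this range of contents every old rim cell has acquired a south-east neighbour, so the
  added cells are the new rim. The ribbon that can be removed is thus the one that was
  added.\<close>

lemma inner_ribbon_E: "inner_ribbon E r c a b = outer_ribbon D r c a b"
proof -
  have "(i, j) \<in> inner_ribbon E r c a b \<longleftrightarrow> (i, j) \<in> outer_ribbon D r c a b" for i j
  proof
    assume h: "(i, j) \<in> inner_ribbon E r c a b"
    show "(i, j) \<in> outer_ribbon D r c a b"
    proof (rule ccontr)
      assume "(i, j) \<notin> outer_ribbon D r c a b"
      with h have "(i, j) \<in> inner_ribbon D r c a b"
        by (auto simp: mem_inner_ribbon mem_rim)
      then have "(Suc i, Suc j) \<in> E"
        by simp
      moreover have "(Suc i, Suc j) \<notin> E"
        using h unfolding mem_inner_ribbon mem_rim by blast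
      ultimately show False by blast
    qed
  next
    assume h: "(i, j) \<in> outer_ribbon D r c a b"
    then obtain k l where kl: "i = Suc k" "j = Suc l" "(k, l) \<in> inner_ribbon D r c a b"
      by (cases i; cases j) auto
    moreover have "(i, j) \<notin> D"
      using h by (rule outer_disjoint)
    moreover from this have "(Suc i, Suc j) \<notin> D"
      using ferrersD[OF ferrers, of "Suc i" "Suc j" i j] by auto
    ultimately show "(i, j) \<in> inner_ribbon E r c a b"
      using h by (auto simp: mem_inner_ribbon mem_rim)
  qed
  then show ?thesis by auto
qed

text \<open>The difference of contents leaves room for the rim cells \<open>(r - 1, c)\<close> and
  \<open>(a, b - 1)\<close> next to the ends; the two cells in question are their diagonal
  shifts.\<close>

lemma ribbon_ends:
  assumes "Suc (c + a) < b + r"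
  shows "(r, Suc c) \<in> E" "(Suc a, b) \<in> E"
proof -
  have ord: "a \<le> r \<and> c \<le> b"
    using rim_mono[OF ferrers start_rim stop_rim] assms by simp
  have "0 < r"
  proof (rule ccontr)
    assume "\<not> 0 < r"
    then show False
      using assms ord start stop ferrersD[OF ferrers, of a b r "Suc c"] by auto
  qed
  then have "(r - 1, c) \<in> inner_ribbon D r c a b"
    using assms start ferrersD[OF ferrers, of r c "r - 1" c] by (auto simp: mem_inner_ribbon mem_rim)
  then show "(r, Suc c) \<in> E"
    using \<open>0 < r\<close> by (simp add: mem_outer_ribbon)
  have "0 < b"
  proof (rule ccontr)
    assume "\<not> 0 < b"
    then show False
      using assms ord start stop ferrersD[OF ferrers, of r c "Suc a" b] by auto
  qed
  then have "(a, b - 1) \<in> inner_ribbon D r c a b"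
    using assms stop ferrersD[OF ferrers, of a b a "b - 1"] by (auto simp: mem_inner_ribbon mem_rim)
  then show "(Suc a, b) \<in> E"
    using \<open>0 < b\<close> by (simp add: mem_outer_ribbon)
qed

end

text \<open>Mirror image of \<open>ribbon_addition\<close>: the row of \<open>(r, c)\<close> and the
  column of \<open>(a, b)\<close> continue by one cell each, and these two cells are the ends of the
  ribbon.\<close>

locale ribbon_removal =
  fixes E :: "cell set" and r c a b :: nat
  assumes ferrers: "ferrers E"
    and start: "(r, Suc c) \<in> E" "(Suc r, Suc c) \<notin> E"
    and stop: "(Suc a, b) \<in> E" "(Suc a, Suc b) \<notin> E"
    and less: "c + a < b + r"
begin

abbreviation "D \<equiv> E - inner_ribbon E r c a b"

lemma start_rim: "(r, c) \<in> rim E"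
  using start ferrersD[OF ferrers, of r "Suc c" r c] by (auto simp: mem_rim)

lemma stop_rim: "(a, b) \<in> rim E"
  using stop ferrersD[OF ferrers, of "Suc a" b a b] by (auto simp: mem_rim)

text \<open>A remaining cell weakly south-east of a removed one shares its row or column and lies on
  the rim, hence beyond an end of the ribbon. In the row case both cells are in row
  \<open>a\<close>, and the cell below \<open>(a, b)\<close> forces a diagonal neighbour of the
  removed cell; the column case is symmetric at the other end.\<close>

lemma ferrers_D: "ferrers D"
  unfolding ferrers_def
proof (intro conjI allI impI)
  show "finite D"
    using ferrers_finite[OF ferrers] by simp
  have "r < a \<Longrightarrow> False"
    using rim_mono[OF ferrers start_rim stop_rim] less by simp
  then show "(0, 0) \<in> D"
    using ferrers_corner[OF ferrers] start stop ferrersD[OF ferrers, of r "Suc c" 1 1]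
      ferrersD[OF ferrers, of "Suc a" b 1 1]
    by (auto simp: mem_inner_ribbon mem_rim)
  fix i j i' j'
  assume h: "(i, j) \<in> D" "i' \<le> i" "j' \<le> j"
  then have E: "(i', j') \<in> E" "(i, j) \<in> E"
    using ferrersD[OF ferrers, of i j i' j'] by auto
  show "(i', j') \<in> D"
  proof (rule ccontr)
    assume "(i', j') \<notin> D"
    then have inn: "(i', j') \<in> rim E" "c + i' < j' + r" "j' + a < b + i'"
      using E by (auto simp: mem_inner_ribbon)
    then have "\<not> (Suc i' \<le> i \<and> Suc j' \<le> j)"
      using E ferrersD[OF ferrers, of i j "Suc i'" "Suc j'"] by (auto simp: mem_rim)
    then consider "i = i'" | "j = j'"
      using h by linarith
    moreover have rim: "(i, j) \<in> rim E"
      using inn E h ferrersD[OF ferrers, of "Suc i" "Suc j" "Suc i'" "Suc j'"] by (auto simp: mem_rim)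
    ultimately show False
    proof cases
      case 1
      then have "\<not> j + a < b + i"
        using rim h inn by (auto simp: mem_inner_ribbon)
      then have "b \<le> j" "i \<le> a"
        using rim_mono[OF ferrers stop_rim rim] by auto
      moreover have "a \<le> i'" "j' \<le> b"
        using rim_mono[OF ferrers inn(1) stop_rim] inn by auto
      moreover have "j' \<noteq> b"
        using inn 1 calculation by auto
      ultimately show False
        using 1 inn(1) stop ferrersD[OF ferrers, of "Suc a" b "Suc i'" "Suc j'"] by (auto simp: mem_rim)
    next
      case 2
      then have "\<not> c + i < j + r"
        using rim h inn by (auto simp: mem_inner_ribbon)
      then have "j \<le> c" "r \<le> i"
        using rim_mono[OF ferrers rim start_rim] by auto
      moreover have "i' \<le> r" "c \<le> j'"
        using rim_mono[OF ferrers start_rim inn(1)] inn by auto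
      moreover have "i' \<noteq> r"
        using inn 2 calculation by auto
      ultimately show False
        using 2 inn(1) start ferrersD[OF ferrers, of r "Suc c" "Suc i'" "Suc j'"] by (auto simp: mem_rim)
    qed
  qed
qed

text \<open>If the contents differed by exactly one, \<open>(r, Suc c)\<close> and
  \<open>(a, b)\<close> would be rim cells of equal content, hence equal; but the diagram continues
  below \<open>(a, b)\<close> and not below \<open>(r, Suc c)\<close>.\<close>

lemma content_gap: "Suc (c + a) < b + r"
proof (rule ccontr)
  assume "\<not> ?thesis"
  then have eq: "b + r = Suc c + a"
    using less by simp
  have "(r, Suc c) \<in> rim E"
    using start ferrersD[OF ferrers, of "Suc r" "Suc (Suc c)" "Suc r" "Suc c"] by (auto simp: mem_rim)
  then have "a = r \<and> b = Suc c"
    using rim_unique[OF ferrers stop_rim, of r "Suc c"] eq by simp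
  then show False
    using start stop by simp
qed

sublocale add: ribbon_addition D r c a b
proof
  show "ferrers D" by (rule ferrers_D)
  show "(r, c) \<in> D" "(a, b) \<in> D"
    using start_rim stop_rim by (auto simp: mem_inner_ribbon mem_rim)
  have "(r, Suc c) \<in> rim E"
    using start ferrersD[OF ferrers, of "Suc r" "Suc (Suc c)" "Suc r" "Suc c"] by (auto simp: mem_rim)
  then show "(r, Suc c) \<notin> D"
    using content_gap by (simp add: mem_inner_ribbon)
  have "(Suc a, b) \<in> rim E"
    using stop ferrersD[OF ferrers, of "Suc (Suc a)" "Suc b" "Suc a" "Suc b"] by (auto simp: mem_rim)
  then show "(Suc a, b) \<notin> D"
    using content_gap by (simp add: mem_inner_ribbon)
qed

lemma outer_ribbon_D: "outer_ribbon D r c a b = inner_ribbon E r c a b"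
proof -
  have "(i, j) \<in> inner_ribbon D r c a b \<longleftrightarrow> (Suc i, Suc j) \<in> inner_ribbon E r c a b" for i j
  proof
    assume h: "(i, j) \<in> inner_ribbon D r c a b"
    then have "(i, j) \<in> E" "(i, j) \<notin> inner_ribbon E r c a b" "(Suc i, Suc j) \<notin> D"
      by (auto simp: mem_inner_ribbon mem_rim)
    with h show "(Suc i, Suc j) \<in> inner_ribbon E r c a b"
      by (auto simp: mem_inner_ribbon mem_rim)
  next
    assume h: "(Suc i, Suc j) \<in> inner_ribbon E r c a b"
    then have "(Suc i, Suc j) \<in> E"
      by (simp add: mem_inner_ribbon mem_rim)
    then have "(i, j) \<in> E" "(i, j) \<notin> rim E"
      using ferrersD[OF ferrers, of "Suc i" "Suc j" i j] by (auto simp: mem_rim)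
    with h show "(i, j) \<in> inner_ribbon D r c a b"
      by (auto simp: mem_inner_ribbon mem_rim)
  qed
  moreover have "0 < i \<and> 0 < j" if "(i, j) \<in> inner_ribbon E r c a b" for i j
  proof -
    have ij: "(i, j) \<in> rim E" "c + i < j + r" "j + a < b + i"
      using that by (auto simp: mem_inner_ribbon)
    then have "j \<le> b \<and> a \<le> i" "i \<le> r \<and> c \<le> j"
      using rim_mono[OF ferrers ij(1) stop_rim] rim_mono[OF ferrers start_rim ij(1)] by auto
    then show ?thesis
      using ij stop start ferrersD[OF ferrers, of "Suc a" b "Suc i" "Suc j"]
        ferrersD[OF ferrers, of r "Suc c" "Suc i" "Suc j"]
      by (cases i; cases j) (auto simp: mem_rim)
  qed
  ultimately have "(i, j) \<in> outer_ribbon D r c a b \<longleftrightarrow> (i, j) \<in> inner_ribbon E r c a b" for i j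
    by (cases i; cases j) force+
  then show ?thesis by auto
qed

lemma D_add_ribbon: "D \<union> outer_ribbon D r c a b = E"
  unfolding outer_ribbon_D by (auto simp: mem_inner_ribbon mem_rim)

end

section \<open>The special point and its ribbon\<close>

lemma tree_like_iff:
  "tree_like T \<longleftrightarrow>
     ferrers (cells T) \<and> points T \<subseteq> cells T \<and> (0, 0) \<in> points T \<and>
     (\<forall>i j. (i, j) \<in> points T \<longrightarrow> (i, j) \<noteq> (0, 0) \<longrightarrow> point_above T (i, j) \<noteq> point_left T (i, j)) \<and>
     (\<forall>i j. (i, j) \<in> cells T \<longrightarrow> (\<exists>j'. (i, j') \<in> points T) \<and> (\<exists>i'. (i', j) \<in> points T))"
  unfolding tree_like_def ferrers_diagram_iff by fast

lemma tree_like_ferrers: "tree_like T \<Longrightarrow> ferrers (cells T)"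
  and tree_like_points: "tree_like T \<Longrightarrow> (i, j) \<in> points T \<Longrightarrow> (i, j) \<in> cells T"
  and tree_like_root: "tree_like T \<Longrightarrow> (0, 0) \<in> points T"
  and tree_like_parent: "tree_like T \<Longrightarrow> (i, j) \<in> points T \<Longrightarrow> (i, j) \<noteq> (0, 0) \<Longrightarrow>
    point_above T (i, j) \<noteq> point_left T (i, j)"
  and tree_like_row: "tree_like T \<Longrightarrow> (i, j) \<in> cells T \<Longrightarrow> \<exists>j'. (i, j') \<in> points T"
  and tree_like_col: "tree_like T \<Longrightarrow> (i, j) \<in> cells T \<Longrightarrow> \<exists>i'. (i', j) \<in> points T"
  unfolding tree_like_iff by blast+

lemma tree_like_finite: "tree_like T \<Longrightarrow> finite (points T)"
  by (meson ferrers_finite finite_subset tree_like_iff)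

text \<open>The maximum exists because the last row contains a point, which is the lowest cell of
  its column, and the columns are bounded.\<close>

lemma special_in:
  assumes T: "tree_like T" and s: "special T = (r, c)"
  shows "(r, c) \<in> points T" "(Suc r, c) \<notin> cells T"
    "\<And>i j. (i, j) \<in> points T \<Longrightarrow> (Suc i, j) \<notin> cells T \<Longrightarrow> j \<le> c"
proof -
  let ?P = "\<lambda>(i, j). (i, j) \<in> points T \<and> (Suc i, j) \<notin> cells T"
  have F: "ferrers (cells T)"
    using T by (rule tree_like_ferrers)
  have "(last_row (cells T), 0) \<in> cells T"
    using last_row_iff[OF F] by simp
  define m where "m = last_col (cells T)"
  have m: "(0, m) \<in> cells T" "\<And>i j. (i, j) \<in> cells T \<Longrightarrow> j \<le> m"
    using last_col_iff[OF F] ferrers_le_last_col[OF F] by (auto simp: m_def)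
  obtain j where "(last_row (cells T), j) \<in> points T"
    using tree_like_row[OF T \<open>(last_row (cells T), 0) \<in> cells T\<close>] by blast
  moreover have "(Suc (last_row (cells T)), j) \<notin> cells T"
    using ferrers_le_last_row[OF F, of "Suc (last_row (cells T))" j] by auto
  ultimately have ex: "?P (last_row (cells T), j)"
    by simp
  have bound: "\<forall>y. ?P y \<longrightarrow> snd y < Suc m"
    using m(2) tree_like_points[OF T] by (auto simp: less_Suc_eq_le)
  have "?P (special T) \<and> (\<forall>y. ?P y \<longrightarrow> snd y \<le> snd (special T))"
    unfolding special_def using arg_max_nat_lemma[of ?P, OF ex bound] by blast
  then show "(r, c) \<in> points T" "(Suc r, c) \<notin> cells T"
    "\<And>i j. (i, j) \<in> points T \<Longrightarrow> (Suc i, j) \<notin> cells T \<Longrightarrow> j \<le> c"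
    using s by auto
qed

lemma special_eqI:
  assumes T: "tree_like T" and "(r, c) \<in> points T" "(Suc r, c) \<notin> cells T"
    and "\<And>i j. (i, j) \<in> points T \<Longrightarrow> (Suc i, j) \<notin> cells T \<Longrightarrow> j \<le> c"
  shows "special T = (r, c)"
proof -
  obtain r' c' where s: "special T = (r', c')"
    by force
  note sp = special_in[OF T s]
  have "c' = c"
    using sp assms by (meson le_antisym)
  moreover have "r' = r"
  proof (rule ccontr)
    assume "r' \<noteq> r"
    then consider "Suc r \<le> r'" | "Suc r' \<le> r"
      by linarith
    then show False
      using sp(1,2) assms(2,3) \<open>c' = c\<close> ferrersD[OF tree_like_ferrers[OF T], of r c "Suc r'" c]
        ferrersD[OF tree_like_ferrers[OF T], of r' c "Suc r" c] tree_like_points[OF T]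
      by cases auto
  qed
  ultimately show ?thesis
    using s by simp
qed

lemma ribbon_empty: "special T = (r, c) \<Longrightarrow> (r, Suc c) \<notin> cells T \<Longrightarrow> ribbon T = {}"
  by (simp add: ribbon_def)

lemma ribbon_eq_inner:
  assumes F: "ferrers (cells T)" and s: "special T = (r, c)" and rc: "(r, Suc c) \<in> cells T" "(Suc r, c) \<notin> cells T"
    and p: "(a, b) \<in> rim (cells T)" "(a, b) \<in> points T" "c + a < b + r"
    and free: "\<And>i j. (i, j) \<in> inner_ribbon (cells T) r c a b \<Longrightarrow> (i, j) \<notin> points T"
  shows "ribbon T = inner_ribbon (cells T) r c a b"
proof -
  let ?D = "cells T"
  have rim1: "(r, Suc c) \<in> rim ?D"
    using rc ferrersD[OF F, of "Suc r" "Suc (Suc c)" "Suc r" c] by (auto simp: mem_rim)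
  have NE: "weakly_NE (r, Suc c) (i, j) \<longleftrightarrow> c + i < j + r" if "(i, j) \<in> rim ?D" for i j
    using rim_mono[OF F rim1 that] by (auto simp: weakly_NE_def)
  have "(i, j) \<in> ribbon T \<longleftrightarrow> (i, j) \<in> inner_ribbon ?D r c a b" for i j
  proof
    assume "(i, j) \<in> ribbon T"
    then have ij: "(i, j) \<in> rim ?D" "weakly_NE (r, Suc c) (i, j)"
      "\<not> (\<exists>y \<in> rim ?D \<inter> points T. weakly_NE (r, Suc c) y \<and> weakly_NE y (i, j))"
      using s rc by (auto simp: ribbon_def)
    have "j + a < b + i"
    proof (rule ccontr)
      assume "\<not> ?thesis"
      then have "weakly_NE (a, b) (i, j)"
        using rim_mono[OF F p(1) ij(1)] by (simp add: weakly_NE_def)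
      then show False
        using ij p NE[OF p(1)] by blast
    qed
    then show "(i, j) \<in> inner_ribbon ?D r c a b"
      using ij NE[OF ij(1)] by (simp add: mem_inner_ribbon)
  next
    assume h: "(i, j) \<in> inner_ribbon ?D r c a b"
    then have ij: "(i, j) \<in> rim ?D" "c + i < j + r" "j + a < b + i"
      by (auto simp: mem_inner_ribbon)
    have "False" if "(k, l) \<in> rim ?D" "(k, l) \<in> points T" "weakly_NE (r, Suc c) (k, l)"
      "weakly_NE (k, l) (i, j)" for k l
    proof -
      have "(k, l) \<in> inner_ribbon ?D r c a b"
        using that ij(3) NE[OF that(1)] by (auto simp: mem_inner_ribbon weakly_NE_def)
      then show False
        using free that by blast
    qed
    then show "(i, j) \<in> ribbon T"
      using s rc ij NE[OF ij(1)] by (auto simp: ribbon_def)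
  qed
  then show ?thesis by auto
qed

text \<open>The path meets a point at the latest in the last column, all of whose cells are on the
  rim. The first point after \<open>(r, c)\<close> lies right of column \<open>c\<close>, so by the
  choice of the special point it is not the lowest cell of its column.\<close>

lemma ribbon_stop_ex:
  assumes T: "tree_like T" and s: "special T = (r, c)" and rc: "(r, Suc c) \<in> cells T"
  shows "\<exists>a b. (a, b) \<in> rim (cells T) \<and> (a, b) \<in> points T \<and> c + a < b + r \<and> c < b \<and> (Suc a, b) \<in> cells T \<and>
    (\<forall>i j. (i, j) \<in> inner_ribbon (cells T) r c a b \<longrightarrow> (i, j) \<notin> points T)"
proof -
  let ?D = "cells T"
  note sp = special_in[OF T s]
  have F: "ferrers ?D"
    using T by (rule tree_like_ferrers)
  have rim0: "(r, c) \<in> rim ?D"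
    using sp ferrersD[OF F, of "Suc r" "Suc c" "Suc r" c] tree_like_points[OF T] by (auto simp: mem_rim)
  let ?P = "\<lambda>(i, j). (i, j) \<in> rim ?D \<and> (i, j) \<in> points T \<and> c + i < j + r"
  have "(0, last_col ?D) \<in> ?D"
    using last_col_iff[OF F] by simp
  then obtain i where i: "(i, last_col ?D) \<in> points T"
    using tree_like_col[OF T] by blast
  then have irim: "(i, last_col ?D) \<in> rim ?D"
    using tree_like_points[OF T i] ferrers_le_last_col[OF F, of "Suc i" "Suc (last_col ?D)"] by (auto simp: mem_rim)
  moreover have "c + i < last_col ?D + r"
    using rim_mono[OF F irim rim0] ferrers_le_last_col[OF F rc] by linarith
  ultimately have "?P (i, last_col ?D)"
    using i by simp
  \<comment> \<open>Minimises the content, shifted by \<open>last_row\<close> to stay within the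
    natural numbers.\<close>
  then obtain x where x: "?P x" "\<And>y. ?P y \<Longrightarrow> snd x + last_row ?D - fst x \<le> snd y + last_row ?D - fst y"
    using ex_has_least_nat[of ?P "(i, last_col ?D)" "\<lambda>y. snd y + last_row ?D - fst y"] by blast
  obtain a b where xab: "x = (a, b)"
    by force
  have ab: "(a, b) \<in> rim ?D" "(a, b) \<in> points T" "c + a < b + r"
    using x(1) xab by auto
  have ord: "a \<le> r \<and> c \<le> b"
    using rim_mono[OF F rim0 ab(1)] ab(3) by simp
  have "b \<noteq> c"
    using ord ab rc ferrersD[OF F, of r "Suc c" "Suc a" "Suc b"] by (auto simp: mem_rim)
  then have "c < b"
    using ord by simp
  then have "(Suc a, b) \<in> ?D"
    using sp(3)[OF ab(2)] by auto
  moreover have "(k, l) \<notin> points T" if h: "(k, l) \<in> inner_ribbon ?D r c a b" for k l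
  proof
    assume "(k, l) \<in> points T"
    then have "b + last_row ?D - a \<le> l + last_row ?D - k"
      using x(2)[of "(k, l)"] h xab by (simp add: mem_inner_ribbon)
    moreover have "a \<le> last_row ?D" "k \<le> last_row ?D"
      using ab h ferrers_le_last_row[OF F] by (auto simp: mem_inner_ribbon mem_rim)
    ultimately show False
      using h by (auto simp: mem_inner_ribbon)
  qed
  ultimately show ?thesis
    using ab \<open>c < b\<close> by blast
qed

subsection \<open>Inserting a special point\<close>

text \<open>The border step at \<open>(r, c)\<close> is the bottom of a column if \<open>below\<close> holds and the right end
  of a row otherwise; \<open>open_gap\<close> makes room for a new row or a new column, respectively.\<close>

definition up_row :: "bool \<Rightarrow> nat \<Rightarrow> nat \<Rightarrow> nat" where
  "up_row below r i = (if below \<and> r \<le> i then Suc i else i)"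

definition up_col :: "bool \<Rightarrow> nat \<Rightarrow> nat \<Rightarrow> nat" where
  "up_col below c j = (if \<not> below \<and> c \<le> j then Suc j else j)"

definition open_gap :: "bool \<Rightarrow> nat \<Rightarrow> nat \<Rightarrow> cell \<Rightarrow> cell" where
  "open_gap below r c = (\<lambda>(i, j). (up_row below r i, up_col below c j))"

definition new_line :: "bool \<Rightarrow> nat \<Rightarrow> nat \<Rightarrow> cell set" where
  "new_line below r c = {(i, j). if below then i = r \<and> j \<le> c else j = c \<and> i \<le> r}"

definition widen :: "bool \<Rightarrow> nat \<Rightarrow> nat \<Rightarrow> cell set \<Rightarrow> cell set" where
  "widen below r c D = open_gap below r c ` D \<union> new_line below r c"

text \<open>The ribbon is aimed at \<open>(u, v)\<close>, the place to which the old special point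
  moves. If that is not far enough beyond the corner, \<open>outer_ribbon\<close> is empty, which
  covers insertions without a ribbon.\<close>

definition add_special :: "bool \<Rightarrow> nat \<Rightarrow> nat \<Rightarrow> tableau \<Rightarrow> tableau" where
  "add_special below r c T = (case open_gap below r c (special T) of (u, v) \<Rightarrow>
     Tableau (widen below r c (cells T) \<union> outer_ribbon (widen below r c (cells T)) r c u v)
             (insert (r, c) (open_gap below r c ` points T)))"

text \<open>\<open>(r, c)\<close> is the place of the new point. It may have an old cell both above
  and to its left; the flag then distinguishes the two border steps that meet there.\<close>

definition insertion_site :: "cell set \<Rightarrow> bool \<Rightarrow> nat \<Rightarrow> nat \<Rightarrow> bool" where
  "insertion_site D below r c \<longleftrightarrow>
     (r, c) \<notin> D \<and> (if below then 0 < r \<and> (r - 1, c) \<in> D else 0 < c \<and> (r, c - 1) \<in> D)"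

lemma open_gap_simp [simp]: "open_gap below r c (i, j) = (up_row below r i, up_col below c j)"
  by (simp add: open_gap_def)

lemma up_row_eq_iff [simp]: "up_row below r i = up_row below r i' \<longleftrightarrow> i = i'"
  by (auto simp: up_row_def)

lemma up_col_eq_iff [simp]: "up_col below c j = up_col below c j' \<longleftrightarrow> j = j'"
  by (auto simp: up_col_def)

lemma up_row_less_iff [simp]: "up_row below r i < up_row below r i' \<longleftrightarrow> i < i'"
  by (auto simp: up_row_def)

lemma up_col_less_iff [simp]: "up_col below c j < up_col below c j' \<longleftrightarrow> j < j'"
  by (auto simp: up_col_def)

lemma up_col_le_iff [simp]: "up_col below c j \<le> up_col below c j' \<longleftrightarrow> j \<le> j'"
  by (auto simp: up_col_def)

lemma inj_open_gap: "inj_on (open_gap below r c) A"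
  by (rule inj_onI) auto

lemma open_gap_image_iff:
  "(i, j) \<in> open_gap below r c ` A \<longleftrightarrow> (\<exists>k l. (k, l) \<in> A \<and> i = up_row below r k \<and> j = up_col below c l)"
  by (simp add: open_gap_def image_iff Bex_def split_paired_Ex)

lemma open_gap_mem_image [simp]:
  "(up_row below r i, up_col below c j) \<in> open_gap below r c ` A \<longleftrightarrow> (i, j) \<in> A"
  by (simp add: open_gap_image_iff)

lemma open_gap_notin_line: "(up_row below r i, up_col below c j) \<notin> new_line below r c"
  "(up_row below r i, up_col below c j) \<noteq> (r, c)"
  by (auto simp: new_line_def up_row_def up_col_def)

lemma mem_widen_open [simp]:
  "(up_row below r i, up_col below c j) \<in> widen below r c D \<longleftrightarrow> (i, j) \<in> D"
  by (simp add: widen_def open_gap_notin_line)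

lemma mem_open_below:
  "(i, j) \<in> open_gap True r c ` A \<longleftrightarrow> i < r \<and> (i, j) \<in> A \<or> r < i \<and> (i - 1, j) \<in> A"
proof -
  have "(i, j) \<in> open_gap True r c ` A \<longleftrightarrow> (\<exists>k. i = up_row True r k \<and> (k, j) \<in> A)"
    by (simp add: open_gap_image_iff up_col_def conj_commute)
  also have "\<dots> \<longleftrightarrow> i < r \<and> (i, j) \<in> A \<or> r < i \<and> (i - 1, j) \<in> A"
  proof
    assume "i < r \<and> (i, j) \<in> A \<or> r < i \<and> (i - 1, j) \<in> A"
    then show "\<exists>k. i = up_row True r k \<and> (k, j) \<in> A"
    proof
      assume "r < i \<and> (i - 1, j) \<in> A"
      then show ?thesis by (intro exI[of _ "i - 1"]) (auto simp: up_row_def)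
    qed (auto simp: up_row_def intro: exI[of _ i])
  qed (auto simp: up_row_def split: if_splits)
  finally show ?thesis .
qed

lemma mem_open_right:
  "(i, j) \<in> open_gap False r c ` A \<longleftrightarrow> j < c \<and> (i, j) \<in> A \<or> c < j \<and> (i, j - 1) \<in> A"
proof -
  have "(i, j) \<in> open_gap False r c ` A \<longleftrightarrow> (\<exists>k. j = up_col False c k \<and> (i, k) \<in> A)"
    by (simp add: open_gap_image_iff up_row_def conj_commute)
  also have "\<dots> \<longleftrightarrow> j < c \<and> (i, j) \<in> A \<or> c < j \<and> (i, j - 1) \<in> A"
  proof
    assume "j < c \<and> (i, j) \<in> A \<or> c < j \<and> (i, j - 1) \<in> A"
    then show "\<exists>k. j = up_col False c k \<and> (i, k) \<in> A"
    proof
      assume "c < j \<and> (i, j - 1) \<in> A"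
      then show ?thesis by (intro exI[of _ "j - 1"]) (auto simp: up_col_def)
    qed (auto simp: up_col_def intro: exI[of _ j])
  qed (auto simp: up_col_def split: if_splits)
  finally show ?thesis .
qed

lemma mem_widen_below:
  "(i, j) \<in> widen True r c D \<longleftrightarrow>
    i < r \<and> (i, j) \<in> D \<or> i = r \<and> j \<le> c \<or> r < i \<and> (i - 1, j) \<in> D"
  unfolding widen_def Un_iff mem_open_below by (auto simp: new_line_def)

lemma mem_widen_right:
  "(i, j) \<in> widen False r c D \<longleftrightarrow>
    j < c \<and> (i, j) \<in> D \<or> j = c \<and> i \<le> r \<or> c < j \<and> (i, j - 1) \<in> D"
  unfolding widen_def Un_iff mem_open_right by (auto simp: new_line_def)

section \<open>Shape, special point and labels after an insertion\<close>

locale insertion =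
  fixes T :: tableau and below :: bool and r c :: nat
  assumes tree: "tree_like T" and site: "insertion_site (cells T) below r c"
begin

abbreviation "W \<equiv> widen below r c (cells T)"
abbreviation "T1 \<equiv> add_special below r c T"
abbreviation "row \<equiv> up_row below r"
abbreviation "col \<equiv> up_col below c"
abbreviation "u \<equiv> row (fst (special T))"
abbreviation "v \<equiv> col (snd (special T))"

lemma ferrers: "ferrers (cells T)"
  using tree by (rule tree_like_ferrers)

lemma site_notin: "r \<le> i \<Longrightarrow> c \<le> j \<Longrightarrow> (i, j) \<notin> cells T"
  using site ferrersD[OF ferrers, of i j r c] by (auto simp: insertion_site_def)

lemma site_below: "below \<Longrightarrow> 0 < r \<and> (\<forall>i j. i < r \<longrightarrow> j \<le> c \<longrightarrow> (i, j) \<in> cells T)"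
  using site ferrersD[OF ferrers, of "r - 1" c] by (auto simp: insertion_site_def)

lemma site_right: "\<not> below \<Longrightarrow> 0 < c \<and> (\<forall>i j. i \<le> r \<longrightarrow> j < c \<longrightarrow> (i, j) \<in> cells T)"
  using site ferrersD[OF ferrers, of r "c - 1"] by (auto simp: insertion_site_def)

lemma cells_T1: "cells T1 = W \<union> outer_ribbon W r c u v"
  and points_T1: "points T1 = insert (r, c) (open_gap below r c ` points T)"
  by (simp_all add: add_special_def open_gap_def split: prod.split)

lemma point_open [simp]: "(row i, col j) \<in> points T1 \<longleftrightarrow> (i, j) \<in> points T"
  unfolding points_T1 using open_gap_notin_line(2)[of below r i c j] by auto

lemma point_cases:
  assumes "(i, j) \<in> points T1"
  obtains "i = r" "j = c" | i' j' where "i = row i'" "j = col j'" "(i', j') \<in> points T"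
  using assms unfolding points_T1 by auto

lemma W_corner: "(r, c) \<in> W" "(Suc r, c) \<notin> W" "(r, Suc c) \<notin> W"
  using site_notin[of r c] site_notin[of r "Suc c"] site_notin[of "Suc r" c]
  by (cases below; simp add: mem_widen_below mem_widen_right)+

lemma ferrers_W: "ferrers W"
proof -
  have fin: "finite W"
  proof -
    have "new_line below r c \<subseteq> {..r} \<times> {..c}"
      by (auto simp: new_line_def)
    then have "finite (new_line below r c)"
      by (rule finite_subset) simp
    then show ?thesis
      unfolding widen_def using ferrers_finite[OF ferrers] by simp
  qed
  have root: "(0, 0) \<in> W"
    using ferrers_corner[OF ferrers] site_below site_right
    by (cases below) (auto simp: mem_widen_below mem_widen_right)
  have "(i', j') \<in> W" if h: "(i, j) \<in> W" "i' \<le> i" "j' \<le> j" for i j i' j'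
  proof (cases below)
    case True
    from h(1) True consider "i < r" "(i, j) \<in> cells T" | "i = r" "j \<le> c" | "r < i" "(i - 1, j) \<in> cells T"
      by (auto simp: mem_widen_below)
    then show ?thesis
    proof cases
      case 1
      then have "(i', j') \<in> cells T"
        using ferrersD[OF ferrers] h by blast
      then show ?thesis using 1 h True by (simp add: mem_widen_below)
    next
      case 2
      then show ?thesis using h True site_below by (cases "i' = r") (auto simp: mem_widen_below)
    next
      case 3
      then have "j < c"
        using site_notin[of "i - 1" j] by (metis Suc_pred' bot_nat_0.not_eq_extremum less_Suc_eq_le linorder_not_le not_less0)
      moreover have "(i'', j') \<in> cells T" if "i'' \<le> i - 1" for i''
        using ferrersD[OF ferrers 3(2) that h(3)] .
      ultimately show ?thesis using h 3 True
        by (cases i' r rule: linorder_cases) (auto simp: mem_widen_below)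
    qed
  next
    case False
    from h(1) False consider "j < c" "(i, j) \<in> cells T" | "j = c" "i \<le> r" | "c < j" "(i, j - 1) \<in> cells T"
      by (auto simp: mem_widen_right)
    then show ?thesis
    proof cases
      case 1
      then have "(i', j') \<in> cells T"
        using ferrersD[OF ferrers] h by blast
      then show ?thesis using 1 h False by (simp add: mem_widen_right)
    next
      case 2
      then show ?thesis using h False site_right by (cases "j' = c") (auto simp: mem_widen_right)
    next
      case 3
      then have "i < r"
        using site_notin[of i "j - 1"] by (metis Suc_pred' bot_nat_0.not_eq_extremum less_Suc_eq_le linorder_not_le not_less0)
      moreover have "(i', j'') \<in> cells T" if "j'' \<le> j - 1" for j''
        using ferrersD[OF ferrers 3(2) h(2) that] .
      ultimately show ?thesis using h 3 False
        by (cases j' c rule: linorder_cases) (auto simp: mem_widen_right)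
    qed
  qed
  then show ?thesis
    unfolding ferrers_def using fin root by blast
qed

lemma last_row_W: "last_row W = (if below then Suc (last_row (cells T)) else last_row (cells T))"
proof (rule last_row_eqI[OF ferrers_W])
  have b: "(i, 0) \<in> cells T \<longleftrightarrow> i \<le> last_row (cells T)" for i
    by (rule last_row_iff[OF ferrers])
  have "below \<Longrightarrow> r \<le> Suc (last_row (cells T))"
    using site_below b[of "r - 1"] by fastforce
  then show "((if below then Suc (last_row (cells T)) else last_row (cells T)), 0) \<in> W"
    "(Suc (if below then Suc (last_row (cells T)) else last_row (cells T)), 0) \<notin> W"
    using b site_right by (cases below; auto simp: mem_widen_below mem_widen_right)+
qed

lemma last_col_W: "last_col W = (if below then last_col (cells T) else Suc (last_col (cells T)))"
proof (rule last_col_eqI[OF ferrers_W])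
  have b: "(0, i) \<in> cells T \<longleftrightarrow> i \<le> last_col (cells T)" for i
    by (rule last_col_iff[OF ferrers])
  have "\<not> below \<Longrightarrow> c \<le> Suc (last_col (cells T))"
    using site_right b[of "c - 1"] by fastforce
  then show "(0, (if below then last_col (cells T) else Suc (last_col (cells T)))) \<in> W"
    "(0, Suc (if below then last_col (cells T) else Suc (last_col (cells T)))) \<notin> W"
    using b site_below by (cases below; auto simp: mem_widen_below mem_widen_right)+
qed

lemma special_T: "(fst (special T), snd (special T)) \<in> points T" "(Suc (fst (special T)), snd (special T)) \<notin> cells T"
  "\<And>i j. (i, j) \<in> points T \<Longrightarrow> (Suc i, j) \<notin> cells T \<Longrightarrow> j \<le> snd (special T)"
  using special_in[OF tree, of "fst (special T)" "snd (special T)"] by auto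

lemma uv_point: "(u, v) \<in> points T1" "(u, v) \<in> W"
  using special_T(1) tree_like_points[OF tree special_T(1)] by simp_all

text \<open>Only a new row directly below the old special point could spoil this, but that row ends
  in column \<open>c\<close> and the hypothesis then puts the point to the right of it.\<close>

lemma uv_lowest:
  assumes "Suc (c + u) < v + r"
  shows "(Suc u, v) \<notin> W"
proof
  let ?i = "fst (special T)" and ?j = "snd (special T)"
  assume h: "(Suc u, v) \<in> W"
  show False
  proof (cases "Suc u = row (Suc ?i)")
    case True
    then show False
      using h special_T(2) by simp
  next
    case False
    then have *: below "u = ?i" "Suc ?i = r"
      by (auto simp: up_row_def split: if_splits)
    then have "c < v"
      using assms by simp
    then show False
      using h * by (simp add: mem_widen_below)
  qed
qed

lemma adding: "Suc (c + u) < v + r \<Longrightarrow> ribbon_addition W r c u v"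
  using ferrers_W W_corner uv_point uv_lowest by unfold_locales auto

lemma no_ribbon:
  assumes "\<not> Suc (c + u) < v + r"
  shows "outer_ribbon W r c u v = {}" "inner_ribbon D r c u v = {}" "cells T1 = W"
proof -
  show "inner_ribbon D r c u v = {}" for D
    using assms by (auto simp: inner_ribbon_def)
  then show "outer_ribbon W r c u v = {}"
    by (simp add: outer_ribbon_def)
  then show "cells T1 = W"
    by (simp add: cells_T1)
qed

lemma ferrers_T1: "ferrers (cells T1)"
proof (cases "Suc (c + u) < v + r")
  case True
  then show ?thesis
    unfolding cells_T1 using ribbon_addition.ferrers_E[OF adding] by blast
qed (simp add: no_ribbon ferrers_W)

lemma last_row_T1: "last_row (cells T1) = last_row W"
proof (cases "Suc (c + u) < v + r")
  case True
  then show ?thesis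
    unfolding cells_T1 using ribbon_addition.last_row_E[OF adding] by blast
qed (simp add: no_ribbon)

lemma last_col_T1: "last_col (cells T1) = last_col W"
proof (cases "Suc (c + u) < v + r")
  case True
  then show ?thesis
    unfolding cells_T1 using ribbon_addition.last_col_E[OF adding] by blast
qed (simp add: no_ribbon)

lemma inner_T1: "inner_ribbon (cells T1) r c u v = outer_ribbon W r c u v"
proof (cases "Suc (c + u) < v + r")
  case True
  then show ?thesis
    unfolding cells_T1 using ribbon_addition.inner_ribbon_E[OF adding] by blast
qed (simp add: no_ribbon)

lemma outer_notin: "(i, j) \<in> outer_ribbon W r c u v \<Longrightarrow> (i, j) \<notin> W"
  by (auto simp: outer_ribbon_def mem_inner_ribbon mem_rim)

lemma start_rim_T1: "(r, c) \<in> rim (cells T1)"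
  using W_corner ferrersD[OF ferrers_W, of "Suc r" "Suc c" r "Suc c"]
  by (auto simp: mem_rim cells_T1 mem_inner_ribbon)

lemma below_start: "(Suc r, c) \<notin> cells T1"
  using W_corner by (auto simp: cells_T1 mem_outer_ribbon mem_inner_ribbon)

lemma points_W: "(i, j) \<in> points T1 \<Longrightarrow> (i, j) \<in> W"
  by (erule point_cases) (auto simp: W_corner tree_like_points[OF tree])

text \<open>The new point is seen only from positions weakly south-east of \<open>(r, c)\<close>,
  where by \<open>site_notin\<close> there are no old cells.\<close>

lemma point_above_open:
  assumes "\<not> (r \<le> i \<and> c \<le> j)"
  shows "point_above T1 (row i, col j) \<longleftrightarrow> point_above T (i, j)"
proof
  assume "point_above T1 (row i, col j)"
  then obtain k where k: "k < row i" "(k, col j) \<in> points T1"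
    by (auto simp: point_above_iff)
  from k(2) show "point_above T (i, j)"
  proof (cases rule: point_cases)
    case 1
    then have "r \<le> i" "c \<le> j"
      using k by (auto simp: up_row_def up_col_def split: if_splits)
    then show ?thesis using assms by blast
  next
    case (2 i' j')
    then show ?thesis using k by (auto simp: point_above_iff)
  qed
next
  assume "point_above T (i, j)"
  then obtain k where "k < i" "(k, j) \<in> points T"
    by (auto simp: point_above_iff)
  then have "row k < row i \<and> (row k, col j) \<in> points T1"
    by simp
  then show "point_above T1 (row i, col j)"
    unfolding point_above_iff by blast
qed

lemma point_left_open:
  assumes "\<not> (r \<le> i \<and> c \<le> j)"
  shows "point_left T1 (row i, col j) \<longleftrightarrow> point_left T (i, j)"
proof
  assume "point_left T1 (row i, col j)"
  then obtain k where k: "k < col j" "(row i, k) \<in> points T1"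
    by (auto simp: point_left_iff)
  from k(2) show "point_left T (i, j)"
  proof (cases rule: point_cases)
    case 1
    then have "r \<le> i" "c \<le> j"
      using k by (auto simp: up_row_def up_col_def split: if_splits)
    then show ?thesis using assms by blast
  next
    case (2 i' j')
    then show ?thesis using k by (auto simp: point_left_iff)
  qed
next
  assume "point_left T (i, j)"
  then obtain k where "k < j" "(i, k) \<in> points T"
    by (auto simp: point_left_iff)
  then have "col k < col j \<and> (row i, col k) \<in> points T1"
    by simp
  then show "point_left T1 (row i, col j)"
    unfolding point_left_iff by blast
qed

lemma point_below_iff:
  assumes below
  shows "(i, j) \<in> points T1 \<longleftrightarrow> i = r \<and> j = c \<or> i < r \<and> (i, j) \<in> points T \<or> r < i \<and> (i - 1, j) \<in> points T"
proof -
  have b: "below = True"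
    using assms by simp
  show ?thesis
    unfolding points_T1 unfolding b by (simp add: mem_open_below)
qed

lemma point_right_iff:
  assumes "\<not> below"
  shows "(i, j) \<in> points T1 \<longleftrightarrow> i = r \<and> j = c \<or> j < c \<and> (i, j) \<in> points T \<or> c < j \<and> (i, j - 1) \<in> points T"
proof -
  have b: "below = False"
    using assms by simp
  show ?thesis
    unfolding points_T1 unfolding b by (simp add: mem_open_right)
qed

lemma new_row_left: "below \<Longrightarrow> j \<le> c \<Longrightarrow> \<not> point_left T1 (r, j)"
  unfolding point_left_iff by (subst point_below_iff) auto

lemma new_col_above: "\<not> below \<Longrightarrow> i \<le> r \<Longrightarrow> \<not> point_above T1 (i, c)"
  unfolding point_above_iff by (subst point_right_iff) auto

text \<open>Reads \<open>below\<close> off the new tableau, so that the removal deletes the line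
  that the insertion added. Column \<open>c\<close> is an old column if \<open>below\<close> holds,
  and all its points lie above row \<open>r\<close>.\<close>

lemma point_above_start: "point_above T1 (r, c) \<longleftrightarrow> below"
proof
  assume b: below
  have "(0, c) \<in> cells T"
    using site_below[OF b] by simp
  then obtain i where i: "(i, c) \<in> points T"
    using tree_like_col[OF tree] by blast
  then have "i < r"
    using site_notin[of i c] tree_like_points[OF tree] by (meson linorder_not_le order_refl)
  then show "point_above T1 (r, c)"
    unfolding point_above_iff point_below_iff[OF b] using i by blast
qed (use new_col_above in blast)

lemma point_left_start: "point_left T1 (r, c) \<longleftrightarrow> \<not> below"
proof
  assume b: "\<not> below"
  have "(r, 0) \<in> cells T"
    using site_right[OF b] by simp
  then obtain j where j: "(r, j) \<in> points T"
    using tree_like_row[OF tree] by blast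
  then have "j < c"
    using site_notin[of r j] tree_like_points[OF tree] by (meson linorder_not_le order_refl)
  then show "point_left T1 (r, c)"
    unfolding point_left_iff point_right_iff[OF b] using j by blast
qed (use new_row_left in blast)

lemma W_cases:
  assumes "(i, j) \<in> W"
  obtains "(i, j) \<in> new_line below r c" | i' j' where "i = row i'" "j = col j'" "(i', j') \<in> cells T"
  using assms unfolding widen_def by auto

lemma tree_T1: "tree_like T1"
  unfolding tree_like_iff
proof (intro conjI allI impI ferrers_T1)
  show "points T1 \<subseteq> cells T1"
    using points_W by (auto simp: cells_T1)
  show "(0, 0) \<in> points T1"
  proof (cases below)
    case True
    show ?thesis
      unfolding point_below_iff[OF True] using tree_like_root[OF tree] site_below[OF True] by blast
  next
    case False
    show ?thesis
      unfolding point_right_iff[OF False] using tree_like_root[OF tree] site_right[OF False] by blast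
  qed
  fix i j
  show "point_above T1 (i, j) \<noteq> point_left T1 (i, j)"
    if h: "(i, j) \<in> points T1" "(i, j) \<noteq> (0, 0)"
    using h(1)
  proof (cases rule: point_cases)
    case 1
    then show ?thesis using point_above_start point_left_start by simp
  next
    case (2 i' j')
    have "row 0 = 0" "col 0 = 0"
      using site_below site_right by (auto simp: up_row_def up_col_def)
    then have "(i', j') \<noteq> (0, 0)"
      using 2(1,2) h(2) by (metis prod.inject)
    moreover have reg: "\<not> (r \<le> i' \<and> c \<le> j')"
      using site_notin tree_like_points[OF tree 2(3)] by blast
    ultimately show ?thesis
      using 2 tree_like_parent[OF tree 2(3)]
      by (simp add: point_above_open[OF reg] point_left_open[OF reg])
  qed
  assume h: "(i, j) \<in> cells T1"
  \<comment> \<open>The ribbon adds no row or column, so every line of \<open>T1\<close> is the new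
    one or comes from \<open>T\<close>.\<close>
  have "i \<le> last_row W" "j \<le> last_col W"
    using ferrers_le_last_row[OF ferrers_T1 h] ferrers_le_last_col[OF ferrers_T1 h] last_row_T1 last_col_T1 by auto
  then have *: "(i, 0) \<in> W" "(0, j) \<in> W"
    using last_row_iff[OF ferrers_W] last_col_iff[OF ferrers_W] by auto
  have rc: "(r, c) \<in> points T1"
    by (simp add: points_T1)
  show "\<exists>j'. (i, j') \<in> points T1"
  proof (cases "i = r")
    case False
    obtain i' where i': "i = row i'"
      using False by (metis diff_Suc_1 leI le_imp_less_Suc less_Suc_eq_le not_less_eq up_row_def Suc_pred gr_implies_not0 neq0_conv nat_neq_iff)
    have "(i', 0) \<in> cells T"
      using *(1) i' False mem_widen_open[of below r i' c 0 "cells T"] site_right site_below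
      by (cases below) (auto simp: mem_widen_below mem_widen_right up_row_def split: if_splits)
    then obtain j' where "(i', j') \<in> points T"
      using tree_like_row[OF tree] by blast
    then have "(i, col j') \<in> points T1"
      by (simp add: i')
    then show ?thesis by blast
  qed (use rc in blast)
  show "\<exists>i'. (i', j) \<in> points T1"
  proof (cases "j = c")
    case False
    obtain j' where j': "j = col j'"
      using False by (metis diff_Suc_1 leI le_imp_less_Suc less_Suc_eq_le not_less_eq up_col_def Suc_pred gr_implies_not0 neq0_conv nat_neq_iff)
    have "(0, j') \<in> cells T"
      using *(2) j' False site_right site_below
      by (cases below) (auto simp: mem_widen_below mem_widen_right up_col_def split: if_splits)
    then obtain i' where "(i', j') \<in> points T"
      using tree_like_col[OF tree] by blast
    then have "(row i', j) \<in> points T1"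
      by (simp add: j')
    then show ?thesis by blast
  qed (use rc in blast)
qed

text \<open>A rival column bottom right of \<open>c\<close> is a column bottom of \<open>T\<close>
  as well, because a new row does not reach beyond \<open>c\<close>. Hence it is not right of the
  old special point, and the ribbon runs below it.\<close>

lemma special_T1: "special T1 = (r, c)"
proof (rule special_eqI[OF tree_T1])
  show "(r, c) \<in> points T1"
    by (simp add: points_T1)
  show "(Suc r, c) \<notin> cells T1"
    by (rule below_start)
  fix i j
  assume h: "(i, j) \<in> points T1" "(Suc i, j) \<notin> cells T1"
  have nW: "(Suc i, j) \<notin> W"
    using h by (simp add: cells_T1)
  have iW: "(i, j) \<in> W"
    using points_W h by blast
  have rim: "(i, j) \<in> rim W" "(r, c) \<in> rim W"
    using nW iW W_corner ferrersD[OF ferrers_W, of "Suc i" "Suc j" "Suc i" j]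
      ferrersD[OF ferrers_W, of "Suc r" "Suc c" "Suc r" c] by (auto simp: mem_rim)
  show "j \<le> c"
  proof (rule ccontr)
    assume "\<not> j \<le> c"
    then have "c < j" by simp
    from h(1) show False
    proof (cases rule: point_cases)
      case 1
      then show False using \<open>c < j\<close> by simp
    next
      case (2 i' j')
      have "(Suc i', j') \<notin> cells T"
      proof
        assume *: "(Suc i', j') \<in> cells T"
        then have "(row (Suc i'), j) \<in> W"
          using 2 by simp
        then have "row (Suc i') \<noteq> Suc i"
          using nW by auto
        then have "below" "Suc i' = r"
          using 2 by (auto simp: up_row_def split: if_splits)
        then show False
          using * 2 \<open>c < j\<close> site_notin[of "Suc i'" j'] by (simp add: up_col_def)
      qed
      then have "j' \<le> snd (special T)"
        using special_T(3) 2 by blast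
      then have "j \<le> v"
        using 2 by simp
      \<comment> \<open>Otherwise \<open>(Suc i, j)\<close> would be weakly north-west of
        \<open>(u, v)\<close> and thus in \<open>W\<close>.\<close>
      then have "u \<le> i"
        using nW uv_point(2) ferrersD[OF ferrers_W, of u v "Suc i" j] by (meson not_less_eq_eq)
      have "c + i < j + r"
        using rim_mono[OF ferrers_W rim] \<open>c < j\<close> by linarith
      then have "i \<le> r"
        using rim_mono[OF ferrers_W rim(2,1)] by simp
      moreover have "i \<noteq> r"
        using iW W_corner(3) \<open>c < j\<close> ferrersD[OF ferrers_W, of i j r "Suc c"] by auto
      ultimately have "c + i < j - 1 + r"
        using \<open>c < j\<close> by simp
      moreover have "j - 1 + u < v + i"
        using \<open>c < j\<close> \<open>j \<le> v\<close> \<open>u \<le> i\<close> by simp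
      moreover have "(i, j - 1) \<in> rim W"
        using iW nW \<open>c < j\<close> ferrersD[OF ferrers_W, of i j i "j - 1"] by (auto simp: mem_rim)
      ultimately have "(Suc i, j) \<in> outer_ribbon W r c u v"
        using \<open>c < j\<close> by (simp add: mem_outer_ribbon mem_inner_ribbon)
      then show False
        using h by (simp add: cells_T1)
    qed
  qed
qed

text \<open>All points lie in \<open>W\<close>, so none is on the ribbon, and the rim cell that
  follows it is the old special point, where the search stops.\<close>

lemma ribbon_T1: "ribbon T1 = outer_ribbon W r c u v"
proof (cases "Suc (c + u) < v + r")
  case True
  interpret ribbon_addition W r c u v
    using adding[OF True] .
  have "ribbon T1 = inner_ribbon (cells T1) r c u v"
  proof (rule ribbon_eq_inner[OF ferrers_T1 special_T1])
    show "(r, Suc c) \<in> cells T1"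
      using ribbon_ends[OF True] by (simp add: cells_T1)
    show "(u, v) \<in> rim (cells T1)"
      using stop_rim_E by (simp add: cells_T1)
    show "c + u < v + r"
      using True by simp
    show "(i, j) \<notin> points T1" if "(i, j) \<in> inner_ribbon (cells T1) r c u v" for i j
      using that outer_notin points_W inner_T1 by blast
  qed (use below_start uv_point in auto)
  then show ?thesis
    by (simp add: inner_T1)
next
  case False
  then show ?thesis
    using no_ribbon ribbon_empty[OF special_T1] W_corner by simp
qed

lemma close_open: "close_gap T1 (row i, col j) = (i, j)"
  by (auto simp: close_gap_def special_T1 point_above_start up_row_def up_col_def)

lemma start_notin_old: "(r, c) \<notin> open_gap below r c ` points T"
  unfolding open_gap_image_iff using open_gap_notin_line(2)[of below r _ c] by metis

lemma remove_T1: "remove_special T1 = T"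
proof -
  have line: "deleted_line T1 = {(i, j). if below then i = r else j = c}"
    by (auto simp: deleted_line_def special_T1 point_above_start)
  have notin: "(row i, col j) \<notin> deleted_line T1" for i j
    by (auto simp: line up_row_def up_col_def)
  have "new_line below r c \<subseteq> deleted_line T1"
    by (auto simp: line new_line_def split: if_splits)
  then have "W - deleted_line T1 = open_gap below r c ` cells T"
    using notin unfolding widen_def by auto
  moreover have "cells T1 - ribbon T1 = W"
    using outer_notin unfolding ribbon_T1 cells_T1 by auto
  ultimately have "cells T1 - deleted_line T1 - ribbon T1 = open_gap below r c ` cells T"
    by blast
  moreover have "points T1 - {special T1} = open_gap below r c ` points T"
    using start_notin_old unfolding special_T1 points_T1 by simp
  moreover have "close_gap T1 (open_gap below r c x) = x" for x
    using close_open by (cases x) simp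
  then have "close_gap T1 ` open_gap below r c ` A = A" for A
    by (simp add: image_image)
  ultimately show ?thesis
    unfolding remove_special_def by (cases T) simp
qed

lemma tsize_T1: "tsize T1 = Suc (tsize T)"
  using tree_like_finite[OF tree] start_notin_old
  by (simp add: tsize_def points_T1 card_image[OF inj_open_gap])

lemma label_start: "ins_label T1 (r, c) = Suc (tsize T)"
  by (simp add: ins_label_def tsize_T1 special_T1)

lemma label_open: "ins_label T1 (row i, col j) = ins_label T (i, j)"
  using open_gap_notin_line(2)[of below r i c j]
  by (auto simp: ins_label_def tsize_T1 special_T1 remove_T1 close_open)

end

subsection \<open>The word of an insertion\<close>

definition crossing :: "tableau \<Rightarrow> nat \<Rightarrow> nat \<Rightarrow> bool" where
  "crossing T i j \<longleftrightarrow> (i, j) \<in> cells T \<and> point_above T (i, j) \<and> point_left T (i, j)"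

definition crossed_gap :: "tableau \<Rightarrow> nat \<Rightarrow> bool" where
  "crossed_gap T q \<longleftrightarrow> (\<exists>i j. crossing T i j \<and> (row_gap (cells T) i q \<or> col_gap (cells T) j q))"

definition baxter_tlt :: "tableau \<Rightarrow> bool" where
  "baxter_tlt T \<longleftrightarrow> \<not> contains_H T \<and> \<not> contains_V T"

lemma crossing_not_point:
  "tree_like T \<Longrightarrow> crossing T i j \<Longrightarrow> (i, j) \<notin> points T"
  using tree_like_parent[of T i j] by (auto simp: crossing_def point_above_iff)

lemma contains_H_iff:
  assumes T: "tree_like T"
  shows "contains_H T \<longleftrightarrow>
    (\<exists>r1 r2 c1 c2 c3. r1 < r2 \<and> c1 < c2 \<and> c2 < c3 \<and>
      (r1, c2) \<in> points T \<and> (r2, c1) \<in> points T \<and> (r2, c3) \<in> points T \<and>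
      (r1, c3) \<notin> points T \<and> (r2, c2) \<notin> points T)"
proof -
  have "{r1, r2} \<times> {c1, c2, c3} \<subseteq> cells T"
    if "r1 < r2" "c1 < c2" "c2 < c3" "(r2, c3) \<in> points T" for r1 r2 c1 c2 c3
  proof -
    have "(i, j) \<in> cells T" if "i \<le> r2" "j \<le> c3" for i j
      using that ferrersD[OF tree_like_ferrers[OF T] tree_like_points[OF T \<open>(r2, c3) \<in> points T\<close>]] by blast
    then show ?thesis using that by auto
  qed
  then show ?thesis
    unfolding contains_H_def by meson
qed

lemma contains_V_iff:
  assumes T: "tree_like T"
  shows "contains_V T \<longleftrightarrow>
    (\<exists>r1 r2 r3 c1 c2. r1 < r2 \<and> r2 < r3 \<and> c1 < c2 \<and>
      (r1, c2) \<in> points T \<and> (r2, c1) \<in> points T \<and> (r3, c2) \<in> points T \<and>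
      (r2, c2) \<notin> points T \<and> (r3, c1) \<notin> points T)"
proof -
  have "{r1, r2, r3} \<times> {c1, c2} \<subseteq> cells T"
    if "r1 < r2" "r2 < r3" "c1 < c2" "(r3, c2) \<in> points T" for r1 r2 r3 c1 c2
  proof -
    have "(i, j) \<in> cells T" if "i \<le> r3" "j \<le> c2" for i j
      using that ferrersD[OF tree_like_ferrers[OF T] tree_like_points[OF T \<open>(r3, c2) \<in> points T\<close>]] by blast
    then show ?thesis using that by auto
  qed
  then show ?thesis
    unfolding contains_V_def by meson
qed

lemma row_gap_value_unique: "row_gap D i q \<Longrightarrow> row_gap D i q' \<Longrightarrow> q = q'"
  unfolding row_gap_def by (metis add_right_cancel linorder_neqE_nat less_irrefl)

lemma col_gap_value_unique: "col_gap D j q \<Longrightarrow> col_gap D j q' \<Longrightarrow> q = q'"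
  unfolding col_gap_def by (metis add_right_cancel linorder_neqE_nat less_irrefl)

lemma row_gap_ex:
  assumes D: "ferrers D" and "(i, j) \<in> D"
  shows "\<exists>q. row_gap D i q"
proof -
  obtain l where l: "\<forall>j. (i, j) \<in> D \<longleftrightarrow> j < l"
    using ferrers_row[OF D] by blast
  have "i \<le> last_row D" "0 < l"
    using ferrers_le_last_row[OF assms] assms l by auto
  then show ?thesis
    unfolding row_gap_def using l by (intro exI[of _ "last_row D + l - i"] exI[of _ l]) simp
qed

lemma col_gap_ex:
  assumes D: "ferrers D" and "(i, j) \<in> D"
  shows "\<exists>q. col_gap D j q"
proof -
  obtain h where h: "\<forall>i. (i, j) \<in> D \<longleftrightarrow> i < h"
    using ferrers_col[OF D] by blast
  have "0 < h" "(h - 1, j) \<in> D"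
    using assms h by (auto intro: diff_less)
  then have "h \<le> Suc (last_row D)"
    using ferrers_le_last_row[OF D] by fastforce
  then show ?thesis
    unfolding col_gap_def using h \<open>0 < h\<close> by (intro exI[of _ "Suc (j + last_row D) - h"] exI[of _ h]) simp
qed

lemma row_gap_end:
  assumes D: "ferrers D" and "row_gap D i q"
  obtains m where "(i, m) \<in> D" "(i, Suc m) \<notin> D" "(i, m) \<in> rim D" "q + i = Suc (last_row D + m)"
proof -
  obtain l where l: "0 < l" "\<forall>j. (i, j) \<in> D \<longleftrightarrow> j < l" "q + i = last_row D + l"
    using assms(2) unfolding row_gap_def by blast
  have "(i, l - 1) \<in> D" "(i, Suc (l - 1)) \<notin> D" "q + i = Suc (last_row D + (l - 1))"
    using l by auto
  moreover from this have "(i, l - 1) \<in> rim D"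
    using ferrersD[OF D, of "Suc i" "Suc (l - 1)" i "Suc (l - 1)"] by (auto simp: mem_rim)
  ultimately show thesis using that by blast
qed

lemma col_gap_end:
  assumes D: "ferrers D" and "col_gap D j q"
  obtains m where "(m, j) \<in> D" "(Suc m, j) \<notin> D" "(m, j) \<in> rim D" "q + m = j + last_row D"
proof -
  obtain l where l: "0 < l" "\<forall>i. (i, j) \<in> D \<longleftrightarrow> i < l" "q + l = Suc (j + last_row D)"
    using assms(2) unfolding col_gap_def by blast
  have "(l - 1, j) \<in> D" "(Suc (l - 1), j) \<notin> D" "q + (l - 1) = j + last_row D"
    using l by auto
  moreover from this have "(l - 1, j) \<in> rim D"
    using ferrersD[OF D, of "Suc (l - 1)" "Suc j" "Suc (l - 1)" j] by (auto simp: mem_rim)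
  ultimately show thesis using that by blast
qed

text \<open>Undoes \<open>up_row\<close> on old rows and sends the new row to the row above it,
  whose labels it copies.\<close>

definition down_row :: "bool \<Rightarrow> nat \<Rightarrow> nat \<Rightarrow> nat" where
  "down_row below r i = (if below \<and> r \<le> i then i - 1 else i)"

definition down_col :: "bool \<Rightarrow> nat \<Rightarrow> nat \<Rightarrow> nat" where
  "down_col below c j = (if \<not> below \<and> c \<le> j then j - 1 else j)"

context insertion
begin

abbreviation "D \<equiv> cells T"
abbreviation "D1 \<equiv> cells T1"

abbreviation "sh_row \<equiv> down_row below r"
abbreviation "sh_col \<equiv> down_col below c"

lemma row_sh: "i \<noteq> r \<or> \<not> below \<Longrightarrow> row (sh_row i) = i"
  by (auto simp: up_row_def down_row_def)

lemma col_sh: "j \<noteq> c \<or> below \<Longrightarrow> col (sh_col j) = j"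
  by (auto simp: up_col_def down_col_def)

text \<open>Away from the new point the labels are those of \<open>T\<close> with one line doubled.
  The positions considered, inside the diagram or not, are closed under moving north and west, as
  the induction requires.\<close>

lemma iso_old:
  assumes "i < r \<or> j < c"
  shows "iso T1 i j = iso T (sh_row i) (sh_col j)"
  using assms
proof (induction "i + j" arbitrary: i j rule: less_induct)
  case less
  have root: "(0, 0) \<in> points T" "(0, 0) \<in> points T1"
    using tree_like_root[OF tree] tree_like_root[OF tree_T1] by auto
  have IH: "iso T1 k l = iso T (sh_row k) (sh_col l)" if "k \<le> i" "l \<le> j" "k + l < i + j" for k l
    using less(1)[of k l] less(2) that by auto
  consider "below" "i = r" | "\<not> below" "j = c" | "(\<not> below \<or> i \<noteq> r) \<and> (below \<or> j \<noteq> c)"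
    by blast
  then show ?case
  proof cases
    case 1
    then have "j < c" "0 < r"
      using less(2) site_below by auto
    have np: "(i, j) \<notin> points T1" and nl: "\<not> point_left T1 (i, j)"
      using new_row_left[of j] point_below_iff[OF 1(1), of i j] 1 \<open>j < c\<close> by auto
    have sh: "sh_row i = r - 1" "sh_col j = j" "sh_row (i - 1) = r - 1" "sh_col (j - 1) = j - 1"
      using 1 \<open>0 < r\<close> by (auto simp: down_row_def down_col_def)
    show ?thesis
    proof (cases "point_above T1 (i, j)")
      case True
      then have "iso T1 i j = iso T1 (i - 1) j"
        using nl iso_not_point[OF root(2) np] by simp
      also have "\<dots> = iso T (r - 1) j"
        using IH[of "i - 1" j] 1 \<open>0 < r\<close> sh by simp
      finally show ?thesis using sh by simp
    next
      case False
      \<comment> \<open>The new cell reads its north-west neighbour; since column \<open>j\<close>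
        is empty down to row \<open>r - 1\<close>, that label equals the one of the north
        neighbour.\<close>
      then have e: "\<forall>k\<le>r - 1. (k, j) \<notin> points T"
        using 1 \<open>0 < r\<close> unfolding point_above_iff point_below_iff[OF 1(1)] by auto
      have "iso T1 i j = iso T1 (i - 1) (j - 1)"
        using nl False iso_not_point[OF root(2) np] by simp
      also have "\<dots> = iso T (r - 1) (j - 1)"
        using IH[of "i - 1" "j - 1"] 1 \<open>0 < r\<close> sh by simp
      also have "\<dots> = iso T (r - 1) j"
        using iso_empty_line(1)[OF root(1), of "r - 1" j] e by simp
      finally show ?thesis using sh by simp
    qed
  next
    case 2
    then have "i < r" "0 < c"
      using less(2) site_right by auto
    have np: "(i, j) \<notin> points T1" and na: "\<not> point_above T1 (i, j)"
      using new_col_above[of i] point_right_iff[OF 2(1), of i j] 2 \<open>i < r\<close> by auto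
    have sh: "sh_row i = i" "sh_col j = c - 1" "sh_row (i - 1) = i - 1" "sh_col (j - 1) = c - 1"
      using 2 \<open>0 < c\<close> by (auto simp: down_row_def down_col_def)
    show ?thesis
    proof (cases "point_left T1 (i, j)")
      case True
      then have "iso T1 i j = iso T1 i (j - 1)"
        using na iso_not_point[OF root(2) np] by simp
      also have "\<dots> = iso T i (c - 1)"
        using IH[of i "j - 1"] 2 \<open>0 < c\<close> sh by simp
      finally show ?thesis using sh by simp
    next
      case False
      then have e: "\<forall>k\<le>c - 1. (i, k) \<notin> points T"
        using 2 \<open>0 < c\<close> unfolding point_left_iff point_right_iff[OF 2(1)] by auto
      have "iso T1 i j = iso T1 (i - 1) (j - 1)"
        using na False iso_not_point[OF root(2) np] by simp
      also have "\<dots> = iso T (i - 1) (c - 1)"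
        using IH[of "i - 1" "j - 1"] 2 \<open>0 < c\<close> sh by simp
      also have "\<dots> = iso T i (c - 1)"
        using iso_empty_line(2)[OF root(1), of "c - 1" i] e by simp
      finally show ?thesis using sh by simp
    qed
  next
    case 3
    then have rc: "row (sh_row i) = i" "col (sh_col j) = j"
      using row_sh col_sh by auto
    have reg: "\<not> (r \<le> sh_row i \<and> c \<le> sh_col j)"
      using less(2) by (auto simp: down_row_def down_col_def split: if_splits)
    have p: "(i, j) \<in> points T1 \<longleftrightarrow> (sh_row i, sh_col j) \<in> points T"
      using point_open[of "sh_row i" "sh_col j"] unfolding rc .
    have a: "point_above T1 (i, j) \<longleftrightarrow> point_above T (sh_row i, sh_col j)"
      using point_above_open[OF reg] unfolding rc .
    have l: "point_left T1 (i, j) \<longleftrightarrow> point_left T (sh_row i, sh_col j)"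
      using point_left_open[OF reg] unfolding rc .
    show ?thesis
    proof (cases "(i, j) \<in> points T1")
      case True
      then show ?thesis
        using p label_open[of "sh_row i" "sh_col j"] unfolding rc by (simp add: iso_point)
    next
      case np: False
      \<comment> \<open>Taking predecessors commutes with the shift except on the new line itself,
        which is excluded in this case.\<close>
      have m: "sh_row (i - 1) = sh_row i - 1" "sh_col (j - 1) = sh_col j - 1"
        using 3 by (auto simp: down_row_def down_col_def)
      have "(i, j) \<noteq> (0, 0)"
        using np root by metis
      then have lt: "i - 1 + (j - 1) < i + j" "point_above T1 (i, j) \<Longrightarrow> i - 1 + j < i + j"
        "point_left T1 (i, j) \<Longrightarrow> i + (j - 1) < i + j"
        by (auto simp: point_above_iff point_left_iff)
      have "iso T1 (i - 1) (j - 1) = iso T (sh_row i - 1) (sh_col j - 1)"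
        "point_above T1 (i, j) \<Longrightarrow> iso T1 (i - 1) j = iso T (sh_row i - 1) (sh_col j)"
        "point_left T1 (i, j) \<Longrightarrow> iso T1 i (j - 1) = iso T (sh_row i) (sh_col j - 1)"
        using IH[OF _ _ lt(1)] IH[OF _ _ lt(2)] IH[OF _ _ lt(3)] by (auto simp: m[unfolded One_nat_def])
      then show ?thesis
        using iso_not_point[OF root(2) np] iso_not_point[OF root(1), of "sh_row i" "sh_col j"] np p a l
        by simp
    qed
  qed
qed

text \<open>All points lie in \<open>W\<close>, which is closed towards the north-west; so the
  points in the row and the column of a cell outside \<open>W\<close> are to its left and above
  it.\<close>

lemma outer_crossing:
  assumes "(i, j) \<in> outer_ribbon W r c u v"
  shows "crossing T1 i j"
proof -
  have ij: "(i, j) \<in> D1"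
    using assms by (simp add: cells_T1)
  obtain k l where kl: "(k, j) \<in> points T1" "(i, l) \<in> points T1"
    using tree_like_row[OF tree_T1 ij] tree_like_col[OF tree_T1 ij] by blast
  have "(i, j) \<notin> W"
    using assms by (rule outer_notin)
  then have "k < i" "l < j"
    using points_W[OF kl(1)] points_W[OF kl(2)] ferrersD[OF ferrers_W, of k j i j]
      ferrersD[OF ferrers_W, of i l i j] by (meson linorder_not_le order_refl)+
  then show ?thesis
    unfolding crossing_def point_above_iff point_left_iff using kl ij by blast
qed

text \<open>Deleting the new line sends the rim of \<open>W\<close> without the corner into the rim
  of \<open>cells T\<close>. Relative to the respective last row, the position in the word is
  unchanged before the corner and drops by one behind it.\<close>

lemma rim_W:
  assumes "(i, j) \<in> rim W" "(i, j) \<noteq> (r, c)"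
  shows "i < r \<or> j < c" "(sh_row i, sh_col j) \<in> rim D"
    "(if j + r < c + i then sh_col j + last_row D + i = sh_row i + j + last_row W
      else c + i < j + r \<and> Suc (sh_col j + last_row D + i) = sh_row i + j + last_row W)"
proof -
  have ij: "(i, j) \<in> W" "(Suc i, Suc j) \<notin> W"
    using assms by (auto simp: mem_rim)
  have rim_s: "(r, c) \<in> rim W"
    using W_corner ferrersD[OF ferrers_W, of "Suc r" "Suc c" r "Suc c"] by (auto simp: mem_rim)
  have "\<not> (r \<le> i \<and> Suc c \<le> j)" "\<not> (Suc r \<le> i \<and> c \<le> j)"
    using W_corner ferrersD[OF ferrers_W ij(1)] by blast+
  then show less: "i < r \<or> j < c"
    using assms(2) by auto
  have ne: "j + r \<noteq> c + i"
    using rim_unique[OF ferrers_W assms(1) rim_s] assms(2) by auto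
  have ge: "c + i < j + r \<Longrightarrow> i \<le> r \<and> c \<le> j" "j + r < c + i \<Longrightarrow> r \<le> i \<and> j \<le> c"
    using rim_mono[OF ferrers_W rim_s assms(1)] rim_mono[OF ferrers_W assms(1) rim_s] by auto
  show "(sh_row i, sh_col j) \<in> rim D"
  proof (cases below)
    case True
    then have b: "below = True" by simp
    note ij' = ij[unfolded b mem_widen_below]
    show ?thesis
    proof (cases i r rule: linorder_cases)
      case less
      have "(Suc i, Suc j) \<notin> D"
      proof (cases "Suc i = r")
        case True
        then have "c \<le> Suc j"
          using ij'(2) by simp
        then show ?thesis
          using True site_notin[of "Suc i" "Suc j"] by simp
      qed (use ij'(2) less in auto)
      then show ?thesis
        using ij'(1) less b by (simp add: mem_rim down_row_def down_col_def)
    next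
      case equal
      then have "j < c"
        using \<open>i < r \<or> j < c\<close> by simp
      then have "(r - 1, j) \<in> D" "(r, Suc j) \<notin> D" "0 < r"
        using site_below[OF True] ij'(2) equal by auto
      then show ?thesis
        using equal b by (simp add: mem_rim down_row_def down_col_def)
    next
      case greater
      then show ?thesis
        using ij' b by (auto simp: mem_rim down_row_def down_col_def)
    qed
  next
    case False
    then have b: "below = False" by simp
    note ij' = ij[unfolded b mem_widen_right]
    show ?thesis
    proof (cases j c rule: linorder_cases)
      case less
      have "(Suc i, Suc j) \<notin> D"
      proof (cases "Suc j = c")
        case True
        then have "r \<le> Suc i"
          using ij'(2) by simp
        then show ?thesis
          using True site_notin[of "Suc i" "Suc j"] by simp
      qed (use ij'(2) less in auto)
      then show ?thesis
        using ij'(1) less b by (simp add: mem_rim down_row_def down_col_def)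
    next
      case equal
      then have "i < r"
        using \<open>i < r \<or> j < c\<close> by simp
      then have "(i, c - 1) \<in> D" "(Suc i, c) \<notin> D" "0 < c"
        using site_right[OF False] ij'(2) equal by auto
      then show ?thesis
        using equal b by (simp add: mem_rim down_row_def down_col_def)
    next
      case greater
      then show ?thesis
        using ij' b by (auto simp: mem_rim down_row_def down_col_def)
    qed
  qed
  show "(if j + r < c + i then sh_col j + last_row D + i = sh_row i + j + last_row W
      else c + i < j + r \<and> Suc (sh_col j + last_row D + i) = sh_row i + j + last_row W)"
    using ne ge less site_below site_right unfolding last_row_W down_row_def down_col_def
    by (auto split: if_splits)
qed

text \<open>Position of the corner \<open>(r, c)\<close> on the rim path, which is also the number
  of the border step that it replaces.\<close>

definition site_pos :: nat where
  "site_pos = c + last_row W - r"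

lemma site_pos: "site_pos + r = c + last_row W"
  using ferrers_le_last_row[OF ferrers_W W_corner(1)] by (simp add: site_pos_def)

lemma length_phi_T1: "length (phi T1) = Suc (length (phi T))"
  by (simp add: length_phi ferrers ferrers_T1 last_row_T1 last_col_T1 last_row_W last_col_W)

lemma site_pos_le: "site_pos \<le> length (phi T)"
proof -
  have "c \<le> last_col W" "r \<le> last_row W"
    using ferrers_le_last_col[OF ferrers_W W_corner(1)] ferrers_le_last_row[OF ferrers_W W_corner(1)] by auto
  moreover have "length (phi T) = last_col W + last_row W"
    by (simp add: length_phi ferrers last_row_W last_col_W)
  ultimately show ?thesis
    using site_pos by simp
qed

text \<open>A ribbon cell is a crossing and takes the label of its north-west neighbour, the rim
  cell of \<open>W\<close> with the same content. The word can therefore be read along the rim of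
  \<open>W\<close>, where \<open>rim_W\<close> and \<open>iso_old\<close> apply.\<close>

lemma phi_T1: "phi T1 = insert_at site_pos (Suc (tsize T)) (phi T)"
proof (rule nth_equalityI)
  show "length (phi T1) = length (insert_at site_pos (Suc (tsize T)) (phi T))"
    by (simp add: length_phi_T1)
  fix q
  assume "q < length (phi T1)"
  then have "q \<le> last_col D1 + last_row D1" and q: "q \<le> length (phi T)"
    by (simp add: length_phi ferrers_T1, simp add: length_phi_T1)
  then obtain a b where ab: "(a, b) \<in> rim D1" "b + last_row D1 = a + q"
    using rim_ex[OF ferrers_T1] by blast
  obtain i j where ij: "(i, j) \<in> rim W" "j + last_row W = i + q" "iso T1 a b = iso T1 i j"
  proof (cases "(a, b) \<in> W")
    case True
    then have "(a, b) \<in> rim W"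
      using ab by (auto simp: mem_rim cells_T1)
    then show ?thesis
      using that[of a b] ab last_row_T1 by simp
  next
    case False
    then have o: "(a, b) \<in> outer_ribbon W r c u v"
      using ab by (auto simp: mem_rim cells_T1)
    then have "0 < a" "0 < b" "(a - 1, b - 1) \<in> rim W"
      by (auto simp: mem_outer_ribbon mem_inner_ribbon)
    moreover have "iso T1 a b = iso T1 (a - 1) (b - 1)"
      using outer_crossing[OF o] crossing_not_point[OF tree_T1, of a b]
        iso_not_point[OF tree_like_root[OF tree_T1], of a b]
      by (simp add: crossing_def)
    ultimately show ?thesis
      using that[of "a - 1" "b - 1"] ab last_row_T1 by simp
  qed
  have phi: "phi T1 ! q = iso T1 i j"
    using phi_nth[OF ferrers_T1 ab] ij by simp
  show "phi T1 ! q = insert_at site_pos (Suc (tsize T)) (phi T) ! q"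
  proof (cases "(i, j) = (r, c)")
    case True
    then have "q = site_pos"
      using ij site_pos by auto
    moreover have "iso T1 i j = Suc (tsize T)"
      using True label_start by (simp add: iso_point points_T1)
    ultimately show ?thesis
      using phi site_pos_le by (simp add: nth_insert_at)
  next
    case False
    note rim = rim_W[OF ij(1) False]
    have iso: "phi T1 ! q = iso T (sh_row i) (sh_col j)"
      using phi iso_old[OF rim(1)] by simp
    show ?thesis
    proof (cases "j + r < c + i")
      case True
      then have "q < site_pos" "sh_col j + last_row D = sh_row i + q"
        using rim(3) ij(2) site_pos by auto
      then show ?thesis
        using iso phi_nth[OF ferrers rim(2)] site_pos_le q by (simp add: nth_insert_at)
    next
      case False
      then have "site_pos < q" "sh_col j + last_row D = sh_row i + (q - 1)"
        using rim(3) ij(2) site_pos by auto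
      then show ?thesis
        using iso phi_nth[OF ferrers rim(2)] site_pos_le q by (simp add: nth_insert_at)
    qed
  qed
qed

end

subsection \<open>Crossed lines and the forbidden patterns\<close>

lemma special_rim:
  assumes T: "tree_like T" and s: "special T = (x, y)"
  shows "(x, y) \<in> rim (cells T)"
proof -
  have "(Suc x, Suc y) \<notin> cells T"
    using special_in(2)[OF T s] ferrersD[OF tree_like_ferrers[OF T], of "Suc x" "Suc y" "Suc x" y] by auto
  then show ?thesis
    using special_in(1)[OF T s] tree_like_points[OF T] by (simp add: mem_rim)
qed

definition special_pos :: "tableau \<Rightarrow> nat" where
  "special_pos T = snd (special T) + last_row (cells T) - fst (special T)"

lemma special_pos:
  assumes T: "tree_like T"
  shows "special_pos T + fst (special T) = snd (special T) + last_row (cells T)"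
    "special_pos T < length (phi T)" "phi T ! special_pos T = tsize T"
proof -
  obtain x y where s: "special T = (x, y)"
    by force
  note p = special_in(1)[OF T s]
  have F: "ferrers (cells T)"
    using T by (rule tree_like_ferrers)
  have "x \<le> last_row (cells T)"
    using ferrers_le_last_row[OF F] tree_like_points[OF T p] by blast
  then show eq: "special_pos T + fst (special T) = snd (special T) + last_row (cells T)"
    by (simp add: special_pos_def s)
  have "tsize T \<noteq> 0"
    using tree_like_root[OF T] tree_like_finite[OF T] by (auto simp: tsize_def)
  then obtain k where "tsize T = Suc k"
    by (cases "tsize T") auto
  then have "ins_label T (x, y) = tsize T"
    by (simp add: ins_label_def s)
  then show "special_pos T < length (phi T)" "phi T ! special_pos T = tsize T"
    using phi_nth[OF F special_rim[OF T s], of "special_pos T"] eq s iso_point[OF p] by auto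
qed

context insertion
begin

text \<open>Translates the condition for a ribbon into the word: the new maximum precedes the old
  one with at least one entry in between. The point \<open>(u, v)\<close> keeps the label of the old
  maximum, whose position goes up by one.\<close>

lemma ribbon_pos:
  "Suc (c + u) < v + r \<longleftrightarrow> site_pos < special_pos T"
  "site_pos < special_pos T \<Longrightarrow> v + last_row W = u + Suc (special_pos T)"
proof -
  let ?x = "fst (special T)" and ?y = "snd (special T)"
  have xy: "(?x, ?y) \<in> D" "(Suc ?x, ?y) \<notin> D"
    using tree_like_points[OF tree special_T(1)] special_T(2) by auto
  have m: "special_pos T + ?x = ?y + last_row D"
    using special_pos[OF tree] by simp
  \<comment> \<open>Whether the new line moves the special point depends on its place relative to
    the site; the facts \<open>1\<close> and \<open>2\<close> exclude the impossible
    combinations.\<close>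
  have 1: "r \<le> ?x \<Longrightarrow> ?y < c"
    using xy(1) site_notin[of ?x ?y] by (meson linorder_not_le)
  have 2: "\<not> below \<Longrightarrow> ?y < c \<Longrightarrow> r \<le> ?x"
    using xy(2) site_right by (metis Suc_leI linorder_not_le)
  show "Suc (c + u) < v + r \<longleftrightarrow> site_pos < special_pos T"
    "site_pos < special_pos T \<Longrightarrow> v + last_row W = u + Suc (special_pos T)"
    using m 1 2 site_pos unfolding last_row_W up_row_def up_col_def
    by (cases "r \<le> ?x"; cases "c \<le> ?y"; auto split: if_splits)+
qed

lemma crossing_W:
  assumes "(i, j) \<in> W"
  shows "crossing T1 i j \<longleftrightarrow> (\<exists>i' j'. i = row i' \<and> j = col j' \<and> crossing T i' j')"
  using assms
proof (cases rule: W_cases)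
  case 1
  have "\<not> crossing T1 i j"
    using 1 new_row_left[of j] new_col_above[of i] by (auto simp: crossing_def new_line_def split: if_splits)
  moreover have "i \<noteq> row i' \<or> j \<noteq> col j'" for i' j'
    using 1 open_gap_notin_line(1)[of below r i' c j'] by auto
  ultimately show ?thesis by blast
next
  case (2 i' j')
  have reg: "\<not> (r \<le> i' \<and> c \<le> j')"
    using site_notin 2(3) by blast
  have "crossing T1 i j \<longleftrightarrow> crossing T i' j'"
    using 2 assms by (simp add: crossing_def point_above_open[OF reg] point_left_open[OF reg] cells_T1)
  then show ?thesis
    using 2 by auto
qed

text \<open>The chosen step is replaced by two steps around the corner: the bottom of column
  \<open>c\<close>, numbered \<open>site_pos\<close>, and the end of row \<open>r\<close>, numbered
  \<open>Suc site_pos\<close>. A chosen row end is therefore renumbered, a chosen column bottom is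
  not; hence \<open><\<close> here and \<open>\<le>\<close> in \<open>col_gap_up\<close>.\<close>

lemma row_gap_up:
  assumes "row_gap D i q"
  shows "row_gap W (row i) (if q < site_pos then q else Suc q)"
proof -
  obtain l where l: "0 < l" "\<And>j. (i, j) \<in> D \<longleftrightarrow> j < l" "q + i = last_row D + l"
    using assms unfolding row_gap_def by blast
  have high: "r \<le> i \<Longrightarrow> l \<le> c"
    using site_notin[of i c] l(2)[of c] by simp
  show ?thesis
  proof (cases below)
    case True
    then have b: "below = True" by simp
    have low: "i < r \<Longrightarrow> c < l"
      using site_below[OF True] l(2)[of c] by simp
    have "(row i, j) \<in> W \<longleftrightarrow> j < l" for j
      unfolding b mem_widen_below up_row_def using l(2)[of j] by auto
    moreover have "(if q < site_pos then q else Suc q) + row i = last_row W + l"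
      using l(3) high low site_pos True unfolding last_row_W up_row_def by (cases "r \<le> i") auto
    ultimately show ?thesis
      unfolding row_gap_def using l(1) by blast
  next
    case False
    then have b: "below = False" by simp
    have low: "i \<le> r \<Longrightarrow> c \<le> l"
      using site_right[OF False] l(2)[of "c - 1"] by fastforce
    define l' where "l' = (if i \<le> r then Suc l else l)"
    have "(row i, j) \<in> W \<longleftrightarrow> j < l'" for j
      unfolding b mem_widen_right up_row_def using l(2)[of j] l(2)[of "j - 1"] high low
      by (auto simp: l'_def)
    moreover have "(if q < site_pos then q else Suc q) + row i = last_row W + l'"
      using l(3) high low site_pos False unfolding last_row_W up_row_def l'_def by (cases "i \<le> r") auto
    moreover have "0 < l'"
      using l(1) by (simp add: l'_def)
    ultimately show ?thesis
      unfolding row_gap_def by blast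
  qed
qed

lemma col_gap_up:
  assumes "col_gap D j q"
  shows "col_gap W (col j) (if q \<le> site_pos then q else Suc q)"
proof -
  obtain h where h: "0 < h" "\<And>i. (i, j) \<in> D \<longleftrightarrow> i < h" "q + h = Suc (j + last_row D)"
    using assms unfolding col_gap_def by blast
  have high: "c \<le> j \<Longrightarrow> h \<le> r"
    using site_notin[of r j] h(2)[of r] by simp
  show ?thesis
  proof (cases below)
    case True
    then have b: "below = True" by simp
    have low: "j \<le> c \<Longrightarrow> r \<le> h"
      using site_below[OF True] h(2)[of "r - 1"] by fastforce
    define h' where "h' = (if j \<le> c then Suc h else h)"
    have "(i, col j) \<in> W \<longleftrightarrow> i < h'" for i
      unfolding b mem_widen_below up_col_def using h(2)[of i] h(2)[of "i - 1"] high low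
      by (auto simp: h'_def)
    moreover have "(if q \<le> site_pos then q else Suc q) + h' = Suc (col j + last_row W)"
      using h(3) high low site_pos True unfolding last_row_W up_col_def h'_def by (cases "j \<le> c") auto
    moreover have "0 < h'"
      using h(1) by (simp add: h'_def)
    ultimately show ?thesis
      unfolding col_gap_def by blast
  next
    case False
    then have b: "below = False" by simp
    have low: "j < c \<Longrightarrow> r < h"
      using site_right[OF False] h(2)[of r] by simp
    have "(i, col j) \<in> W \<longleftrightarrow> i < h" for i
      unfolding b mem_widen_right up_col_def using h(2)[of i] by auto
    moreover have "(if q \<le> site_pos then q else Suc q) + h = Suc (col j + last_row W)"
      using h(3) high low site_pos False unfolding last_row_W up_col_def by (cases "c \<le> j") auto
    ultimately show ?thesis
      unfolding col_gap_def using h(1) by blast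
  qed
qed

lemma row_gap_down:
  assumes "row_gap W (row i) q" "(i, j) \<in> D"
  shows "\<exists>q'. row_gap D i q' \<and> q = (if q' < site_pos then q' else Suc q')"
  using row_gap_ex[OF ferrers assms(2)] row_gap_up row_gap_value_unique[OF assms(1)] by blast

lemma col_gap_down:
  assumes "col_gap W (col j) q" "(i, j) \<in> D"
  shows "\<exists>q'. col_gap D j q' \<and> q = (if q' \<le> site_pos then q' else Suc q')"
  using col_gap_ex[OF ferrers assms(2)] col_gap_up col_gap_value_unique[OF assms(1)] by blast

text \<open>The first disjunct of \<open>bad_gap_insert_at\<close>, with \<open>site_pos\<close> for
  \<open>k\<close> and the position of the old maximum for \<open>m\<close>.\<close>

definition ribbon_gap :: "nat \<Rightarrow> bool" where
  "ribbon_gap q \<longleftrightarrow> site_pos < q \<and> q \<le> Suc (special_pos T) \<and> site_pos < special_pos T"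

lemma outer_pos:
  assumes "(i, j) \<in> outer_ribbon W r c u v" "q + i = j + last_row W"
  shows "site_pos < q \<and> q \<le> special_pos T"
proof -
  have h: "c + i < j + r" "j + u < v + i"
    using assms(1) by (auto simp: mem_outer_ribbon mem_inner_ribbon)
  then have "Suc (c + u) < v + r"
    by linarith
  then have "site_pos < special_pos T"
    using ribbon_pos(1) by blast
  from ribbon_pos(2)[OF this] show ?thesis
    using h assms(2) site_pos by linarith
qed

lemma outer_posI:
  assumes "(i, j) \<in> rim D1" "q + i = j + last_row W" "site_pos < q" "q \<le> special_pos T"
  shows "(i, j) \<in> outer_ribbon W r c u v"
proof -
  have "site_pos < special_pos T"
    using assms by linarith
  from ribbon_pos(2)[OF this] have "(i, j) \<in> inner_ribbon D1 r c u v"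
    using assms site_pos unfolding mem_inner_ribbon by linarith
  then show ?thesis
    unfolding inner_T1 .
qed

text \<open>If the row grew, its next cell would be a ribbon cell at position \<open>q\<close>, and
  \<open>outer_pos\<close> would make \<open>q\<close> a ribbon gap.\<close>

lemma row_gap_W_T1:
  assumes "row_gap W i q" "\<not> ribbon_gap q"
  shows "row_gap D1 i q"
proof -
  obtain m where m: "(i, m) \<in> W" "(i, Suc m) \<notin> W" "q + i = Suc (last_row W + m)"
    using row_gap_end[OF ferrers_W assms(1)] by metis
  have "(i, Suc m) \<notin> outer_ribbon W r c u v"
    using outer_pos[of i "Suc m" q] m(3) assms(2) by (auto simp: ribbon_gap_def)
  then show ?thesis
    using row_gapI[OF ferrers_T1, of i m q] m last_row_T1 by (simp add: cells_T1)
qed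

lemma col_gap_W_T1:
  assumes "col_gap W j q" "\<not> ribbon_gap q"
  shows "col_gap D1 j q"
proof -
  obtain m where m: "(m, j) \<in> W" "(Suc m, j) \<notin> W" "q + m = j + last_row W"
    using col_gap_end[OF ferrers_W assms(1)] by metis
  have "(Suc m, j) \<notin> outer_ribbon W r c u v"
  proof
    assume o: "(Suc m, j) \<in> outer_ribbon W r c u v"
    \<comment> \<open>The cell below the column bottom has position \<open>q - 1\<close>; the bound
      shows that \<open>q\<close> is positive.\<close>
    have "m < last_row D1"
      using ferrers_le_last_row[OF ferrers_T1, of "Suc m" j] o by (simp add: cells_T1)
    then have "site_pos < q - 1 \<and> q - 1 \<le> special_pos T"
      using outer_pos[OF o, of "q - 1"] m(3) last_row_T1 by simp
    then show False
      using assms(2) by (auto simp: ribbon_gap_def)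
  qed
  then show ?thesis
    using col_gapI[OF ferrers_T1, of m j q] m last_row_T1 by (simp add: cells_T1)
qed

lemma row_gap_T1_W:
  assumes "row_gap D1 i q" "\<not> ribbon_gap q"
  shows "row_gap W i q" "(i, j) \<in> D1 \<Longrightarrow> (i, j) \<in> W"
proof -
  obtain m where m: "(i, m) \<in> D1" "(i, Suc m) \<notin> D1" "q + i = Suc (last_row D1 + m)"
    using row_gap_end[OF ferrers_T1 assms(1)] by metis
  have "(i, m) \<notin> outer_ribbon W r c u v"
    using outer_pos[of i m "q - 1"] m(3) assms(2) last_row_T1 ferrers_le_last_row[OF ferrers_T1 m(1)]
    by (auto simp: ribbon_gap_def)
  then have mW: "(i, m) \<in> W" "(i, Suc m) \<notin> W"
    using m by (auto simp: cells_T1)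
  then show "row_gap W i q"
    using row_gapI[OF ferrers_W mW] m last_row_T1 by simp
  assume "(i, j) \<in> D1"
  then have "j \<le> m"
    using m ferrersD[OF ferrers_T1, of i j i "Suc m"] by (meson not_less_eq_eq order_refl)
  then show "(i, j) \<in> W"
    using ferrersD[OF ferrers_W mW(1)] by simp
qed

lemma col_gap_T1_W:
  assumes "col_gap D1 j q" "\<not> ribbon_gap q"
  shows "col_gap W j q" "(i, j) \<in> D1 \<Longrightarrow> (i, j) \<in> W"
proof -
  obtain m where m: "(m, j) \<in> D1" "(Suc m, j) \<notin> D1" "q + m = j + last_row D1"
    using col_gap_end[OF ferrers_T1 assms(1)] by metis
  have "(m, j) \<notin> outer_ribbon W r c u v"
    using outer_pos[of m j q] m(3) assms(2) last_row_T1 by (auto simp: ribbon_gap_def)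
  then have mW: "(m, j) \<in> W" "(Suc m, j) \<notin> W"
    using m by (auto simp: cells_T1)
  then show "col_gap W j q"
    using col_gapI[OF ferrers_W mW] m last_row_T1 by simp
  assume "(i, j) \<in> D1"
  then have "i \<le> m"
    using m ferrersD[OF ferrers_T1, of i j "Suc m" j] by (meson not_less_eq_eq order_refl)
  then show "(i, j) \<in> W"
    using ferrersD[OF ferrers_W mW(1)] by simp
qed

text \<open>In this range every border step ends a line whose last cell is in the ribbon, and ribbon
  cells are crossings. At the two extremes this rests on \<open>ribbon_ends\<close>, by which row
  \<open>r\<close> and column \<open>v\<close> are prolonged.\<close>

lemma ribbon_gap_crossed:
  assumes "ribbon_gap q"
  shows "crossed_gap T1 q"
proof -
  have q: "site_pos < q" "q \<le> Suc (special_pos T)" and lt: "site_pos < special_pos T"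
    using assms by (auto simp: ribbon_gap_def)
  have large: "Suc (c + u) < v + r"
    using ribbon_pos(1) lt by blast
  interpret ribbon_addition W r c u v
    using adding[OF large] .
  have ends: "(r, Suc c) \<in> D1" "(Suc u, v) \<in> D1" and uv: "(u, v) \<in> rim D1"
    using ribbon_ends[OF large] stop_rim_E by (simp_all add: cells_T1)
  have "v \<le> last_col D1" "u \<le> last_row D1"
    using uv ferrers_le_last_col[OF ferrers_T1] ferrers_le_last_row[OF ferrers_T1] by (auto simp: mem_rim)
  then have "q \<le> Suc (last_col D1 + last_row D1)"
    using q ribbon_pos(2)[OF lt] last_row_T1 by simp
  from gap_ex[OF ferrers_T1 this] show ?thesis
  proof (elim disjE exE)
    fix i assume g: "row_gap D1 i q"
    then obtain m where m: "(i, m) \<in> D1" "(i, Suc m) \<notin> D1" "(i, m) \<in> rim D1" "q + i = Suc (last_row D1 + m)"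
      using row_gap_end[OF ferrers_T1] by metis
    have "q - 1 \<noteq> site_pos"
    proof
      assume "q - 1 = site_pos"
      then have "i = r \<and> m = c"
        using m(4) q site_pos last_row_T1 by (intro rim_unique[OF ferrers_T1 m(3) start_rim_T1]) linarith
      then show False
        using ends m by simp
    qed
    then have "(i, m) \<in> outer_ribbon W r c u v"
      using outer_posI[OF m(3), of "q - 1"] q m(4) last_row_T1 by simp
    from outer_crossing[OF this] show ?thesis
      using g unfolding crossed_gap_def by blast
  next
    fix j assume g: "col_gap D1 j q"
    then obtain m where m: "(m, j) \<in> D1" "(Suc m, j) \<notin> D1" "(m, j) \<in> rim D1" "q + m = j + last_row D1"
      using col_gap_end[OF ferrers_T1] by metis
    have "q \<noteq> Suc (special_pos T)"
    proof
      assume "q = Suc (special_pos T)"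
      then have "m = u \<and> j = v"
        using m(4) ribbon_pos(2)[OF lt] last_row_T1 by (intro rim_unique[OF ferrers_T1 m(3) uv]) linarith
      then show False
        using ends m by simp
    qed
    then have "(m, j) \<in> outer_ribbon W r c u v"
      using outer_posI[OF m(3), of q] q m(4) last_row_T1 by simp
    from outer_crossing[OF this] show ?thesis
      using g unfolding crossed_gap_def by blast
  qed
qed

text \<open>Outside the range of the ribbon, the lines have the same cells in \<open>T1\<close> as
  in \<open>W\<close>, where by \<open>crossing_W\<close> all crossings are old ones. The chosen
  line has no crossing, so the different renumbering of rows and columns at \<open>site_pos\<close>
  has no effect.\<close>

lemma crossed_gap_T1:
  assumes free: "\<not> crossed_gap T site_pos"
  shows "crossed_gap T1 q \<longleftrightarrow>
    ribbon_gap q \<or> (q < site_pos \<and> crossed_gap T q) \<or> (Suc site_pos < q \<and> crossed_gap T (q - 1))"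
proof
  assume "crossed_gap T1 q"
  then obtain i j where ij: "crossing T1 i j" "row_gap D1 i q \<or> col_gap D1 j q"
    unfolding crossed_gap_def by blast
  show "ribbon_gap q \<or> (q < site_pos \<and> crossed_gap T q) \<or> (Suc site_pos < q \<and> crossed_gap T (q - 1))"
  proof (cases "ribbon_gap q")
    case False
    have "(i, j) \<in> D1"
      using ij(1) by (simp add: crossing_def)
    then have W: "(i, j) \<in> W" "row_gap W i q \<or> col_gap W j q"
      using ij(2) row_gap_T1_W[OF _ False] col_gap_T1_W[OF _ False] by blast+
    then obtain i' j' where ij': "i = row i'" "j = col j'" "crossing T i' j'"
      using ij(1) crossing_W by blast
    then have "(i', j') \<in> D"
      by (simp add: crossing_def)
    from W(2) obtain q' where q': "row_gap D i' q' \<or> col_gap D j' q'" "q' \<noteq> site_pos \<longrightarrow> q = (if q' < site_pos then q' else Suc q')"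
      using row_gap_down[of i' q j'] col_gap_down[of j' q i'] \<open>(i', j') \<in> D\<close> ij'
      by (metis order_le_less)
    then have "crossed_gap T q'"
      unfolding crossed_gap_def using ij'(3) by blast
    moreover from this have "q' \<noteq> site_pos"
      using free by blast
    ultimately show ?thesis
      using q'(2) by (auto split: if_splits)
  qed simp
next
  have old: "crossed_gap T1 q" if c: "crossed_gap T q'" "\<not> ribbon_gap q" "q' \<noteq> site_pos"
    "q = (if q' < site_pos then q' else Suc q')" for q'
  proof -
    obtain i j where ij: "crossing T i j" "row_gap D i q' \<or> col_gap D j q'"
      using c(1) unfolding crossed_gap_def by blast
    have "row_gap W (row i) q \<or> col_gap W (col j) q"
      using ij(2) row_gap_up[of i q'] col_gap_up[of j q'] c(3,4) by (auto split: if_splits)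
    then have "row_gap D1 (row i) q \<or> col_gap D1 (col j) q"
      using row_gap_W_T1 col_gap_W_T1 c(2) by blast
    moreover have "crossing T1 (row i) (col j)"
      using crossing_W[of "row i" "col j"] ij(1) by (auto simp: crossing_def)
    ultimately show ?thesis
      unfolding crossed_gap_def by blast
  qed
  assume "ribbon_gap q \<or> (q < site_pos \<and> crossed_gap T q) \<or> (Suc site_pos < q \<and> crossed_gap T (q - 1))"
  then show "crossed_gap T1 q"
    using ribbon_gap_crossed[of q] old[of q] old[of "q - 1"] by (cases "ribbon_gap q") auto
qed

section \<open>Crossings of the chosen line and the patterns H and V\<close>

lemma site_gap: "if below then col_gap D c site_pos else row_gap D r site_pos"
proof (cases below)
  case True
  have "col_gap D c site_pos"
    by (rule col_gapI[OF ferrers, of "r - 1"])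
      (use site_below[OF True] site_notin[of r c] site_pos True last_row_W in auto)
  then show ?thesis
    using True by simp
next
  case False
  have "row_gap D r site_pos"
    by (rule row_gapI[OF ferrers, of _ "c - 1"])
      (use site_right[OF False] site_notin[of r c] site_pos False last_row_W in auto)
  then show ?thesis
    using False by simp
qed

lemma crossed_site:
  "crossed_gap T site_pos \<longleftrightarrow> (if below then \<exists>i. crossing T i c else \<exists>j. crossing T r j)"
proof (cases below)
  case True
  then have g: "col_gap D c site_pos"
    using site_gap by simp
  show ?thesis
    unfolding crossed_gap_def using True g row_col_gap[OF _ g] col_gap_unique[OF ferrers g] by auto
next
  case False
  then have g: "row_gap D r site_pos"
    using site_gap by simp
  show ?thesis
    unfolding crossed_gap_def using False g row_col_gap[OF g] row_gap_unique[OF ferrers g] by auto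
qed

lemma points_start:
  "(i, j) \<in> points T1 \<Longrightarrow> r \<le> i \<Longrightarrow> c \<le> j \<Longrightarrow> i = r \<and> j = c"
  using points_W[of i j] W_corner ferrersD[OF ferrers_W, of i j "Suc r" c] ferrersD[OF ferrers_W, of i j r "Suc c"]
  by (metis Suc_leI order_le_less)

text \<open>By \<open>points_start\<close>, only the bottom right point of a new pattern can be the
  inserted one. As a point lies to its left, it was inserted at the end of row \<open>r\<close>, and
  the empty cell \<open>(r2, c2)\<close> is a crossing of this row. The pattern V is
  symmetric.\<close>

lemma H_T1:
  assumes "contains_H T1"
  shows "contains_H T \<or> crossed_gap T site_pos"
proof -
  obtain r1 r2 c1 c2 c3 where h: "r1 < r2" "c1 < c2" "c2 < c3"
    "(r1, c2) \<in> points T1" "(r2, c1) \<in> points T1" "(r2, c3) \<in> points T1"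
    "(r1, c3) \<notin> points T1" "(r2, c2) \<notin> points T1"
    using assms unfolding contains_H_iff[OF tree_T1] by blast
  have n1: "(r1, c2) \<noteq> (r, c)" "(r2, c1) \<noteq> (r, c)"
    using points_start[OF h(6)] h(1-3) by auto
  show ?thesis
  proof (cases "(r2, c3) = (r, c)")
    case True
    then have "point_left T1 (r, c)"
      using h unfolding point_left_iff by (auto intro!: exI[of _ c1])
    then have nb: "\<not> below"
      using point_left_start by blast
    note p = point_right_iff[OF nb]
    have old: "(r1, c2) \<in> points T" "(r, c1) \<in> points T"
      using h n1 True unfolding p by auto
    have "crossing T r c2"
      unfolding crossing_def point_above_iff point_left_iff
      using old h True site_right[OF nb] by blast
    then show ?thesis
      using crossed_site nb by auto
  next
    case False
    obtain a1 b2 where 1: "r1 = row a1" "c2 = col b2" "(a1, b2) \<in> points T"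
      using h(4) n1(1) by (auto elim: point_cases)
    obtain a2 b1 where 2: "r2 = row a2" "c1 = col b1" "(a2, b1) \<in> points T"
      using h(5) n1(2) by (auto elim: point_cases)
    obtain a3 b3 where 3: "r2 = row a3" "c3 = col b3" "(a3, b3) \<in> points T"
      using h(6) False by (auto elim: point_cases)
    have "a3 = a2"
      using 2 3 by simp
    then have "contains_H T"
      unfolding contains_H_iff[OF tree]
      using h(1-3,7,8) 1 2 3 by (intro exI[of _ a1] exI[of _ a2] exI[of _ b1] exI[of _ b2] exI[of _ b3]) auto
    then show ?thesis ..
  qed
qed

lemma V_T1:
  assumes "contains_V T1"
  shows "contains_V T \<or> crossed_gap T site_pos"
proof -
  obtain r1 r2 r3 c1 c2 where h: "r1 < r2" "r2 < r3" "c1 < c2"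
    "(r1, c2) \<in> points T1" "(r2, c1) \<in> points T1" "(r3, c2) \<in> points T1"
    "(r2, c2) \<notin> points T1" "(r3, c1) \<notin> points T1"
    using assms unfolding contains_V_iff[OF tree_T1] by blast
  have n1: "(r1, c2) \<noteq> (r, c)" "(r2, c1) \<noteq> (r, c)"
    using points_start[OF h(6)] h(1-3) by auto
  show ?thesis
  proof (cases "(r3, c2) = (r, c)")
    case True
    then have "point_above T1 (r, c)"
      using h unfolding point_above_iff by (auto intro!: exI[of _ r1])
    then have nb: below
      using point_above_start by blast
    note p = point_below_iff[OF nb]
    have old: "(r1, c) \<in> points T" "(r2, c1) \<in> points T"
      using h n1 True unfolding p by auto
    have "crossing T r2 c"
      unfolding crossing_def point_above_iff point_left_iff
      using old h True site_below[OF nb] by blast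
    then show ?thesis
      using crossed_site nb by auto
  next
    case False
    obtain a1 b2 where 1: "r1 = row a1" "c2 = col b2" "(a1, b2) \<in> points T"
      using h(4) n1(1) by (auto elim: point_cases)
    obtain a2 b1 where 2: "r2 = row a2" "c1 = col b1" "(a2, b1) \<in> points T"
      using h(5) n1(2) by (auto elim: point_cases)
    obtain a3 b3 where 3: "r3 = row a3" "c2 = col b3" "(a3, b3) \<in> points T"
      using h(6) False by (auto elim: point_cases)
    have "b3 = b2"
      using 1 3 by simp
    then have "contains_V T"
      unfolding contains_V_iff[OF tree]
      using h(1-3,7,8) 1 2 3 by (intro exI[of _ a1] exI[of _ a2] exI[of _ a3] exI[of _ b1] exI[of _ b2]) auto
    then show ?thesis ..
  qed
qed

text \<open>\<open>row\<close> and \<open>col\<close> preserve the order of the lines and, by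
  \<open>point_open\<close>, both points and empty cells.\<close>

lemma H_mono: "contains_H T \<Longrightarrow> contains_H T1"
  unfolding contains_H_iff[OF tree] contains_H_iff[OF tree_T1]
  by (elim exE, rule_tac x="row r1" in exI, rule_tac x="row r2" in exI, rule_tac x="col c1" in exI,
      rule_tac x="col c2" in exI, rule_tac x="col c3" in exI) simp

lemma V_mono: "contains_V T \<Longrightarrow> contains_V T1"
  unfolding contains_V_iff[OF tree] contains_V_iff[OF tree_T1]
  by (elim exE, rule_tac x="row r1" in exI, rule_tac x="row r2" in exI, rule_tac x="row r3" in exI,
      rule_tac x="col c1" in exI, rule_tac x="col c2" in exI) simp

text \<open>A crossing of the chosen line, the two points that witness it and the new point beyond
  it form V for a column and H for a row. The second empty cell of the pattern lies in the new line,
  whose only point is the new one.\<close>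

lemma crossed_contains:
  assumes "crossed_gap T site_pos"
  shows "contains_H T1 \<or> contains_V T1"
proof (cases below)
  case True
  note p = point_below_iff[OF True]
  obtain i where x: "crossing T i c"
    using assms crossed_site True by auto
  then have "i < r"
    using site_notin[of i c] by (meson crossing_def linorder_not_le order_refl)
  obtain i1 j1 where "i1 < i" "(i1, c) \<in> points T" "j1 < c" "(i, j1) \<in> points T"
    using x by (auto simp: crossing_def point_above_iff point_left_iff)
  moreover have "(i, c) \<notin> points T"
    using crossing_not_point[OF tree x] .
  ultimately have "i1 < i \<and> i < r \<and> j1 < c \<and> (i1, c) \<in> points T1 \<and> (i, j1) \<in> points T1 \<and>
      (r, c) \<in> points T1 \<and> (i, c) \<notin> points T1 \<and> (r, j1) \<notin> points T1"
    unfolding p using \<open>i < r\<close> by auto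
  then show ?thesis
    unfolding contains_V_iff[OF tree_T1] by blast
next
  case False
  note p = point_right_iff[OF False]
  obtain j where x: "crossing T r j"
    using assms crossed_site False by auto
  then have "j < c"
    using site_notin[of r j] by (meson crossing_def linorder_not_le order_refl)
  obtain i1 j1 where "i1 < r" "(i1, j) \<in> points T" "j1 < j" "(r, j1) \<in> points T"
    using x by (auto simp: crossing_def point_above_iff point_left_iff)
  moreover have "(r, j) \<notin> points T"
    using crossing_not_point[OF tree x] .
  ultimately have "i1 < r \<and> j1 < j \<and> j < c \<and> (i1, j) \<in> points T1 \<and> (r, j1) \<in> points T1 \<and>
      (r, c) \<in> points T1 \<and> (i1, c) \<notin> points T1 \<and> (r, j) \<notin> points T1"
    unfolding p using \<open>j < c\<close> by auto
  then show ?thesis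
    unfolding contains_H_iff[OF tree_T1] by blast
qed

lemma baxter_T1: "baxter_tlt T1 \<longleftrightarrow> baxter_tlt T \<and> \<not> crossed_gap T site_pos"
  unfolding baxter_tlt_def using H_T1 V_T1 H_mono V_mono crossed_contains by blast

end

subsection \<open>Removing the special point\<close>

lemma insertion_site_ex:
  assumes T: "tree_like T" and k: "k \<le> length (phi T)"
  obtains below r c where "insertion T below r c" "insertion.site_pos T below r c = k"
proof -
  have F: "ferrers (cells T)"
    using T by (rule tree_like_ferrers)
  have "k \<le> Suc (last_col (cells T) + last_row (cells T))"
    using k length_phi[OF F] by simp
  from gap_ex[OF F this] show thesis
  proof (elim disjE exE)
    fix i assume "row_gap (cells T) i k"
    then obtain m where m: "(i, m) \<in> cells T" "(i, Suc m) \<notin> cells T" "k + i = Suc (last_row (cells T) + m)"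
      using row_gap_end[OF F] by metis
    interpret insertion T False i "Suc m"
      by unfold_locales (use T m in \<open>auto simp: insertion_site_def\<close>)
    have "site_pos = k"
      using site_pos m(3) by (simp add: last_row_W)
    then show thesis
      using that[of False i "Suc m"] insertion_axioms by blast
  next
    fix j assume "col_gap (cells T) j k"
    then obtain m where m: "(m, j) \<in> cells T" "(Suc m, j) \<notin> cells T" "k + m = j + last_row (cells T)"
      using col_gap_end[OF F] by metis
    interpret insertion T True "Suc m" j
      by unfold_locales (use T m in \<open>auto simp: insertion_site_def\<close>)
    have "site_pos = k"
      using site_pos m(3) by (simp add: last_row_W)
    then show thesis
      using that[of True "Suc m" j] insertion_axioms by blast
  qed
qed

text \<open>A border step is a row end or a column bottom but not both, which fixes
  \<open>below\<close> and one coordinate; the position then gives the other.\<close>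

lemma insertion_site_unique:
  assumes "insertion T below r c" "insertion T below' r' c'"
    and pos: "insertion.site_pos T below r c = insertion.site_pos T below' r' c'"
  shows "below = below' \<and> r = r' \<and> c = c'"
proof -
  interpret a: insertion T below r c by fact
  interpret b: insertion T below' r' c' by fact
  note F = a.ferrers
  show ?thesis
  proof (cases below)
    case True
    then have ga: "col_gap (cells T) c a.site_pos"
      using a.site_gap by simp
    then have "below'"
      using b.site_gap row_col_gap pos by (metis (full_types))
    then have gb: "col_gap (cells T) c' a.site_pos"
      using b.site_gap pos by simp
    have "c = c'"
      using col_gap_unique[OF F ga gb] .
    have w: "last_row a.W = Suc (last_row (cells T))" "last_row b.W = Suc (last_row (cells T))"
      using a.last_row_W b.last_row_W True \<open>below'\<close> by auto
    have "r = r'"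
      using a.site_pos[unfolded w] b.site_pos[unfolded w] pos \<open>c = c'\<close> by linarith
    then show ?thesis
      using True \<open>below'\<close> \<open>c = c'\<close> by blast
  next
    case False
    then have ga: "row_gap (cells T) r a.site_pos"
      using a.site_gap by simp
    then have "\<not> below'"
      using b.site_gap row_col_gap pos by (metis (full_types))
    then have gb: "row_gap (cells T) r' a.site_pos"
      using b.site_gap pos by simp
    have "r = r'"
      using row_gap_unique[OF F ga gb] .
    have w: "last_row a.W = last_row (cells T)" "last_row b.W = last_row (cells T)"
      using a.last_row_W b.last_row_W False \<open>\<not> below'\<close> by auto
    have "c = c'"
      using a.site_pos[unfolded w] b.site_pos[unfolded w] pos \<open>r = r'\<close> by linarith
    then show ?thesis
      using False \<open>\<not> below'\<close> \<open>r = r'\<close> by blast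
  qed
qed

section \<open>The tableau left by a removal\<close>

locale removal =
  fixes S :: tableau and r c :: nat
  assumes tree: "tree_like S" and size: "2 \<le> tsize S" and special: "special S = (r, c)"
begin

definition below :: bool where
  "below \<longleftrightarrow> point_above S (r, c)"

abbreviation "E \<equiv> cells S"
abbreviation "W \<equiv> E - ribbon S"
abbreviation "row \<equiv> up_row below r"
abbreviation "col \<equiv> up_col below c"
abbreviation "T \<equiv> remove_special S"

lemma ferrers: "ferrers E"
  using tree by (rule tree_like_ferrers)

lemmas special_S = special_in[OF tree special]

text \<open>If the root were special, the first column and hence every column would have height one.
  All points would be column bottoms, and none could lie right of the root.\<close>

lemma not_root: "(r, c) \<noteq> (0, 0)"
proof
  assume rc: "(r, c) = (0, 0)"
  have "points S \<subseteq> {(0, 0)}"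
  proof clarify
    fix i j assume p: "(i, j) \<in> points S"
    have "(1, 0) \<notin> E"
      using special_S(2) rc by simp
    then have "i = 0"
      using ferrersD[OF ferrers tree_like_points[OF tree p], of 1 0] by (cases i) auto
    moreover have "(1, j) \<notin> E"
      using \<open>(1, 0) \<notin> E\<close> ferrersD[OF ferrers, of 1 j 1 0] by auto
    ultimately have "j \<le> 0"
      using special_S(3)[OF p] rc by simp
    then show "i = 0 \<and> j = 0"
      using \<open>i = 0\<close> by simp
  qed
  then have "tsize S \<le> 1"
    unfolding tsize_def using card_mono[of "{(0::nat, 0::nat)}" "points S"] by simp
  then show False
    using size by simp
qed

lemma left_iff: "point_left S (r, c) \<longleftrightarrow> \<not> below"
  using tree_like_parent[OF tree special_S(1) not_root] by (simp add: below_def)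

lemma row_pos: "below \<Longrightarrow> 0 < r"
  and col_pos: "\<not> below \<Longrightarrow> 0 < c"
  using left_iff by (auto simp: below_def point_above_iff point_left_iff)

lemma ribbon_cases:
  obtains "ribbon S = {}" "(r, Suc c) \<notin> E"
  | a b where "ribbon_removal E r c a b" "ribbon S = inner_ribbon E r c a b" "(a, b) \<in> points S" "c < b"
proof (cases "(r, Suc c) \<in> E")
  case False
  then show thesis
    using that(1) ribbon_empty[OF special] by blast
next
  case True
  obtain a b where ab: "(a, b) \<in> rim E" "(a, b) \<in> points S" "c + a < b + r" "c < b" "(Suc a, b) \<in> E"
    "\<And>i j. (i, j) \<in> inner_ribbon E r c a b \<Longrightarrow> (i, j) \<notin> points S"
    using ribbon_stop_ex[OF tree special True] by blast
  have "ribbon_removal E r c a b"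
    using True ab ferrers special_S(2) ferrersD[OF ferrers, of "Suc r" "Suc c" "Suc r" c]
    by unfold_locales (auto simp: mem_rim)
  moreover have "ribbon S = inner_ribbon E r c a b"
    by (rule ribbon_eq_inner[OF ferrers special True special_S(2) ab(1-3)]) (rule ab(6))
  ultimately show thesis
    using that(2) ab by blast
qed

lemma W_facts: "ferrers W" "(r, c) \<in> W" "(r, Suc c) \<notin> W" "points S \<subseteq> W"
proof -
  have rc: "(r, c) \<in> E"
    using tree_like_points[OF tree special_S(1)] .
  have "ferrers W \<and> (r, c) \<in> W \<and> (r, Suc c) \<notin> W"
  proof (cases rule: ribbon_cases)
    case 1
    then show ?thesis using ferrers rc by simp
  next
    case (2 a b)
    interpret ribbon_removal E r c a b by fact
    show ?thesis
      using ferrers_D add.start unfolding 2 by blast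
  qed
  then show "ferrers W" "(r, c) \<in> W" "(r, Suc c) \<notin> W"
    by auto
  have "\<And>i j. (i, j) \<in> points S \<Longrightarrow> (i, j) \<notin> ribbon S"
  proof (cases rule: ribbon_cases)
    case 1
    then show "(i, j) \<notin> ribbon S" for i j by simp
  next
    case 2
    have "(r, Suc c) \<in> E"
      using 2 by (simp add: ribbon_removal_def)
    have "(i, j) \<notin> points S" if "(i, j) \<in> ribbon S" for i j
      using that \<open>(r, Suc c) \<in> E\<close> special by (auto simp: ribbon_def weakly_NE_def)
    then show "(i, j) \<in> points S \<Longrightarrow> (i, j) \<notin> ribbon S" for i j by blast
  qed
  then show "points S \<subseteq> W"
    using tree_like_points[OF tree] by auto
qed

lemma W_below: "(Suc r, c) \<notin> W"
  using special_S(2) by simp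

lemma W_start: "(i, j) \<in> W \<Longrightarrow> r \<le> i \<Longrightarrow> c \<le> j \<Longrightarrow> i = r \<and> j = c"
  using W_below W_facts(3) ferrersD[OF W_facts(1), of i j "Suc r" c] ferrersD[OF W_facts(1), of i j r "Suc c"]
  by (metis Suc_leI order_le_less)

lemma points_in_W: "(i, j) \<in> points S \<Longrightarrow> (i, j) \<in> W"
  using W_facts(4) by blast

text \<open>The parent of the special point lies off the deleted line, and the parent condition
  leaves no point between the special point and the start of that line. On the other side,
  \<open>W\<close> has no cells. So no other point is lost.\<close>

lemma new_line_points:
  assumes "(i, j) \<in> points S" "if below then i = r else j = c"
  shows "i = r \<and> j = c"
proof (cases below)
  case True
  then have "\<not> point_left S (r, c)"
    using left_iff by blast
  then have "\<not> j < c"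
    using assms True by (auto simp: point_left_iff)
  then show ?thesis
    using W_start[OF points_in_W[OF assms(1)]] assms(2) True by simp
next
  case False
  then have "\<not> point_above S (r, c)"
    by (simp add: below_def)
  then have "\<not> i < r"
    using assms False by (auto simp: point_above_iff)
  then show ?thesis
    using W_start[OF points_in_W[OF assms(1)]] assms(2) False by simp
qed

lemma line_cases:
  obtains "if below then i = r else j = c" | i' j' where "i = row i'" "j = col j'"
proof (cases "if below then i = r else j = c")
  case False
  have "i = row (down_row below r i)" "j = col (down_col below c j)"
    using False by (auto simp: up_row_def up_col_def down_row_def down_col_def split: if_splits)
  then show thesis
    using that(2) by blast
qed (use that(1) in blast)

lemma line_open: "\<not> (if below then row i = r else col j = c)"
  by (auto simp: up_row_def up_col_def)

lemma deleted_line: "deleted_line S = {(i, j). if below then i = r else j = c}"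
  by (auto simp: deleted_line_def special below_def)

lemma close_open: "close_gap S (row i, col j) = (i, j)"
  by (auto simp: close_gap_def special below_def up_row_def up_col_def)

lemma close_image:
  assumes "A \<inter> deleted_line S = {}"
  shows "(i, j) \<in> close_gap S ` A \<longleftrightarrow> (row i, col j) \<in> A"
proof
  assume "(row i, col j) \<in> A"
  then show "(i, j) \<in> close_gap S ` A"
    using close_open by (metis image_eqI)
next
  assume "(i, j) \<in> close_gap S ` A"
  then obtain k l where kl: "(k, l) \<in> A" "close_gap S (k, l) = (i, j)"
    by auto
  show "(row i, col j) \<in> A"
  proof (cases rule: line_cases[of k l])
    case 1
    then show ?thesis using kl assms by (auto simp: deleted_line)
  next
    case (2 i' j')
    then show ?thesis using kl close_open by simp
  qed
qed

lemma mem_T: "(i, j) \<in> cells T \<longleftrightarrow> (row i, col j) \<in> W"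
proof -
  have "E - deleted_line S - ribbon S = W - deleted_line S"
    by blast
  then have "cells T = close_gap S ` (W - deleted_line S)"
    by (simp add: remove_special_def)
  moreover have "(row i, col j) \<notin> deleted_line S"
    using line_open[of i j] by (simp add: deleted_line)
  ultimately show ?thesis
    using close_image[of "W - deleted_line S" i j] by blast
qed

lemma point_T: "(i, j) \<in> points T \<longleftrightarrow> (row i, col j) \<in> points S"
proof -
  have "(points S - {(r, c)}) \<inter> deleted_line S = {}"
    using new_line_points by (auto simp: deleted_line)
  moreover have "points T = close_gap S ` (points S - {(r, c)})"
    by (simp add: remove_special_def special)
  ultimately show ?thesis
    using close_image[of "points S - {(r, c)}" i j] open_gap_notin_line(2)[of below r i c j] by simp
qed

lemma points_S: "points S = insert (r, c) (open_gap below r c ` points T)"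
proof -
  have "(i, j) \<in> points S \<longleftrightarrow> (i, j) \<in> insert (r, c) (open_gap below r c ` points T)" for i j
  proof (cases rule: line_cases[of i j])
    case 1
    then show ?thesis
      using new_line_points[of i j] special_S(1) line_open by (auto simp: open_gap_image_iff)
  next
    case (2 i' j')
    then show ?thesis
      using open_gap_notin_line(2)[of below r i' c j'] by (auto simp: point_T)
  qed
  then show ?thesis by auto
qed

lemma row_0: "row 0 = 0" and col_0: "col 0 = 0"
  using row_pos col_pos by (auto simp: up_row_def up_col_def)

lemma ferrers_T: "ferrers (cells T)"
  unfolding ferrers_def
proof (intro conjI allI impI)
  have "cells T = close_gap S ` (E - deleted_line S - ribbon S)"
    by (simp add: remove_special_def)
  then show "finite (cells T)"
    using ferrers_finite[OF ferrers] by simp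
  show "(0, 0) \<in> cells T"
    using ferrers_corner[OF W_facts(1)] by (simp add: mem_T row_0 col_0)
  fix i j i' j'
  assume "(i, j) \<in> cells T" "i' \<le> i" "j' \<le> j"
  moreover from this have "row i' \<le> row i" "col j' \<le> col j"
    by (auto simp: up_row_def up_col_def)
  ultimately show "(i', j') \<in> cells T"
    unfolding mem_T using ferrersD[OF W_facts(1)] by blast
qed

lemma above_T:
  assumes "(i, j) \<in> cells T"
  shows "point_above T (i, j) \<longleftrightarrow> point_above S (row i, col j)"
proof
  assume "point_above S (row i, col j)"
  then obtain k where k: "k < row i" "(k, col j) \<in> points S"
    by (auto simp: point_above_iff)
  show "point_above T (i, j)"
  proof (cases rule: line_cases[of k "col j"])
    case 1
    then have "k = r" "col j = c"
      using new_line_points[OF k(2)] by auto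
    then show ?thesis
      using W_start[of "row i" "col j"] assms k by (simp add: mem_T)
  next
    case (2 k' j')
    then show ?thesis
      using k by (auto simp: point_above_iff point_T)
  qed
next
  assume "point_above T (i, j)"
  then obtain k where "k < i" "(row k, col j) \<in> points S"
    by (auto simp: point_above_iff point_T)
  then show "point_above S (row i, col j)"
    unfolding point_above_iff using up_row_less_iff by blast
qed

lemma left_T:
  assumes "(i, j) \<in> cells T"
  shows "point_left T (i, j) \<longleftrightarrow> point_left S (row i, col j)"
proof
  assume "point_left S (row i, col j)"
  then obtain k where k: "k < col j" "(row i, k) \<in> points S"
    by (auto simp: point_left_iff)
  show "point_left T (i, j)"
  proof (cases rule: line_cases[of "row i" k])
    case 1
    then have "row i = r" "k = c"
      using new_line_points[OF k(2)] by auto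
    then show ?thesis
      using W_start[of "row i" "col j"] assms k by (simp add: mem_T)
  next
    case (2 i' k')
    then show ?thesis
      using k by (auto simp: point_left_iff point_T)
  qed
next
  assume "point_left T (i, j)"
  then obtain k where "k < j" "(row i, col k) \<in> points S"
    by (auto simp: point_left_iff point_T)
  then show "point_left S (row i, col j)"
    unfolding point_left_iff using up_col_less_iff by blast
qed

lemma tree_T: "tree_like T"
  unfolding tree_like_iff
proof (intro conjI allI impI ferrers_T)
  show "points T \<subseteq> cells T"
    using points_in_W by (auto simp: point_T mem_T)
  show "(0, 0) \<in> points T"
    using tree_like_root[OF tree] by (simp add: point_T row_0 col_0)
  fix i j
  show "point_above T (i, j) \<noteq> point_left T (i, j)"
    if h: "(i, j) \<in> points T" "(i, j) \<noteq> (0, 0)"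
  proof -
    have "(i, j) \<in> cells T"
      using h points_in_W by (simp add: point_T mem_T)
    moreover have "(row i, col j) \<noteq> (0, 0)"
      using h(2) row_0 col_0 by (metis prod.inject up_row_eq_iff up_col_eq_iff)
    ultimately show ?thesis
      using tree_like_parent[OF tree, of "row i" "col j"] h(1) above_T left_T by (simp add: point_T)
  qed
  assume h: "(i, j) \<in> cells T"
  then have W: "(row i, col j) \<in> W" and E: "(row i, col j) \<in> E"
    by (auto simp: mem_T)
  show "\<exists>j'. (i, j') \<in> points T"
  proof -
    obtain k where k: "(row i, k) \<in> points S"
      using tree_like_row[OF tree E] by blast
    \<comment> \<open>If the point found is the deleted one, the deleted line is a column, and the
      special point has another point to its left in this row.\<close>
    have "\<exists>k. (row i, k) \<in> points S \<and> \<not> (if below then row i = r else k = c)"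
    proof (cases "if below then row i = r else k = c")
      case True
      then have "\<not> below"
        using line_open[of i 0] by (auto split: if_splits)
      moreover have "row i = r"
        using new_line_points[OF k True] by simp
      ultimately obtain l where "l < c" "(row i, l) \<in> points S"
        using left_iff by (auto simp: point_left_iff)
      then show ?thesis
        using \<open>\<not> below\<close> by auto
    qed (use k in blast)
    then obtain k where k: "(row i, k) \<in> points S" "\<not> (if below then row i = r else k = c)"
      by blast
    show ?thesis
    proof (cases rule: line_cases[of "row i" k])
      case (2 i' k')
      then have "(i, k') \<in> points T"
        using k(1) by (simp add: point_T)
      then show ?thesis by blast
    qed (use k(2) in blast)
  qed
  show "\<exists>i'. (i', j) \<in> points T"
  proof -
    obtain k where k: "(k, col j) \<in> points S"
      using tree_like_col[OF tree E] by blast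
    have "\<exists>k. (k, col j) \<in> points S \<and> \<not> (if below then k = r else col j = c)"
    proof (cases "if below then k = r else col j = c")
      case True
      then have b: below
        using line_open[of 0 j] by (auto split: if_splits)
      moreover have "col j = c"
        using new_line_points[OF k True] by simp
      ultimately obtain l where "l < r" "(l, col j) \<in> points S"
        by (auto simp: point_above_iff below_def)
      then show ?thesis
        using b by auto
    qed (use k in blast)
    then obtain k where k: "(k, col j) \<in> points S" "\<not> (if below then k = r else col j = c)"
      by blast
    show ?thesis
    proof (cases rule: line_cases[of k "col j"])
      case (2 k' j')
      then have "(k', j) \<in> points T"
        using k(1) by (simp add: point_T)
      then show ?thesis by blast
    qed (use k(2) in blast)
  qed
qed

lemma insertion_T: "insertion T below r c"
proof
  show "tree_like T" by (rule tree_T)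
  have "(row r, col c) \<notin> W"
    using W_below W_facts(3) by (auto simp: up_row_def up_col_def)
  moreover have "0 < r \<and> (row (r - 1), col c) \<in> W" if below
    using that row_pos[OF that] ferrersD[OF W_facts(1,2), of "r - 1" c] by (auto simp: up_row_def up_col_def)
  moreover have "0 < c \<and> (row r, col (c - 1)) \<in> W" if "\<not> below"
    using that col_pos[OF that] ferrersD[OF W_facts(1,2), of r "c - 1"] by (auto simp: up_row_def up_col_def)
  ultimately show "insertion_site (cells T) below r c"
    unfolding insertion_site_def mem_T by simp
qed

lemma widen_T: "widen below r c (cells T) = W"
proof -
  have "(i, j) \<in> widen below r c (cells T) \<longleftrightarrow> (i, j) \<in> W" for i j
  proof (cases rule: line_cases[of i j])
    case 1
    then have "(i, j) \<notin> open_gap below r c ` cells T"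
      using line_open by (auto simp: open_gap_image_iff)
    moreover have "(i, j) \<in> new_line below r c \<longleftrightarrow> (i, j) \<in> W"
    proof (cases below)
      case True
      then have "i = r"
        using 1 by simp
      moreover have "(r, j) \<in> W \<longleftrightarrow> j \<le> c"
        using ferrersD[OF W_facts(1,2), of r j] W_start[of r j] by (metis le_cases order_refl)
      moreover have "(i, j) \<in> new_line below r c \<longleftrightarrow> i = r \<and> j \<le> c"
        using True by (simp add: new_line_def)
      ultimately show ?thesis
        by metis
    next
      case False
      then have "j = c"
        using 1 by simp
      moreover have "(i, c) \<in> W \<longleftrightarrow> i \<le> r"
        using ferrersD[OF W_facts(1,2), of i c] W_start[of i c] by (metis le_cases order_refl)
      moreover have "(i, j) \<in> new_line below r c \<longleftrightarrow> j = c \<and> i \<le> r"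
        using False by (simp add: new_line_def)
      ultimately show ?thesis
        by metis
    qed
    ultimately show ?thesis
      by (simp add: widen_def)
  next
    case (2 i' j')
    then show ?thesis
      by (simp only: mem_widen_open mem_T)
  qed
  then show ?thesis by auto
qed

text \<open>Without the ribbon, \<open>(a, b)\<close> is the bottom of its column. Below a pointed
  column bottom of \<open>T\<close> further right, \<open>S\<close> must have a ribbon cell; being
  right of column \<open>b\<close> and of smaller content than \<open>(a, b)\<close>, it would lie
  strictly south-east of this rim cell.\<close>

lemma special_T_ribbon:
  assumes rem: "ribbon_removal E r c a b" and rib: "ribbon S = inner_ribbon E r c a b"
    and ab: "(a, b) \<in> points S" "c < b"
  shows "open_gap below r c (special T) = (a, b)"
proof -
  interpret ribbon_removal E r c a b by fact
  have stopW: "(Suc a, b) \<notin> W"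
    using add.stop(2) by (simp add: rib)
  obtain x y where xy: "a = row x" "b = col y"
  proof (cases rule: line_cases[of a b])
    case 1
    then show thesis using new_line_points[OF ab(1) 1] ab(2) by simp
  qed (use that in blast)
  have "special T = (x, y)"
  proof (rule special_eqI[OF tree_T])
    show "(x, y) \<in> points T"
      using ab xy by (simp add: point_T)
    have "Suc a \<le> row (Suc x)"
      using xy by (auto simp: up_row_def)
    then show "(Suc x, y) \<notin> cells T"
      using stopW ferrersD[OF W_facts(1), of "row (Suc x)" b "Suc a" b] xy by (auto simp: mem_T)
    fix i j
    assume h: "(i, j) \<in> points T" "(Suc i, j) \<notin> cells T"
    show "j \<le> y"
    proof (rule ccontr)
      assume "\<not> j \<le> y"
      then have "b < col j"
        using xy by simp
      have p: "(row i, col j) \<in> points S" "(row (Suc i), col j) \<notin> W"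
        using h by (auto simp: point_T mem_T)
      have "(Suc (row i), col j) \<notin> W"
      proof (cases "row (Suc i) = Suc (row i)")
        case False
        then have "Suc (row i) = r"
          by (auto simp: up_row_def split: if_splits)
        then show ?thesis
          using W_facts(3) \<open>b < col j\<close> ab(2) ferrersD[OF W_facts(1), of r "col j" r "Suc c"] by auto
      qed (use p in simp)
      moreover have "(Suc (row i), col j) \<in> E"
        using special_S(3)[OF p(1)] \<open>b < col j\<close> ab(2) by linarith
      ultimately have "(Suc (row i), col j) \<in> inner_ribbon E r c a b"
        using rib by blast
      then have "col j + a < b + Suc (row i)" "(Suc (row i), col j) \<in> E"
        by (auto simp: mem_inner_ribbon mem_rim)
      then show False
        using stop(2) \<open>b < col j\<close> ferrersD[OF ferrers, of "Suc (row i)" "col j" "Suc a" "Suc b"] by auto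
    qed
  qed
  then show ?thesis
    using xy by simp
qed

text \<open>Ensures that inserting again adds no ribbon. The special point of \<open>T\<close> is
  not right of column \<open>c\<close>; if it were more than one row above \<open>r\<close>, the
  cell below it would be weakly north-west of \<open>(r, c)\<close> and so in the diagram.\<close>

lemma special_T_no_ribbon:
  assumes "(r, Suc c) \<notin> E" "ribbon S = {}" and uv: "open_gap below r c (special T) = (u, v)"
  shows "\<not> Suc (c + u) < v + r"
proof
  assume less: "Suc (c + u) < v + r"
  obtain x y where s: "special T = (x, y)"
    by force
  then have uv: "u = row x" "v = col y"
    using uv by auto
  have p: "(u, v) \<in> points S" "(row (Suc x), v) \<notin> E"
    using special_in(1,2)[OF tree_T s] assms(2) by (auto simp: point_T mem_T uv)
  have "v \<le> c"
  proof (cases "(Suc u, v) \<in> E")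
    case True
    then have "row (Suc x) \<noteq> Suc u"
      using p by auto
    then have "Suc u = r"
      by (auto simp: uv up_row_def split: if_splits)
    then show ?thesis
      using True assms(1) ferrersD[OF ferrers, of r v r "Suc c"] by (meson not_less_eq_eq order_refl)
  qed (use special_S(3) p in blast)
  then have "Suc u < r"
    using less by linarith
  then have "(Suc u, v) \<in> E"
    using \<open>v \<le> c\<close> ferrersD[OF ferrers tree_like_points[OF tree special_S(1)], of "Suc u" v] by simp
  moreover have "row (Suc x) = Suc u"
    using \<open>Suc u < r\<close> by (auto simp: uv up_row_def split: if_splits)
  ultimately show False
    using p by simp
qed

lemma add_special_T: "add_special below r c T = S"
proof -
  obtain u v where uv: "open_gap below r c (special T) = (u, v)"
    by force
  have "W \<union> outer_ribbon W r c u v = E"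
  proof (cases rule: ribbon_cases)
    case 1
    then have "\<not> Suc (c + u) < v + r"
      using special_T_no_ribbon uv by blast
    then have "inner_ribbon W r c u v = {}"
      by (auto simp: inner_ribbon_def)
    then show ?thesis
      using 1 by (simp add: outer_ribbon_def)
  next
    case (2 a b)
    interpret ribbon_removal E r c a b by fact
    have "u = a \<and> v = b"
      using special_T_ribbon[OF 2] uv by simp
    then show ?thesis
      using D_add_ribbon by (simp add: 2(2))
  qed
  then show ?thesis
    unfolding add_special_def uv widen_T points_S[symmetric] by (cases S) simp
qed

end

section \<open>Induction on the size\<close>

lemma tree_like_insertion_ex:
  assumes "tree_like S" "tsize S = Suc n" "1 \<le> n"
  obtains T below r c where "insertion T below r c" "S = add_special below r c T" "tsize T = n"
proof -
  obtain r c where "special S = (r, c)"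
    by force
  then interpret removal S r c
    using assms by unfold_locales auto
  interpret i: insertion T below r c
    by (rule insertion_T)
  show thesis
    using that[OF insertion_T] add_special_T i.tsize_T1 assms(2) by simp
qed

lemma tree_like_size_1:
  assumes T: "tree_like T" and size: "tsize T = 1"
  shows "T = Tableau {(0, 0)} {(0, 0)}"
proof -
  obtain x where "points T = {x}"
    using size by (auto simp: tsize_def card_1_singleton_iff)
  then have p: "points T = {(0, 0)}"
    using tree_like_root[OF T] by auto
  then have "i = 0 \<and> j = 0" if "(i, j) \<in> cells T" for i j
    using tree_like_row[OF T that] tree_like_col[OF T that] by auto
  moreover have "(0, 0) \<in> cells T"
    using ferrers_corner[OF tree_like_ferrers[OF T]] .
  ultimately have "cells T = {(0, 0)}"
    by auto
  then show ?thesis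
    using p by (cases T) auto
qed

lemma tree_like_singleton: "tree_like (Tableau {(0, 0)} {(0, 0)})"
  by (auto simp: tree_like_iff ferrers_def)

lemma phi_singleton: "phi (Tableau {(0, 0)} {(0, 0)}) = [1]"
proof -
  let ?T = "Tableau {(0, 0)} {(0, 0)}"
  note tree = tree_like_singleton
  have F: "ferrers {(0, 0)}"
    by (simp add: ferrers_def)
  have last_row: "last_row {(0, 0)} = 0" and last_col: "last_col {(0, 0)} = 0"
    using last_row_eqI[OF F, of 0] last_col_eqI[OF F, of 0] by auto
  have size: "tsize ?T = 1"
    by (simp add: tsize_def)
  have s: "special ?T = (0, 0)"
    by (rule special_eqI[OF tree]) auto
  have "ins_label ?T (0, 0) = 1"
    unfolding ins_label_def size One_nat_def ins_label_aux.simps s by simp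
  then have "phi ?T ! 0 = 1"
    using phi_nth[of ?T 0 0 0] F last_row by (simp add: mem_rim)
  moreover have "length (phi ?T) = 1"
    using length_phi[of ?T] F last_row last_col by simp
  ultimately show ?thesis
    by (cases "phi ?T") auto
qed

text \<open>The third conjunct drives the induction: it identifies the conditions of
  \<open>baxter_T1\<close> and \<open>baxter_list_insert_at\<close>. It is inherited because
  \<open>special_pos\<close> is the position of the maximum of the smaller word, which makes the two
  gap recursions coincide literally.\<close>

lemma phi_tree_like:
  assumes "1 \<le> n" "tree_like T" "tsize T = n"
  shows "perm_list n (phi T) \<and> (baxter_tlt T \<longleftrightarrow> baxter_list (phi T)) \<and>
    (baxter_tlt T \<longrightarrow> (\<forall>q. crossed_gap T q \<longleftrightarrow> bad_gap (phi T) q))"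
  using assms
proof (induction n arbitrary: T rule: nat_induct_at_least)
  case base
  have "T = Tableau {(0, 0)} {(0, 0)}"
    using tree_like_size_1 base by blast
  moreover have "perm_list 1 [1]" "baxter_list [1]" "\<not> bad_gap [1] q" for q
    by (auto simp: perm_list_def baxter_list_def bad_gap_def)
  moreover have "baxter_tlt (Tableau {(0, 0)} {(0, 0)})"
    by (auto simp: baxter_tlt_def contains_H_iff contains_V_iff tree_like_singleton)
  moreover have "\<not> crossed_gap (Tableau {(0, 0)} {(0, 0)}) q" for q
    by (auto simp: crossed_gap_def crossing_def point_above_iff)
  ultimately show ?case
    using phi_singleton by simp
next
  case (Suc n)
  obtain T' below r c where ins: "insertion T' below r c" and T: "T = add_special below r c T'"
    and size: "tsize T' = n"
    using tree_like_insertion_ex[OF Suc.prems] Suc.hyps by blast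
  interpret insertion T' below r c by (rule ins)
  note IH = Suc.IH[OF tree size]
  have perm: "perm_list n (phi T')"
    using IH by blast
  have len: "length (phi T') = n"
    using length_perm_list[OF perm] .
  have phi: "phi T = insert_at site_pos (Suc n) (phi T')"
    using phi_T1 size T by simp
  have pos: "site_pos \<le> n"
    using site_pos_le len by simp
  have m: "special_pos T' < n" "phi T' ! special_pos T' = n"
    using special_pos(2,3)[OF tree] len size by auto
  have bax: "baxter_tlt T \<longleftrightarrow> baxter_tlt T' \<and> \<not> crossed_gap T' site_pos"
    using baxter_T1 T by simp
  have "baxter_tlt T \<longleftrightarrow> baxter_list (phi T)"
    unfolding bax phi baxter_list_insert_at[OF perm pos] using IH by blast
  moreover have "crossed_gap T q \<longleftrightarrow> bad_gap (phi T) q" if "baxter_tlt T" for q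
  proof -
    have *: "baxter_tlt T'" "\<not> crossed_gap T' site_pos" "\<And>q. crossed_gap T' q \<longleftrightarrow> bad_gap (phi T') q"
      using that bax IH by blast+
    then have "\<not> bad_gap (phi T') site_pos"
      by blast
    from bad_gap_insert_at[OF perm pos this m, of q] crossed_gap_T1[OF *(2), of q]
    show ?thesis
      unfolding phi unfolding T ribbon_gap_def *(3) by blast
  qed
  ultimately show ?case
    using perm_list_insert_at[OF perm] phi by simp
qed

text \<open>The position of the maximum reveals the chosen border step, and the rest of the word
  reveals the smaller tableau.\<close>

lemma phi_inj:
  assumes "1 \<le> n" "tree_like T" "tsize T = n" "tree_like S" "tsize S = n" "phi T = phi S"
  shows "T = S"
  using assms
proof (induction n arbitrary: T S rule: nat_induct_at_least)
  case base
  then show ?case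
    using tree_like_size_1[of T] tree_like_size_1[of S] by simp
next
  case (Suc n)
  obtain T' b r c where T: "insertion T' b r c" "T = add_special b r c T'" "tsize T' = n"
    using tree_like_insertion_ex[OF Suc.prems(1,2)] Suc.hyps by blast
  obtain S' b' r' c' where S: "insertion S' b' r' c'" "S = add_special b' r' c' S'" "tsize S' = n"
    using tree_like_insertion_ex[OF Suc.prems(3,4)] Suc.hyps by blast
  interpret T: insertion T' b r c by (rule T(1))
  interpret S: insertion S' b' r' c' by (rule S(1))
  have perm: "perm_list n (phi T')" "perm_list n (phi S')"
    using phi_tree_like[OF Suc.hyps] T.tree S.tree T(3) S(3) by blast+
  have "insert_at T.site_pos (Suc n) (phi T') = insert_at S.site_pos (Suc n) (phi S')"
    using Suc.prems(5) T.phi_T1 S.phi_T1 T(2,3) S(2,3) by simp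
  moreover have "Suc n \<notin> set (phi T')" "Suc n \<notin> set (phi S')"
    using perm by (auto simp: perm_list_def)
  ultimately have eq: "T.site_pos = S.site_pos" "phi T' = phi S'"
    using insert_at_eq_iff[OF _ _ T.site_pos_le S.site_pos_le, of "Suc n"] by simp_all
  have same: "T' = S'"
    using Suc.IH[OF T.tree T(3) S.tree S(3) eq(2)] .
  have "b = b' \<and> r = r' \<and> c = c'"
    by (rule insertion_site_unique[OF T(1)]) (use S(1) eq(1) same in simp_all)
  then show ?case
    using T(2) S(2) same by simp
qed

lemma phi_surj:
  assumes "1 \<le> n" "perm_list n xs"
  shows "\<exists>T. tree_like T \<and> tsize T = n \<and> phi T = xs"
  using assms
proof (induction n arbitrary: xs rule: nat_induct_at_least)
  case base
  then have "length xs = 1" "set xs = {1}"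
    using length_perm_list[of 1 xs] by (auto simp: perm_list_def)
  then have "xs = [1]"
    by (cases xs) auto
  then show ?case
    using tree_like_singleton phi_singleton by (intro exI[of _ "Tableau {(0, 0)} {(0, 0)}"]) (simp add: tsize_def)
next
  case (Suc n)
  obtain k ys where xs: "xs = insert_at k (Suc n) ys" "perm_list n ys" "k \<le> n"
    using perm_list_SucE[OF Suc.prems] by blast
  obtain T where T: "tree_like T" "tsize T = n" "phi T = ys"
    using Suc.IH[OF xs(2)] by blast
  have "k \<le> length (phi T)"
    using T(3) xs(3) length_perm_list[OF xs(2)] by simp
  then obtain below r c where ins: "insertion T below r c" "insertion.site_pos T below r c = k"
    using insertion_site_ex[OF T(1)] by metis
  interpret insertion T below r c by (rule ins(1))
  show ?case
    using tree_T1 tsize_T1 phi_T1 T xs(1) ins(2) by (intro exI[of _ T1]) simp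
qed

theorem theorem4p7:
  fixes n :: nat
  assumes "n \<ge> 1"
  shows "bij_betw phi (baxter_tlts n) (inverse_twisted_baxter n)"
proof -
  have mem: "T \<in> baxter_tlts n \<longleftrightarrow> tree_like T \<and> tsize T = n \<and> baxter_tlt T" for T
    by (auto simp: baxter_tlts_def baxter_tlt_def)
  show ?thesis
  proof (rule bij_betw_imageI)
    show "inj_on phi (baxter_tlts n)"
      by (rule inj_onI) (use mem phi_inj[OF assms] in blast)
    show "phi ` baxter_tlts n = inverse_twisted_baxter n"
    proof (intro equalityI subsetI)
      fix xs assume "xs \<in> phi ` baxter_tlts n"
      then show "xs \<in> inverse_twisted_baxter n"
        using mem phi_tree_like[OF assms] inverse_twisted_baxter_iff by auto
    next
      fix xs assume "xs \<in> inverse_twisted_baxter n"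
      then have xs: "perm_list n xs" "baxter_list xs"
        by (auto simp: inverse_twisted_baxter_iff)
      then obtain T where "tree_like T" "tsize T = n" "phi T = xs"
        using phi_surj[OF assms] by blast
      then show "xs \<in> phi ` baxter_tlts n"
        using mem phi_tree_like[OF assms] xs(2) by blast
    qed
  qed
qed

end
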